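(* Let $n\in\mathbb{N}\cup\{\infty\}$ and $T\in\mathcal{S}_n(\mathcal{H})$, and let $V$ be the Livsic function corresponding to $T$. Then $T$ is unitarily equivalent to $M^V$, multiplication by the independent variable on the Herglotz space $\mathscr{H}(V)$ (with domain $\{f\in\mathscr{H}(V): zf\in\mathscr{H}(V)\}$). Furthermore, the Livsic function for $M^V$ is $V$ (Livsic functions being identified up to left and right multiplication by constant unitary operators).
   Context: $\mathcal{S}_n(\mathcal{H})$ denotes the set of closed, densely defined linear operators $T:\mathscr{D}(T)\subset\mathcal{H}\to\mathcal{H}$ on a complex separable Hilbert space $\mathcal{H}$ that are symmetric, simple ($\bigcap_{\Im\lambda\neq0}\mathrm{Rng}(T-\lambda I)=\{0\}$), and have deficiency indices $(n,n)$, i.e. $\dim\mathrm{Rng}(T-iI)^\perp=\dim\mathrm{Rng}(T+iI)^\perp=n$. $\mathbb{C}_\pm$ are the open upper/lower half planes. $T_1,T_2$ on $\mathcal{H}_1,\mathcal{H}_2$ are unitarily equivalent if there is a unitary $U:\mathcal{H}_1\to\mathcal{H}_2$ with $U\mathscr{D}(T_1)=\mathscr{D}(T_2)$ and $UT_1=T_2U$. Let $\mathcal{K}$ be a complex separable Hilbert space of dimension $n$. A model for $T$ is a map $\Gamma:\mathbb{C}\setminus\mathbb{R}\to\mathcal{B}(\mathcal{K},\mathcal{H})$ such that: (1) $\Gamma$ is co-analytic; (2) for each $\lambda$, $\Gamma(\lambda)$ is an invertible map from $\mathcal{K}$ onto $\mathrm{Rng}(T-\lambda I)^\perp$; (3)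 $\Gamma(z)^*\Gamma(\lambda)$ is invertible on $\mathcal{K}$ whenever $\lambda,z\in\mathbb{C}_+$ or $\lambda,z\in\mathbb{C}_-$; (4) the closed linear span of $\bigcup_{\Im\lambda\ne0}\mathrm{Rng}\,\Gamma(\lambda)$ is $\mathcal{H}$. Given a model, put $K_\lambda(z)=\Gamma(z)^*\Gamma(\lambda)$, $b(z)=\frac{z-i}{z+i}$, $\Phi(z)=K_i(z)K_i(i)^{-1/2}$, $\Psi(z)=K_{-i}(z)K_{-i}(-i)^{-1/2}$; the Livsic function of $T$ is $V(z)=b(z)\Phi(z)^{-1}\Psi(z)$. It is a $\mathcal{B}(\mathcal{K})$-valued function, analytic and strictly contractive on $\mathbb{C}_+$ with $V(i)=0$, it is determined by $T$ up to left and right multiplication by constant unitary operators, and it satisfies $V(z)V(\overline z)^*=I$ on $\mathbb{C}\setminus\mathbb{R}$ (interpreted suitably at zeros and poles). Put $\Omega(z):=(I+iV(z))(I-iV(z))^{-1}$; this is an analytic $\mathcal{B}(\mathcal{K})$-valued function on $\mathbb{C}\setminus\mathbb{R}$ with $\Re\Omega(z)\ge0$ on $\mathbb{C}_+$ and $\Omega(z)=-\Omega(\overline z)^*$ (which determines $\Omega$ on $\mathbb{C}_-$ from its values on $\mathbb{C}_+$). The Herglotz space $\mathscr{H}(V)$ is the unique $\mathcal{K}$-valued reproducing kernel Hilbert space on $\mathbb{C}\setminus\mathbb{R}$ with the positive definite kernel $$K^V_\lambda(z)=\frac{\Omega(z)+\Omega(\lambda)^*}{\pi i(\overline\lambda-z)}.$$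 *)

theory Defs
  imports "HOL-Analysis.Analysis" "HOL-Library.Function_Algebras" "HOL-Library.Extended_Nat"
begin

section \<open>Complex vector spaces\<close>

class complex_vector = ab_group_add +
  fixes scaleC :: "complex \<Rightarrow> 'a \<Rightarrow> 'a"  (infixr \<open>*\<^sub>C\<close> 75)
  assumes scaleC_add_right: "a *\<^sub>C (x + y) = a *\<^sub>C x + a *\<^sub>C y"
    and scaleC_add_left: "(a + b) *\<^sub>C x = a *\<^sub>C x + b *\<^sub>C x"
    and scaleC_scaleC: "a *\<^sub>C b *\<^sub>C x = (a * b) *\<^sub>C x"
    and scaleC_one: "1 *\<^sub>C x = x"

global_interpretation complex_vector:
  vector_space "scaleC :: complex \<Rightarrow> 'a \<Rightarrow> 'a::complex_vector"
  by standard (simp_all add: scaleC_add_right scaleC_add_left scaleC_scaleC scaleC_one)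

instantiation "fun" :: (type, complex_vector) complex_vector
begin

definition scaleC_fun :: "complex \<Rightarrow> ('a \<Rightarrow> 'b) \<Rightarrow> 'a \<Rightarrow> 'b" where
  "scaleC_fun a f = (\<lambda>x. a *\<^sub>C f x)"

instance
  by standard
    (simp_all add: scaleC_fun_def fun_eq_iff scaleC_add_right scaleC_add_left
      scaleC_scaleC scaleC_one)

end


section \<open>Complex Hilbert spaces\<close>

text \<open>
  A Hilbert space is given by a linear subspace of an ambient complex vector space together with
  an inner product whose values matter on this carrier only.  In this way abstract spaces and
  spaces of vector-valued functions are treated alike.  The inner product is linear in its first
  argument.  Operators are functions on the ambient types whose values matter on carriers only.
\<close>

record 'a hspace =
  car :: "'a set"
  ip :: "'a \<Rightarrow> 'a \<Rightarrow> complex"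

definition inner_space :: "'a::complex_vector hspace \<Rightarrow> bool" where
  "inner_space H \<longleftrightarrow>
     complex_vector.subspace (car H) \<and>
     (\<forall>x\<in>car H. \<forall>y\<in>car H. \<forall>z\<in>car H. ip H (x + y) z = ip H x z + ip H y z) \<and>
     (\<forall>a. \<forall>x\<in>car H. \<forall>y\<in>car H. ip H (a *\<^sub>C x) y = a * ip H x y) \<and>
     (\<forall>x\<in>car H. \<forall>y\<in>car H. ip H y x = cnj (ip H x y)) \<and>
     (\<forall>x\<in>car H. 0 \<le> Re (ip H x x)) \<and>
     (\<forall>x\<in>car H. ip H x x = 0 \<longrightarrow> x = 0)"

definition hnorm :: "'a hspace \<Rightarrow> 'a \<Rightarrow> real" where
  "hnorm H x = sqrt (Re (ip H x x))"

text \<open>The distance is totalised by 0 because \<^locale>\<open>Metric_space\<close> demands symmetry and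
  nonnegativity off the carrier as well.\<close>

definition hdist :: "'a::complex_vector hspace \<Rightarrow> 'a \<Rightarrow> 'a \<Rightarrow> real" where
  "hdist H x y = (if x \<in> car H \<and> y \<in> car H then hnorm H (x - y) else 0)"

definition htop :: "'a::complex_vector hspace \<Rightarrow> 'a topology" where
  "htop H = Metric_space.mtopology (car H) (hdist H)"

definition hilbert_space :: "'a::complex_vector hspace \<Rightarrow> bool" where
  "hilbert_space H \<longleftrightarrow> inner_space H \<and> Metric_space.mcomplete (car H) (hdist H)"

definition separable_hilbert_space :: "'a::complex_vector hspace \<Rightarrow> bool" where
  "separable_hilbert_space H \<longleftrightarrow> hilbert_space H \<and> separable_space (htop H)"

definition closed_span :: "'a::complex_vector hspace \<Rightarrow> 'a set \<Rightarrow> 'a set" where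
  "closed_span H S = htop H closure_of complex_vector.span S"

definition ortho :: "'a hspace \<Rightarrow> 'a set \<Rightarrow> 'a set" where
  "ortho H S = {x \<in> car H. \<forall>y\<in>S. ip H x y = 0}"

abbreviation restr :: "'a hspace \<Rightarrow> 'a set \<Rightarrow> 'a hspace" where
  "restr H S \<equiv> H\<lparr>car := S\<rparr>"

text \<open>Hilbert space dimension, used for separable spaces only, so that the value \<infinity> stands for a
  countably infinite orthonormal basis.\<close>

definition has_hdim :: "'a::complex_vector hspace \<Rightarrow> enat \<Rightarrow> bool" where
  "has_hdim H n \<longleftrightarrow>
     (\<exists>B. B \<subseteq> car H \<and>
          (\<forall>x\<in>B. \<forall>y\<in>B. ip H x y = (if x = y then 1 else 0)) \<and>
          closed_span H B = car H \<and>
          n = (if finite B then enat (card B) else \<infinity>))"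


section \<open>Bounded operators\<close>

definition linear_on :: "'a::complex_vector set \<Rightarrow> ('a \<Rightarrow> 'b::complex_vector) \<Rightarrow> bool" where
  "linear_on S A \<longleftrightarrow>
     (\<forall>x\<in>S. \<forall>y\<in>S. A (x + y) = A x + A y) \<and> (\<forall>a. \<forall>x\<in>S. A (a *\<^sub>C x) = a *\<^sub>C A x)"

definition bounded_op ::
    "'a::complex_vector hspace \<Rightarrow> 'b::complex_vector hspace \<Rightarrow> ('a \<Rightarrow> 'b) \<Rightarrow> bool" where
  "bounded_op H1 H2 A \<longleftrightarrow>
     linear_on (car H1) A \<and> A ` car H1 \<subseteq> car H2 \<and>
     (\<exists>C. \<forall>x\<in>car H1. hnorm H2 (A x) \<le> C * hnorm H1 x)"

definition invertible_op ::
    "'a::complex_vector hspace \<Rightarrow> 'b::complex_vector hspace \<Rightarrow> ('a \<Rightarrow> 'b) \<Rightarrow> bool" where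
  "invertible_op H1 H2 A \<longleftrightarrow>
     bounded_op H1 H2 A \<and>
     (\<exists>B. bounded_op H2 H1 B \<and> (\<forall>x\<in>car H1. B (A x) = x) \<and> (\<forall>y\<in>car H2. A (B y) = y))"

abbreviation op_inv :: "'a hspace \<Rightarrow> ('a \<Rightarrow> 'b) \<Rightarrow> 'b \<Rightarrow> 'a" where
  "op_inv H A \<equiv> inv_into (car H) A"

definition adj :: "'a hspace \<Rightarrow> 'b hspace \<Rightarrow> ('a \<Rightarrow> 'b) \<Rightarrow> 'b \<Rightarrow> 'a" where
  "adj H1 H2 A y = (THE x. x \<in> car H1 \<and> (\<forall>v\<in>car H1. ip H2 (A v) y = ip H1 v x))"

definition positive_op :: "'a::complex_vector hspace \<Rightarrow> ('a \<Rightarrow> 'a) \<Rightarrow> bool" where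
  "positive_op H A \<longleftrightarrow>
     bounded_op H H A \<and> (\<forall>x\<in>car H. Im (ip H (A x) x) = 0 \<and> 0 \<le> Re (ip H (A x) x))"

text \<open>The positive square root is unique on the carrier; it is normalised to 0 outside.\<close>

definition op_sqrt :: "'a::complex_vector hspace \<Rightarrow> ('a \<Rightarrow> 'a) \<Rightarrow> 'a \<Rightarrow> 'a" where
  "op_sqrt H A =
     (THE B. positive_op H B \<and> (\<forall>x\<in>car H. B (B x) = A x) \<and> (\<forall>x. x \<notin> car H \<longrightarrow> B x = 0))"

definition unitary_op ::
    "'a::complex_vector hspace \<Rightarrow> 'b::complex_vector hspace \<Rightarrow> ('a \<Rightarrow> 'b) \<Rightarrow> bool" where
  "unitary_op H1 H2 U \<longleftrightarrow>
     linear_on (car H1) U \<and> U ` car H1 = car H2 \<and>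
     (\<forall>x\<in>car H1. \<forall>y\<in>car H1. ip H2 (U x) (U y) = ip H1 x y)"

text \<open>Complex differentiability with respect to the operator norm at every point of \<open>S\<close>
  (which is open whenever this is used).\<close>

definition op_analytic_on ::
    "'a::complex_vector hspace \<Rightarrow> 'b::complex_vector hspace \<Rightarrow> (complex \<Rightarrow> 'a \<Rightarrow> 'b)
      \<Rightarrow> complex set \<Rightarrow> bool" where
  "op_analytic_on H1 H2 F S \<longleftrightarrow>
     (\<forall>z\<in>S. \<exists>D. bounded_op H1 H2 D \<and>
        (\<forall>e>0. \<forall>\<^sub>F w in at z. \<forall>x\<in>car H1.
           hnorm H2 (inverse (w - z) *\<^sub>C (F w x - F z x) - D x) \<le> e * hnorm H1 x))"

definition nonreal :: "complex set" where
  "nonreal = {z. Im z \<noteq> 0}"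

definition op_coanalytic ::
    "'a::complex_vector hspace \<Rightarrow> 'b::complex_vector hspace \<Rightarrow> (complex \<Rightarrow> 'a \<Rightarrow> 'b) \<Rightarrow> bool"
  where
  "op_coanalytic H1 H2 F \<longleftrightarrow> op_analytic_on H1 H2 (\<lambda>z. F (cnj z)) nonreal"


section \<open>Symmetric operators\<close>

record 'a lin_op =
  opdom :: "'a set"
  opapp :: "'a \<Rightarrow> 'a"

definition op_range :: "'a::complex_vector lin_op \<Rightarrow> complex \<Rightarrow> 'a set" where
  "op_range T \<mu> = (\<lambda>x. opapp T x - \<mu> *\<^sub>C x) ` opdom T"

definition linear_operator :: "'a::complex_vector hspace \<Rightarrow> 'a lin_op \<Rightarrow> bool" where
  "linear_operator H T \<longleftrightarrow>
     complex_vector.subspace (opdom T) \<and> opdom T \<subseteq> car H \<and>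
     opapp T ` opdom T \<subseteq> car H \<and> linear_on (opdom T) (opapp T)"

definition densely_defined :: "'a::complex_vector hspace \<Rightarrow> 'a lin_op \<Rightarrow> bool" where
  "densely_defined H T \<longleftrightarrow> htop H closure_of opdom T = car H"

definition closed_operator :: "'a::complex_vector hspace \<Rightarrow> 'a lin_op \<Rightarrow> bool" where
  "closed_operator H T \<longleftrightarrow>
     closedin (prod_topology (htop H) (htop H)) ((\<lambda>x. (x, opapp T x)) ` opdom T)"

definition symmetric_operator :: "'a hspace \<Rightarrow> 'a lin_op \<Rightarrow> bool" where
  "symmetric_operator H T \<longleftrightarrow>
     (\<forall>x\<in>opdom T. \<forall>y\<in>opdom T. ip H (opapp T x) y = ip H x (opapp T y))"

definition simple_operator :: "'a::complex_vector lin_op \<Rightarrow> bool" where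
  "simple_operator T \<longleftrightarrow> (\<Inter>\<mu>\<in>nonreal. op_range T \<mu>) = {0}"

definition sym_class :: "enat \<Rightarrow> 'a::complex_vector hspace \<Rightarrow> 'a lin_op set"
  (\<open>\<S>\<^bsub>_\<^esub>\<close>) where
  "\<S>\<^bsub>n\<^esub> H = {T.
     separable_hilbert_space H \<and>
     linear_operator H T \<and> densely_defined H T \<and> closed_operator H T \<and>
     symmetric_operator H T \<and> simple_operator T \<and>
     has_hdim (restr H (ortho H (op_range T \<i>))) n \<and>
     has_hdim (restr H (ortho H (op_range T (- \<i>)))) n}"

definition unitarily_equivalent ::
    "'a::complex_vector hspace \<Rightarrow> 'a lin_op \<Rightarrow> 'b::complex_vector hspace \<Rightarrow> 'b lin_op \<Rightarrow> bool"
  where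
  "unitarily_equivalent H1 T1 H2 T2 \<longleftrightarrow>
     (\<exists>U. unitary_op H1 H2 U \<and> U ` opdom T1 = opdom T2 \<and>
          (\<forall>x\<in>opdom T1. U (opapp T1 x) = opapp T2 (U x)))"


section \<open>Models and Livsic functions\<close>

definition model_kernel ::
    "'k::complex_vector hspace \<Rightarrow> 'h::complex_vector hspace \<Rightarrow> (complex \<Rightarrow> 'k \<Rightarrow> 'h)
      \<Rightarrow> complex \<Rightarrow> complex \<Rightarrow> 'k \<Rightarrow> 'k" where
  "model_kernel K H \<Gamma> \<mu> z = (\<lambda>x. adj K H (\<Gamma> z) (\<Gamma> \<mu> x))"

definition is_model ::
    "'k::complex_vector hspace \<Rightarrow> 'h::complex_vector hspace \<Rightarrow> 'h lin_op
      \<Rightarrow> (complex \<Rightarrow> 'k \<Rightarrow> 'h) \<Rightarrow> bool" where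
  "is_model K H T \<Gamma> \<longleftrightarrow>
     (\<forall>\<mu>\<in>nonreal. bounded_op K H (\<Gamma> \<mu>)) \<and>
     op_coanalytic K H \<Gamma> \<and>
     (\<forall>\<mu>\<in>nonreal. invertible_op K (restr H (ortho H (op_range T \<mu>))) (\<Gamma> \<mu>)) \<and>
     (\<forall>\<mu> z. (0 < Im \<mu> \<and> 0 < Im z \<or> Im \<mu> < 0 \<and> Im z < 0) \<longrightarrow>
        invertible_op K K (model_kernel K H \<Gamma> \<mu> z)) \<and>
     closed_span H (\<Union>\<mu>\<in>nonreal. \<Gamma> \<mu> ` car K) = car H"

definition model_Phi ::
    "'k::complex_vector hspace \<Rightarrow> 'h::complex_vector hspace \<Rightarrow> (complex \<Rightarrow> 'k \<Rightarrow> 'h)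
      \<Rightarrow> complex \<Rightarrow> 'k \<Rightarrow> 'k" where
  "model_Phi K H \<Gamma> z =
     (\<lambda>x. model_kernel K H \<Gamma> \<i> z (op_inv K (op_sqrt K (model_kernel K H \<Gamma> \<i> \<i>)) x))"

definition model_Psi ::
    "'k::complex_vector hspace \<Rightarrow> 'h::complex_vector hspace \<Rightarrow> (complex \<Rightarrow> 'k \<Rightarrow> 'h)
      \<Rightarrow> complex \<Rightarrow> 'k \<Rightarrow> 'k" where
  "model_Psi K H \<Gamma> z =
     (\<lambda>x. model_kernel K H \<Gamma> (- \<i>) z
            (op_inv K (op_sqrt K (model_kernel K H \<Gamma> (- \<i>) (- \<i>))) x))"

text \<open>
  On the upper half plane the first case always applies for a model.  On the lower half plane
  the function may have singularities: at \<open>- \<i>\<close>, where \<open>b\<close> has its pole, and where \<open>\<Phi> z\<close>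
  fails to be invertible.  At these points, which are those where \<open>V (cnj z)\<close> is not invertible,
  the value is set to 0.
\<close>

definition livsic ::
    "'k::complex_vector hspace \<Rightarrow> 'h::complex_vector hspace \<Rightarrow> (complex \<Rightarrow> 'k \<Rightarrow> 'h)
      \<Rightarrow> complex \<Rightarrow> 'k \<Rightarrow> 'k" where
  "livsic K H \<Gamma> z =
     (if z \<noteq> - \<i> \<and> invertible_op K K (model_Phi K H \<Gamma> z)
      then (\<lambda>x. ((z - \<i>) / (z + \<i>)) *\<^sub>C op_inv K (model_Phi K H \<Gamma> z) (model_Psi K H \<Gamma> z x))
      else (\<lambda>x. 0))"

definition is_livsic_function ::
    "'k::complex_vector hspace \<Rightarrow> 'h::complex_vector hspace \<Rightarrow> 'h lin_op
      \<Rightarrow> (complex \<Rightarrow> 'k \<Rightarrow> 'k) \<Rightarrow> bool" where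
  "is_livsic_function K H T V \<longleftrightarrow>
     (\<exists>\<Gamma>. is_model K H T \<Gamma> \<and> (\<forall>z\<in>nonreal. \<forall>x\<in>car K. V z x = livsic K H \<Gamma> z x))"

text \<open>Equality of Livsic functions up to constant unitary factors on the left and the right.\<close>

definition livsic_equiv ::
    "'k::complex_vector hspace \<Rightarrow> (complex \<Rightarrow> 'k \<Rightarrow> 'k) \<Rightarrow> (complex \<Rightarrow> 'k \<Rightarrow> 'k) \<Rightarrow> bool" where
  "livsic_equiv K V W \<longleftrightarrow>
     (\<exists>R Q. unitary_op K K R \<and> unitary_op K K Q \<and>
        (\<forall>z\<in>nonreal. \<forall>x\<in>car K. W z x = R (V z (Q x))))"


section \<open>Herglotz spaces\<close>

text \<open>Functions on \<open>X\<close> are represented by functions vanishing off \<open>X\<close>; \<open>k \<mu> z\<close> is the operator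
  \<open>k\<^sub>\<mu>(z)\<close>.\<close>

definition is_rkhs ::
    "'x set \<Rightarrow> 'k::complex_vector hspace \<Rightarrow> ('x \<Rightarrow> 'x \<Rightarrow> 'k \<Rightarrow> 'k) \<Rightarrow> ('x \<Rightarrow> 'k) hspace \<Rightarrow> bool"
  where
  "is_rkhs X K k S \<longleftrightarrow>
     hilbert_space S \<and>
     (\<forall>f\<in>car S. (\<forall>z\<in>X. f z \<in> car K) \<and> (\<forall>z. z \<notin> X \<longrightarrow> f z = 0)) \<and>
     (\<forall>\<mu>\<in>X. \<forall>x\<in>car K.
        (\<lambda>z. if z \<in> X then k \<mu> z x else 0) \<in> car S \<and>
        (\<forall>f\<in>car S. ip S f (\<lambda>z. if z \<in> X then k \<mu> z x else 0) = ip K (f \<mu>) x))"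

text \<open>The inner product is normalised to 0 off the carrier so that the record is unique.\<close>

definition rkhs ::
    "'x set \<Rightarrow> 'k::complex_vector hspace \<Rightarrow> ('x \<Rightarrow> 'x \<Rightarrow> 'k \<Rightarrow> 'k) \<Rightarrow> ('x \<Rightarrow> 'k) hspace" where
  "rkhs X K k =
     (THE S. is_rkhs X K k S \<and> (\<forall>f g. f \<notin> car S \<or> g \<notin> car S \<longrightarrow> ip S f g = 0))"

text \<open>\<open>\<Omega> = (I + \<i> V) (I - \<i> V)\<^sup>-\<^sup>1\<close> on the upper half plane, where \<open>V\<close> is strictly contractive;
  on the lower half plane \<open>\<Omega> z = - (\<Omega> (cnj z))\<^sup>*\<close>, which covers also the singularities of \<open>V\<close>.\<close>

definition herglotz_upper ::
    "'k::complex_vector hspace \<Rightarrow> (complex \<Rightarrow> 'k \<Rightarrow> 'k) \<Rightarrow> complex \<Rightarrow> 'k \<Rightarrow> 'k" where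
  "herglotz_upper K V z =
     (\<lambda>x. let y = op_inv K (\<lambda>u. u - \<i> *\<^sub>C V z u) x in y + \<i> *\<^sub>C V z y)"

definition herglotz_Omega ::
    "'k::complex_vector hspace \<Rightarrow> (complex \<Rightarrow> 'k \<Rightarrow> 'k) \<Rightarrow> complex \<Rightarrow> 'k \<Rightarrow> 'k" where
  "herglotz_Omega K V z =
     (if 0 < Im z then herglotz_upper K V z
      else (\<lambda>x. - adj K K (herglotz_upper K V (cnj z)) x))"

definition herglotz_quotient ::
    "'k::complex_vector hspace \<Rightarrow> (complex \<Rightarrow> 'k \<Rightarrow> 'k) \<Rightarrow> complex \<Rightarrow> complex \<Rightarrow> 'k \<Rightarrow> 'k" where
  "herglotz_quotient K V \<mu> z =
     (\<lambda>x. inverse (of_real pi * \<i> * (cnj \<mu> - z)) *\<^sub>C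
            (herglotz_Omega K V z x + adj K K (herglotz_Omega K V \<mu>) x))"

text \<open>The quotient has the form \<open>0 / 0\<close> at \<open>z = cnj \<mu>\<close>, a removable singularity.\<close>

definition herglotz_kernel ::
    "'k::complex_vector hspace \<Rightarrow> (complex \<Rightarrow> 'k \<Rightarrow> 'k) \<Rightarrow> complex \<Rightarrow> complex \<Rightarrow> 'k \<Rightarrow> 'k" where
  "herglotz_kernel K V \<mu> z =
     (\<lambda>x. if z = cnj \<mu> then (THE l. limitin (htop K) (\<lambda>w. herglotz_quotient K V \<mu> w x) l (at z))
          else herglotz_quotient K V \<mu> z x)"

definition herglotz_space ::
    "'k::complex_vector hspace \<Rightarrow> (complex \<Rightarrow> 'k \<Rightarrow> 'k) \<Rightarrow> (complex \<Rightarrow> 'k) hspace" where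
  "herglotz_space K V = rkhs nonreal K (herglotz_kernel K V)"

definition mult_operator ::
    "(complex \<Rightarrow> 'k::complex_vector) hspace \<Rightarrow> (complex \<Rightarrow> 'k) lin_op" where
  "mult_operator S =
     \<lparr>opdom = {f \<in> car S. (\<lambda>z. z *\<^sub>C f z) \<in> car S}, opapp = (\<lambda>f z. z *\<^sub>C f z)\<rparr>"

end

theory Submission
  imports Defs
begin

text \<open>
  For a model \<open>\<Gamma>\<close> of \<open>T\<close> the map \<open>f \<mapsto> (z \<mapsto> \<Gamma>(z)\<^sup>* f)\<close> is injective by simplicity, and it turns \<open>T\<close> into
  multiplication by \<open>z\<close> because the kernel of \<open>\<Gamma>(z)\<^sup>*\<close> is the range of \<open>T - z\<close>.  Applying the Cayley
  transform of \<open>T\<close> to \<open>\<Gamma>(\<mu>) x\<close> gives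
  \<open>(z + \<i>)(cnj \<mu> - \<i>) \<Phi>(z) \<Phi>(\<mu>)\<^sup>* - (z - \<i>)(cnj \<mu> + \<i>) \<Psi>(z) \<Psi>(\<mu>)\<^sup>* = 2 \<i> (cnj \<mu> - z) \<Gamma>(z)\<^sup>* \<Gamma>(\<mu>)\<close>.
  With \<open>E(z) = (z + \<i>) \<Phi>(z) - \<i> (z - \<i>) \<Psi>(z)\<close>, which is invertible on both half planes, this identity says that
  the Herglotz kernel is \<open>G(z) G(\<mu>)\<^sup>*\<close> for \<open>G(z) = (2 / sqrt \<pi>) E(z)\<^sup>-\<^sup>1 \<Gamma>(z)\<^sup>*\<close>.  Hence \<open>f \<mapsto> (z \<mapsto> G(z) f)\<close> is a
  unitary map onto the Herglotz space.  Two models of the same operator differ by an invertible factor on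
  the right, which changes \<open>\<Phi>\<^sup>-\<^sup>1 \<Psi>\<close> only by constant unitary factors.
\<close>

section \<open>Geometry of Hilbert spaces\<close>

text \<open>What makes the identity work is its sign. For \<open>\<mu> = z\<close> its right-hand
  side is a multiple of \<open>Im z\<close>, so the adjoint of \<open>(z + \<i>) \<Phi>(z)\<close>
  strictly dominates that of \<open>(z - \<i>) \<Psi>(z)\<close> above the real axis, and the roles
  are exchanged below; either way \<open>E(z)\<close> is invertible. For
  \<open>\<mu> = cnj z\<close> the right-hand side vanishes, which is exactly the reflection rule
  that defines \<open>\<Omega>\<close> below the axis. So the Herglotz kernel reads \<open>V\<close>
  only on the upper half plane, where \<open>\<Phi>(z)\<close> is invertible and the default value
  of \<open>livsic\<close> never occurs. The obstacle is that adjoints, square roots, the kernel at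
  \<open>z = cnj \<mu>\<close> and the Herglotz space itself are definite descriptions on carriers.
  Each has to be shown to exist and to be unique: by Riesz representation, by an iteration, by
  continuity in operator norm, and by comparing two reproducing kernel spaces. Nothing about
  multiplication by \<open>z\<close> is checked inside the Herglotz space except its domain;
  closedness, density, simplicity and deficiency indices are carried over from \<open>T\<close> by
  the unitary map.\<close>

lemma linear_on_add: "linear_on S A \<Longrightarrow> x \<in> S \<Longrightarrow> y \<in> S \<Longrightarrow> A (x + y) = A x + A y"
  by (simp add: linear_on_def)

lemma linear_on_scaleC: "linear_on S A \<Longrightarrow> x \<in> S \<Longrightarrow> A (a *\<^sub>C x) = a *\<^sub>C A x"
  by (simp add: linear_on_def)

lemma linear_on_diff:
  assumes "linear_on S A" "complex_vector.subspace S" "x \<in> S" "y \<in> S"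
  shows "A (x - y) = A x - A y"
  using linear_on_add[OF assms(1) complex_vector.subspace_diff[OF assms(2,3,4)] assms(4)] by simp

lemma linear_on_0:
  assumes "linear_on S A" "complex_vector.subspace S"
  shows "A 0 = 0"
  using linear_on_diff[OF assms, of 0 0] assms(2) complex_vector.subspace_0 by fastforce

lemma linear_on_subset: "linear_on S A \<Longrightarrow> S' \<subseteq> S \<Longrightarrow> linear_on S' A"
  by (auto simp: linear_on_def subset_iff)


locale cinner =
  fixes H :: "'a::complex_vector hspace"
  assumes inner: "inner_space H"
begin

lemma sub: "complex_vector.subspace (car H)"
  using inner by (simp add: inner_space_def)

lemma zero_car [simp, intro]: "0 \<in> car H"
  and add_car [simp, intro]: "x \<in> car H \<Longrightarrow> y \<in> car H \<Longrightarrow> x + y \<in> car H"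
  and diff_car [simp, intro]: "x \<in> car H \<Longrightarrow> y \<in> car H \<Longrightarrow> x - y \<in> car H"
  and minus_car [simp, intro]: "x \<in> car H \<Longrightarrow> - x \<in> car H"
  and scaleC_car [simp, intro]: "x \<in> car H \<Longrightarrow> a *\<^sub>C x \<in> car H"
  by (simp_all add: sub complex_vector.subspace_0 complex_vector.subspace_add
      complex_vector.subspace_diff complex_vector.subspace_neg complex_vector.subspace_scale)

lemma inner_axioms:
  "\<forall>x\<in>car H. \<forall>y\<in>car H. \<forall>z\<in>car H. ip H (x + y) z = ip H x z + ip H y z"
  "\<forall>a. \<forall>x\<in>car H. \<forall>y\<in>car H. ip H (a *\<^sub>C x) y = a * ip H x y"
  "\<forall>x\<in>car H. \<forall>y\<in>car H. ip H y x = cnj (ip H x y)"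
  "\<forall>x\<in>car H. 0 \<le> Re (ip H x x)"
  "\<forall>x\<in>car H. ip H x x = 0 \<longrightarrow> x = 0"
  by (insert inner[unfolded inner_space_def], (elim conjE, assumption)+)

lemma ip_add_left [simp]:
    "x \<in> car H \<Longrightarrow> y \<in> car H \<Longrightarrow> z \<in> car H \<Longrightarrow> ip H (x + y) z = ip H x z + ip H y z"
  using inner_axioms(1) by blast

lemma ip_scaleC_left [simp]: "x \<in> car H \<Longrightarrow> y \<in> car H \<Longrightarrow> ip H (a *\<^sub>C x) y = a * ip H x y"
  using inner_axioms(2) by blast

lemma ip_commute: "x \<in> car H \<Longrightarrow> y \<in> car H \<Longrightarrow> ip H y x = cnj (ip H x y)"
  by (rule inner_axioms(3)[rule_format])

lemma ip_ge_zero: "x \<in> car H \<Longrightarrow> 0 \<le> Re (ip H x x)"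
  using inner_axioms(4) by blast

lemma ip_eq_zero: "x \<in> car H \<Longrightarrow> ip H x x = 0 \<Longrightarrow> x = 0"
  using inner_axioms(5) by blast

lemma ip_add_right [simp]:
  "x \<in> car H \<Longrightarrow> y \<in> car H \<Longrightarrow> z \<in> car H \<Longrightarrow> ip H z (x + y) = ip H z x + ip H z y"
  by (metis add_car complex_cnj_add ip_add_left ip_commute)

lemma ip_scaleC_right [simp]:
  "x \<in> car H \<Longrightarrow> y \<in> car H \<Longrightarrow> ip H x (a *\<^sub>C y) = cnj a * ip H x y"
  by (metis complex_cnj_mult ip_commute ip_scaleC_left scaleC_car)

lemma ip_diff_left [simp]:
  "x \<in> car H \<Longrightarrow> y \<in> car H \<Longrightarrow> z \<in> car H \<Longrightarrow> ip H (x - y) z = ip H x z - ip H y z"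
  using ip_add_left[of "x - y" y z] by simp

lemma ip_diff_right [simp]:
  "x \<in> car H \<Longrightarrow> y \<in> car H \<Longrightarrow> z \<in> car H \<Longrightarrow> ip H z (x - y) = ip H z x - ip H z y"
  by (metis complex_cnj_diff diff_car ip_commute ip_diff_left)

lemma ip_zero_left [simp]: "x \<in> car H \<Longrightarrow> ip H 0 x = 0"
  by (metis diff_self ip_diff_left)

lemma ip_zero_right [simp]: "x \<in> car H \<Longrightarrow> ip H x 0 = 0"
  by (metis diff_self ip_diff_right)

lemma ip_minus_left [simp]: "x \<in> car H \<Longrightarrow> y \<in> car H \<Longrightarrow> ip H (- x) y = - ip H x y"
  using ip_diff_left[of 0 x y] by simp

lemma ip_minus_right [simp]: "x \<in> car H \<Longrightarrow> y \<in> car H \<Longrightarrow> ip H x (- y) = - ip H x y"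
  using ip_diff_right[of 0 y x] by simp

lemma ip_self: "x \<in> car H \<Longrightarrow> ip H x x = of_real ((hnorm H x)\<^sup>2)"
proof -
  assume x: "x \<in> car H"
  have "Im (ip H x x) = 0"
    using arg_cong[OF ip_commute[OF x x], of Im] by simp
  then show ?thesis using ip_ge_zero[OF x] by (simp add: hnorm_def complex_eq_iff)
qed

lemma Re_ip_self: "x \<in> car H \<Longrightarrow> Re (ip H x x) = (hnorm H x)\<^sup>2"
  by (simp add: ip_self)

lemma hnorm_nonneg [simp]: "x \<in> car H \<Longrightarrow> 0 \<le> hnorm H x"
  by (simp add: hnorm_def ip_ge_zero)

lemma hnorm_zero [simp]: "hnorm H 0 = 0"
  by (simp add: hnorm_def)

lemma hnorm_eq_zero [simp]: "x \<in> car H \<Longrightarrow> hnorm H x = 0 \<longleftrightarrow> x = 0"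
  using ip_eq_zero ip_self by fastforce

lemma hnorm_scaleC [simp]: "x \<in> car H \<Longrightarrow> hnorm H (a *\<^sub>C x) = cmod a * hnorm H x"
proof -
  assume x: "x \<in> car H"
  have "(hnorm H (a *\<^sub>C x))\<^sup>2 = Re ((a * cnj a) * ip H x x)"
    using x by (simp add: mult.assoc algebra_simps flip: Re_ip_self)
  also have "\<dots> = (cmod a * hnorm H x)\<^sup>2"
    using x by (simp add: ip_self power_mult_distrib flip: complex_norm_square of_real_power of_real_mult)
  finally show ?thesis using x by (simp add: power2_eq_iff_nonneg)
qed

lemma hnorm_minus [simp]: "x \<in> car H \<Longrightarrow> hnorm H (- x) = hnorm H x"
  by (simp add: hnorm_def)

lemma hnorm_diff_commute: "x \<in> car H \<Longrightarrow> y \<in> car H \<Longrightarrow> hnorm H (x - y) = hnorm H (y - x)"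
  by (metis diff_car hnorm_minus minus_diff_eq)

lemma hnorm_add_sq: "x \<in> car H \<Longrightarrow> y \<in> car H \<Longrightarrow>
    (hnorm H (x + y))\<^sup>2 = (hnorm H x)\<^sup>2 + 2 * Re (ip H x y) + (hnorm H y)\<^sup>2"
  by (simp add: ip_commute[of x y] flip: Re_ip_self)

lemma hnorm_diff_sq: "x \<in> car H \<Longrightarrow> y \<in> car H \<Longrightarrow>
    (hnorm H (x - y))\<^sup>2 = (hnorm H x)\<^sup>2 - 2 * Re (ip H x y) + (hnorm H y)\<^sup>2"
  by (simp add: ip_commute[of x y] flip: Re_ip_self)

lemma cauchy_schwarz: "x \<in> car H \<Longrightarrow> y \<in> car H \<Longrightarrow> cmod (ip H x y) \<le> hnorm H x * hnorm H y"
proof (cases "y = 0")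
  case False
  assume x: "x \<in> car H" and y: "y \<in> car H"
  define c where "c = ip H x y"
  define m where "m = (hnorm H y)\<^sup>2"
  have m: "m > 0" using False y unfolding m_def by (simp add: less_le)
  have ipc: "ip H (of_real m *\<^sub>C x) (c *\<^sub>C y) = of_real (m * (cmod c)\<^sup>2)"
    using x y complex_norm_square[of c] by (simp add: c_def mult.commute)
  \<comment> \<open>This vector is \<open>m\<close> times the component of \<open>x\<close>
    orthogonal to \<open>y\<close>; scaling by \<open>m\<close> avoids a division.\<close>
  have "0 \<le> (hnorm H (of_real m *\<^sub>C x - c *\<^sub>C y))\<^sup>2" by simp
  also have "\<dots> = m\<^sup>2 * (hnorm H x)\<^sup>2 - 2 * (m * (cmod c)\<^sup>2) + (cmod c)\<^sup>2 * m"
    using x y m by (subst hnorm_diff_sq)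
      (simp_all add: ipc m_def[symmetric] power_mult_distrib del: ip_scaleC_left ip_scaleC_right)
  also have "\<dots> = m * (m * (hnorm H x)\<^sup>2 - (cmod c)\<^sup>2)"
    by (simp add: power2_eq_square algebra_simps)
  finally have "(cmod c)\<^sup>2 \<le> (hnorm H x * hnorm H y)\<^sup>2"
    using m by (simp add: zero_le_mult_iff m_def power_mult_distrib mult.commute)
  then show ?thesis using x y unfolding c_def by (intro power2_le_imp_le[of "cmod _"]) auto
qed simp

lemma hnorm_triangle: "x \<in> car H \<Longrightarrow> y \<in> car H \<Longrightarrow> hnorm H (x + y) \<le> hnorm H x + hnorm H y"
proof -
  assume x: "x \<in> car H" and y: "y \<in> car H"
  have "Re (ip H x y) \<le> hnorm H x * hnorm H y"
    using cauchy_schwarz[OF x y] complex_Re_le_cmod order_trans by blast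
  then have "(hnorm H (x + y))\<^sup>2 \<le> (hnorm H x + hnorm H y)\<^sup>2"
    using x y by (simp add: hnorm_add_sq power2_sum)
  then show ?thesis using x y by (intro power2_le_imp_le[of "hnorm H (x + y)"]) auto
qed

lemma hnorm_triangle_diff: "x \<in> car H \<Longrightarrow> y \<in> car H \<Longrightarrow> hnorm H (x - y) \<le> hnorm H x + hnorm H y"
  using hnorm_triangle[of x "- y"] by simp

sublocale Metric_space "car H" "hdist H"
proof
  fix x y z
  show "0 \<le> hdist H x y" by (simp add: hdist_def)
  show "hdist H x y = hdist H y x" by (simp add: hdist_def hnorm_diff_commute)
  show "x \<in> car H \<Longrightarrow> y \<in> car H \<Longrightarrow> (hdist H x y = 0) = (x = y)" by (simp add: hdist_def)
  assume "x \<in> car H" "y \<in> car H" "z \<in> car H"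
  then show "hdist H x z \<le> hdist H x y + hdist H y z"
    using hnorm_triangle[of "x - y" "y - z"] by (simp add: hdist_def)
qed

lemma htop_eq: "htop H = mtopology"
  by (simp add: htop_def)

lemma topspace_htop [simp]: "topspace (htop H) = car H"
  by (simp add: htop_eq)

lemma limitin_htop:
  "limitin (htop H) f l F \<longleftrightarrow>
    l \<in> car H \<and> eventually (\<lambda>w. f w \<in> car H) F \<and> ((\<lambda>w. hnorm H (f w - l)) \<longlongrightarrow> 0) F"
  (is "?L \<longleftrightarrow> ?R")
proof -
  have "?L \<longleftrightarrow> l \<in> car H \<and> eventually (\<lambda>w. f w \<in> car H) F \<and> ((\<lambda>w. hdist H (f w) l) \<longlongrightarrow> 0) F"
    by (simp add: htop_eq limitin_metric_dist_null)
  also have "\<dots> \<longleftrightarrow> ?R"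
  proof (intro conj_cong refl)
    assume l: "l \<in> car H" and ev: "eventually (\<lambda>w. f w \<in> car H) F"
    have "eventually (\<lambda>w. hdist H (f w) l = hnorm H (f w - l)) F"
      using ev by eventually_elim (simp add: hdist_def l)
    then show "((\<lambda>w. hdist H (f w) l) \<longlongrightarrow> 0) F = ((\<lambda>w. hnorm H (f w - l)) \<longlongrightarrow> 0) F"
      by (rule tendsto_cong)
  qed
  finally show ?thesis .
qed

lemma limitin_htop_seq:
  assumes "\<And>n. s n \<in> car H"
  shows "limitin (htop H) s l sequentially \<longleftrightarrow> l \<in> car H \<and> (\<lambda>n. hnorm H (s n - l)) \<longlonglongrightarrow> 0"
  using assms by (simp add: limitin_htop)

lemma limitin_htop_unique:
  "F \<noteq> bot \<Longrightarrow> limitin (htop H) f l F \<Longrightarrow> limitin (htop H) f l' F \<Longrightarrow> l = l'"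
  using Hausdorff_space_mtopology limitin_Hausdorff_unique by (metis htop_eq)

lemma closure_of_htop:
  assumes "S \<subseteq> car H"
  shows "x \<in> htop H closure_of S \<longleftrightarrow>
    x \<in> car H \<and> (\<exists>s. (\<forall>n. s n \<in> S) \<and> (\<lambda>n. hnorm H (s n - x)) \<longlonglongrightarrow> 0)"
proof -
  have "x \<in> htop H closure_of S \<longleftrightarrow>
      x \<in> car H \<and> (\<exists>s. range s \<subseteq> S \<inter> car H \<and> limitin (htop H) s x sequentially)"
    by (auto simp: htop_eq closure_of_sequentially)
  moreover have "(range s \<subseteq> S \<inter> car H \<and> limitin (htop H) s x sequentially) \<longleftrightarrow>
      ((\<forall>n. s n \<in> S) \<and> (\<lambda>n. hnorm H (s n - x)) \<longlonglongrightarrow> 0)" if "x \<in> car H" for s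
    using assms that limitin_htop_seq[of s x] by blast
  ultimately show ?thesis by blast
qed

lemma ip_tendsto_left:
  assumes "eventually (\<lambda>w. f w \<in> car H) F" "l \<in> car H" "y \<in> car H"
    and "((\<lambda>w. hnorm H (f w - l)) \<longlongrightarrow> 0) F"
  shows "((\<lambda>w. ip H (f w) y) \<longlongrightarrow> ip H l y) F"
proof -
  have "((\<lambda>w. hnorm H (f w - l) * hnorm H y) \<longlongrightarrow> 0) F"
    using tendsto_mult_left_zero[OF assms(4)] .
  moreover have "eventually (\<lambda>w. norm (ip H (f w) y - ip H l y) \<le> hnorm H (f w - l) * hnorm H y) F"
    using assms(1) by eventually_elim (metis assms(2,3) cauchy_schwarz diff_car ip_diff_left)
  ultimately have "((\<lambda>w. ip H (f w) y - ip H l y) \<longlongrightarrow> 0) F"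
    by (rule Lim_null_comparison[rotated])
  then show ?thesis by (simp add: LIM_zero_iff)
qed

lemma ip_tendsto_right:
  assumes "eventually (\<lambda>w. f w \<in> car H) F" "l \<in> car H" "y \<in> car H"
    and "((\<lambda>w. hnorm H (f w - l)) \<longlongrightarrow> 0) F"
  shows "((\<lambda>w. ip H y (f w)) \<longlongrightarrow> ip H y l) F"
proof -
  have "((\<lambda>w. cnj (ip H (f w) y)) \<longlongrightarrow> cnj (ip H l y)) F"
    using ip_tendsto_left[OF assms] by (rule tendsto_cnj)
  then have "((\<lambda>w. cnj (ip H (f w) y)) \<longlongrightarrow> ip H y l) F"
    using ip_commute[OF assms(2,3)] by simp
  moreover have "eventually (\<lambda>w. cnj (ip H (f w) y) = ip H y (f w)) F"
    using assms(1) by eventually_elim (rule ip_commute[symmetric, OF _ assms(3)])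
  ultimately show ?thesis by (rule Lim_transform_eventually)
qed

lemma eq_by_ip: "x \<in> car H \<Longrightarrow> y \<in> car H \<Longrightarrow> (\<And>v. v \<in> car H \<Longrightarrow> ip H v x = ip H v y) \<Longrightarrow> x = y"
  using ip_eq_zero[of "x - y"] by simp

lemma ortho_subspace: "S \<subseteq> car H \<Longrightarrow> complex_vector.subspace (ortho H S)"
  by (auto simp: complex_vector.subspace_def ortho_def subset_iff)

lemma inner_restr:
  assumes "S \<subseteq> car H" "complex_vector.subspace S"
  shows "inner_space (restr H S)"
proof -
  have S: "x \<in> car H" if "x \<in> S" for x using assms(1) that by blast
  have eq: "car (restr H S) = S" "ip (restr H S) = ip H" by simp_all
  show ?thesis
    unfolding inner_space_def eq
    by (intro conjI ballI allI impI assms(2); (rule ip_add_left ip_scaleC_left ip_commute ip_ge_zero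
        ip_eq_zero); (erule S | assumption))
qed

lemma MCauchy_iff:
  assumes "\<And>n. s n \<in> car H"
  shows "MCauchy s \<longleftrightarrow> (\<forall>e>0. \<exists>N. \<forall>m n. N \<le> m \<longrightarrow> N \<le> n \<longrightarrow> hnorm H (s m - s n) < e)"
  using assms by (auto simp: MCauchy_def hdist_def)

lemma hnorm_tendsto_Cauchy:
  assumes "\<And>n. s n \<in> car H" "x \<in> car H" "(\<lambda>n. hnorm H (s n - x)) \<longlonglongrightarrow> 0"
  shows "MCauchy s"
  using convergent_imp_MCauchy[of s x] limitin_htop_seq[of s x] assms by (auto simp: htop_eq)

end

lemma hnorm_restr [simp]: "hnorm (restr H S) x = hnorm H x"
  by (simp add: hnorm_def)

section \<open>Orthogonal projections and Riesz representation in complete spaces\<close>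

locale chilbert =
  fixes H :: "'a::complex_vector hspace"
  assumes hilbert: "hilbert_space H"
begin

sublocale cinner
  using hilbert by unfold_locales (simp add: hilbert_space_def)

lemma complete:
  assumes "\<And>n. s n \<in> car H" "MCauchy s"
  obtains x where "x \<in> car H" "(\<lambda>n. hnorm H (s n - x)) \<longlonglongrightarrow> 0"
proof -
  have "mcomplete" using hilbert by (simp add: hilbert_space_def)
  then obtain x where "limitin mtopology s x sequentially"
    using assms unfolding mcomplete_def by blast
  then have "x \<in> car H" "(\<lambda>n. hnorm H (s n - x)) \<longlonglongrightarrow> 0"
    using limitin_htop_seq[of s x] assms(1) by (auto simp: htop_eq)
  then show ?thesis by (rule that)
qed

text \<open>The minimising sequence converges in \<open>H\<close>, so that no closedness of \<open>M\<close> is needed.\<close>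

lemma projection_seq:
  assumes M: "complex_vector.subspace M" "M \<subseteq> car H" and x: "x \<in> car H"
  obtains s m where "\<And>n. s n \<in> M" "m \<in> car H" "(\<lambda>n. hnorm H (s n - m)) \<longlonglongrightarrow> 0"
    "x - m \<in> ortho H M"
proof -
  define D where "D = (\<lambda>m. (hnorm H (x - m))\<^sup>2) ` M"
  define d where "d = Inf D"
  have ne: "D \<noteq> {}" using complex_vector.subspace_0[OF M(1)] by (auto simp: D_def)
  have bdd: "bdd_below D" by (rule bdd_belowI[of _ 0]) (auto simp: D_def)
  have d_le: "d \<le> (hnorm H (x - m))\<^sup>2" if "m \<in> M" for m
    unfolding d_def using bdd that by (auto simp: D_def intro: cInf_lower)
  have "\<exists>m\<in>M. (hnorm H (x - m))\<^sup>2 < d + inverse (real (Suc n))" for n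
  proof -
    have "Inf D < d + inverse (real (Suc n))" by (simp add: d_def)
    then show ?thesis using cInf_lessD[OF ne] by (force simp: D_def)
  qed
  then obtain s where sM: "\<And>n. s n \<in> M"
    and sd: "\<And>n. (hnorm H (x - s n))\<^sup>2 < d + inverse (real (Suc n))" by metis
  have sH [simp]: "s n \<in> car H" for n using sM M by blast
  \<comment> \<open>The midpoint of \<open>s m\<close> and \<open>s n\<close> lies in
    \<open>M\<close>, so the parallelogram law bounds their distance by the excess of both squared
    distances over the infimum \<open>d\<close>.\<close>
  have par: "(hnorm H (s m - s n))\<^sup>2 \<le> 2 * inverse (real (Suc m)) + 2 * inverse (real (Suc n))" for m n
  proof -
    have mid: "(1/2) *\<^sub>C (s m + s n) \<in> M"
      using M(1) sM complex_vector.subspace_add complex_vector.subspace_scale by blast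
    have "(x - s m) + (x - s n) = 2 *\<^sub>C (x - (1/2) *\<^sub>C (s m + s n))"
      by (simp add: complex_vector.scale_right_diff_distrib complex_vector.scale_right_distrib)
        (metis (no_types, lifting) one_add_one diff_add_eq_diff_diff_swap add_diff_eq diff_add_eq
          scaleC_add_left scaleC_one)
    then have "(hnorm H ((x - s m) + (x - s n)))\<^sup>2 = 4 * (hnorm H (x - (1/2) *\<^sub>C (s m + s n)))\<^sup>2"
      using x by (simp add: power_mult_distrib)
    then have 1: "(hnorm H ((x - s m) + (x - s n)))\<^sup>2 \<ge> 4 * d" using d_le[OF mid] by linarith
    have "(s m - s n) = (x - s n) - (x - s m)" by simp
    then have "(hnorm H (s m - s n))\<^sup>2
        = 2 * (hnorm H (x - s m))\<^sup>2 + 2 * (hnorm H (x - s n))\<^sup>2 - (hnorm H ((x - s m) + (x - s n)))\<^sup>2"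
      using x by (simp only: hnorm_add_sq hnorm_diff_sq sH diff_car)
        (simp add: ip_commute[of x "s m"] ip_commute[of x "s n"] ip_commute[of "s m" "s n"])
    then show ?thesis using 1 sd[of m] sd[of n] by linarith
  qed
  have "MCauchy s"
    unfolding MCauchy_iff[of s, OF sH]
  proof (intro allI impI)
    fix e :: real assume e: "e > 0"
    obtain N where N: "inverse (real (Suc N)) < e\<^sup>2 / 4"
      using reals_Archimedean[of "e\<^sup>2/4"] e by auto
    have "hnorm H (s m - s n) < e" if "N \<le> m" "N \<le> n" for m n
    proof -
      have "inverse (real (Suc m)) \<le> inverse (real (Suc N))" "inverse (real (Suc n)) \<le> inverse (real (Suc N))"
        using that by (auto intro!: le_imp_inverse_le)
      then have "(hnorm H (s m - s n))\<^sup>2 < e\<^sup>2" using par[of m n] N by linarith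
      then show ?thesis using e by (intro power2_less_imp_less[of "hnorm H _"]) auto
    qed
    then show "\<exists>N. \<forall>m n. N \<le> m \<longrightarrow> N \<le> n \<longrightarrow> hnorm H (s m - s n) < e" by blast
  qed
  then obtain m where m: "m \<in> car H" "(\<lambda>n. hnorm H (s n - m)) \<longlonglongrightarrow> 0" using complete sH by blast
  have dist: "(hnorm H (x - m))\<^sup>2 \<le> d"
  proof -
    have "hnorm H (x - m) \<le> hnorm H (x - s n) + hnorm H (s n - m)" for n
      using hnorm_triangle[of "x - s n" "s n - m"] x m by simp
    then have "hnorm H (x - m) \<le> sqrt (d + inverse (real (Suc n))) + hnorm H (s n - m)" for n
      using real_le_rsqrt[OF less_imp_le[OF sd[of n]]] by (smt (verit, best))
    moreover have "(\<lambda>n. sqrt (d + inverse (real (Suc n))) + hnorm H (s n - m)) \<longlonglongrightarrow> sqrt (d + 0) + 0"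
      by (intro tendsto_intros LIMSEQ_inverse_real_of_nat m(2))
    ultimately have "hnorm H (x - m) \<le> sqrt d"
      by (metis (no_types, lifting) LIMSEQ_le_const add.right_neutral)
    moreover have "0 \<le> d" unfolding d_def using ne by (intro cInf_greatest) (auto simp: D_def)
    ultimately show ?thesis
      using x m by (metis diff_car hnorm_nonneg power_mono real_sqrt_pow2)
  qed
  have "ip H (x - m) y = 0" if y: "y \<in> M" for y
  proof (rule ccontr)
    assume c0: "ip H (x - m) y \<noteq> 0"
    define c where "c = ip H (x - m) y"
    have yH [simp]: "y \<in> car H" using y M by blast
    define b where "b = (hnorm H y)\<^sup>2"
    have b: "b > 0" using c0 x m yH unfolding b_def
      by (metis diff_car hnorm_eq_zero ip_zero_right zero_less_power2)
    \<comment> \<open>\<open>m\<close> need not lie in \<open>M\<close>, but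
      \<open>s n + t *\<^sub>C y\<close> does; the bound for these points passes to the
      limit.\<close>
    have le: "d \<le> (hnorm H (x - m - t *\<^sub>C y))\<^sup>2" for t
    proof -
      have 1: "d \<le> (hnorm H (x - (s n + t *\<^sub>C y)))\<^sup>2" for n
        using d_le complex_vector.subspace_add[OF M(1) sM complex_vector.subspace_scale[OF M(1) y]] by blast
      have 2: "sqrt d \<le> hnorm H (x - m - t *\<^sub>C y) + hnorm H (s n - m)" for n
      proof -
        have "sqrt d \<le> hnorm H (x - (s n + t *\<^sub>C y))"
          using 1 x by (simp add: real_le_lsqrt)
        also have "x - (s n + t *\<^sub>C y) = (x - m - t *\<^sub>C y) - (s n - m)" by simp
        also have "hnorm H \<dots> \<le> hnorm H (x - m - t *\<^sub>C y) + hnorm H (s n - m)"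
          using x m by (intro hnorm_triangle_diff) auto
        finally show ?thesis .
      qed
      have "(\<lambda>n. hnorm H (x - m - t *\<^sub>C y) + hnorm H (s n - m)) \<longlonglongrightarrow> hnorm H (x - m - t *\<^sub>C y) + 0"
        by (intro tendsto_intros m(2))
      then have "sqrt d \<le> hnorm H (x - m - t *\<^sub>C y)"
        using 2 by (metis (no_types, lifting) LIMSEQ_le_const add.right_neutral)
      then show ?thesis by (metis real_sqrt_le_iff real_sqrt_abs abs_of_nonneg hnorm_nonneg x m(1) diff_car scaleC_car yH)
    qed
    \<comment> \<open>The choice \<open>t = c / b\<close> minimises the distance along
      \<open>y\<close> and lowers its square by \<open>|c|^2 / b\<close>.\<close>
    have "d \<le> (hnorm H (x - m - (c / of_real b) *\<^sub>C y))\<^sup>2" by (rule le)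
    also have "\<dots> = (hnorm H (x - m))\<^sup>2 - 2 * Re (cnj c / of_real b * c) + (cmod c / b)\<^sup>2 * b"
      using x m(1) b by (subst hnorm_diff_sq) (auto simp: c_def b_def[symmetric] norm_divide power_mult_distrib power_divide)
    also have "cnj c / of_real b * c = of_real ((cmod c)\<^sup>2 / b)"
      using complex_norm_square[of c] by (simp add: mult.commute)
    also have "(hnorm H (x - m))\<^sup>2 - 2 * Re (of_real ((cmod c)\<^sup>2 / b)) + (cmod c / b)\<^sup>2 * b
       = (hnorm H (x - m))\<^sup>2 - (cmod c)\<^sup>2 / b"
      using b by (simp add: power2_eq_square field_simps)
    also have "\<dots> \<le> d - (cmod c)\<^sup>2 / b" using dist by simp
    finally have "(cmod c)\<^sup>2 / b \<le> 0" by simp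
    then show False using b c0 by (simp add: c_def divide_le_0_iff)
  qed
  then have "x - m \<in> ortho H M" using x m(1) by (simp add: ortho_def)
  then show thesis using that sM m by blast
qed

lemma projection:
  assumes "complex_vector.subspace M" "closedin (htop H) M" and x: "x \<in> car H"
  obtains m where "m \<in> M" "x - m \<in> ortho H M"
proof -
  have M: "M \<subseteq> car H" using closedin_subset[OF assms(2)] by simp
  obtain s m where s: "\<And>n. s n \<in> M" "m \<in> car H" "(\<lambda>n. hnorm H (s n - m)) \<longlonglongrightarrow> 0"
    "x - m \<in> ortho H M" using projection_seq[OF assms(1) M x] by blast
  then have "limitin (htop H) s m sequentially" using M by (simp add: limitin_htop_seq subset_iff)
  then have "m \<in> M" using limitin_closedin[OF _ assms(2)] s(1) by fastforce
  then show thesis using that s by blast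
qed

lemma dense_if_ortho_trivial:
  assumes "complex_vector.subspace M" "M \<subseteq> car H" "ortho H M \<subseteq> {0}"
  shows "htop H closure_of M = car H"
proof
  show "htop H closure_of M \<subseteq> car H" by (metis closure_of_subset_topspace topspace_htop)
  show "car H \<subseteq> htop H closure_of M"
  proof
    fix x assume x: "x \<in> car H"
    obtain s m where s: "\<And>n. s n \<in> M" "m \<in> car H" "(\<lambda>n. hnorm H (s n - m)) \<longlonglongrightarrow> 0"
      "x - m \<in> ortho H M" using projection_seq[OF assms(1,2) x] by blast
    then have "x = m" using assms(3) by auto
    then show "x \<in> htop H closure_of M" using s closure_of_htop[OF assms(2)] by blast
  qed
qed

text \<open>The residual \<open>x - m\<close> of the projection is orthogonal to \<open>m\<close>,
  and by the last hypothesis also to \<open>x\<close>, hence to itself.\<close>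

lemma ortho_ortho:
  assumes "complex_vector.subspace M" "closedin (htop H) M" "x \<in> car H"
    "\<And>y. y \<in> ortho H M \<Longrightarrow> ip H x y = 0"
  shows "x \<in> M"
proof -
  obtain m where m: "m \<in> M" "x - m \<in> ortho H M" using projection[OF assms(1-3)] .
  have mH: "m \<in> car H" using m closedin_subset[OF assms(2)] by auto
  have "ip H (x - m) m = 0" using m by (simp add: ortho_def)
  then have "ip H (x - m) (x - m) = 0" using assms(3) assms(4)[OF m(2)] ip_commute mH
    by (metis complex_cnj_zero diff_0_right diff_car ip_diff_left)
  then show ?thesis using m mH assms(3) ip_eq_zero[of "x - m"] by simp
qed

lemma riesz:
  assumes add: "\<And>x y. x \<in> car H \<Longrightarrow> y \<in> car H \<Longrightarrow> \<phi> (x + y) = \<phi> x + \<phi> y"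
    and scale: "\<And>a x. x \<in> car H \<Longrightarrow> \<phi> (a *\<^sub>C x) = a * \<phi> x"
    and bdd: "\<And>x. x \<in> car H \<Longrightarrow> cmod (\<phi> x) \<le> C * hnorm H x"
  obtains y where "y \<in> car H" "\<And>v. v \<in> car H \<Longrightarrow> \<phi> v = ip H v y"
proof (cases "\<forall>x\<in>car H. \<phi> x = 0")
  case True
  then show ?thesis using that[of 0] by simp
next
  case False
  then obtain x where x: "x \<in> car H" "\<phi> x \<noteq> 0" by blast
  define M where "M = {v \<in> car H. \<phi> v = 0}"
  have \<phi>0: "\<phi> 0 = 0" using scale[of 0 0] by simp
  have \<phi>d: "\<phi> (u - v) = \<phi> u - \<phi> v" if "u \<in> car H" "v \<in> car H" for u v
    using add[of "u - v" v] that by simp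
  have M: "complex_vector.subspace M" "M \<subseteq> car H"
    by (auto simp: M_def complex_vector.subspace_def \<phi>0 add scale)
  obtain s m where s: "\<And>n. s n \<in> M" "m \<in> car H" "(\<lambda>n. hnorm H (s n - m)) \<longlonglongrightarrow> 0"
    "x - m \<in> ortho H M" using projection_seq[OF M x(1)] by blast
  \<comment> \<open>\<open>m\<close> is only a limit of zeros of \<open>\<phi>\<close>; the bound on
    \<open>\<phi>\<close> carries the zero over.\<close>
  have "\<phi> m = 0"
  proof -
    have "cmod (\<phi> m) \<le> C * hnorm H (s n - m)" for n
      using bdd[of "s n - m"] s(1)[of n] s(2) \<phi>d[of "s n" m] M by (auto simp: M_def)
    moreover have "(\<lambda>n. C * hnorm H (s n - m)) \<longlonglongrightarrow> C * 0" by (intro tendsto_intros s(3))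
    ultimately have "cmod (\<phi> m) \<le> C * 0" by (intro LIMSEQ_le_const) auto
    then show ?thesis by simp
  qed
  define u where "u = x - m"
  have u: "u \<in> car H" "\<phi> u \<noteq> 0" using x s(2) \<open>\<phi> m = 0\<close> by (auto simp: u_def \<phi>d)
  have u0: "ip H u u \<noteq> 0" using u \<phi>0 ip_eq_zero by metis
  have uM: "ip H v u = 0" if "v \<in> M" for v
  proof -
    have v: "v \<in> car H" using that M(2) by blast
    have "ip H u v = 0" using s(4) that by (simp add: ortho_def u_def)
    then show ?thesis using ip_commute[OF u(1) v] by simp
  qed
  show ?thesis
  proof (rule that[of "cnj (\<phi> u / ip H u u) *\<^sub>C u"])
    fix v assume v: "v \<in> car H"
    \<comment> \<open>A combination on which \<open>\<phi>\<close> vanishes is orthogonal to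
      \<open>u\<close>; this expresses \<open>\<phi> v\<close> through
      \<open>ip H v u\<close>.\<close>
    have "\<phi> u *\<^sub>C v - \<phi> v *\<^sub>C u \<in> M" using u v by (simp add: M_def \<phi>d scale mult.commute)
    then have "\<phi> u * ip H v u = \<phi> v * ip H u u" using uM u v by fastforce
    then show "\<phi> v = ip H v (cnj (\<phi> u / ip H u u) *\<^sub>C u)" using u v u0 by (simp add: field_simps)
  qed (use u in auto)
qed

end

section \<open>Bounded operators and adjoints\<close>

lemma linear_on_image_subspace:
  assumes "linear_on S A" "complex_vector.subspace S"
  shows "complex_vector.subspace (A ` S)"
  unfolding complex_vector.subspace_def
proof (intro conjI ballI allI)
  show "0 \<in> A ` S"
    using linear_on_0[OF assms] complex_vector.subspace_0[OF assms(2)] by (rule image_eqI[OF sym])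
  show "x + y \<in> A ` S" if "x \<in> A ` S" "y \<in> A ` S" for x y
    using that linear_on_add[OF assms(1)] complex_vector.subspace_add[OF assms(2)]
    by (auto simp: image_iff) metis
  show "a *\<^sub>C x \<in> A ` S" if "x \<in> A ` S" for a x
    using that linear_on_scaleC[OF assms(1)] complex_vector.subspace_scale[OF assms(2)]
    by (auto simp: image_iff) metis
qed

lemma bounded_opI:
  assumes "linear_on (car H1) A" "\<And>x. x \<in> car H1 \<Longrightarrow> A x \<in> car H2"
    "\<And>x. x \<in> car H1 \<Longrightarrow> hnorm H2 (A x) \<le> C * hnorm H1 x"
  shows "bounded_op H1 H2 A"
  using assms unfolding bounded_op_def by blast

lemma bounded_op_linear: "bounded_op H1 H2 A \<Longrightarrow> linear_on (car H1) A"
  by (simp add: bounded_op_def)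

lemma bounded_op_car: "bounded_op H1 H2 A \<Longrightarrow> x \<in> car H1 \<Longrightarrow> A x \<in> car H2"
  by (auto simp: bounded_op_def)

lemma bounded_op_add: "bounded_op H1 H2 A \<Longrightarrow> x \<in> car H1 \<Longrightarrow> y \<in> car H1 \<Longrightarrow> A (x + y) = A x + A y"
  by (simp add: bounded_op_def linear_on_def)

lemma bounded_op_scaleC: "bounded_op H1 H2 A \<Longrightarrow> x \<in> car H1 \<Longrightarrow> A (a *\<^sub>C x) = a *\<^sub>C A x"
  by (simp add: bounded_op_def linear_on_def)

lemma bounded_op_diff:
  "inner_space H1 \<Longrightarrow> bounded_op H1 H2 A \<Longrightarrow> x \<in> car H1 \<Longrightarrow> y \<in> car H1 \<Longrightarrow> A (x - y) = A x - A y"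
  using linear_on_diff[of "car H1" A x y] cinner.sub[OF cinner.intro] bounded_op_linear by blast

lemma bounded_op_zero: "inner_space H1 \<Longrightarrow> bounded_op H1 H2 A \<Longrightarrow> A 0 = 0"
  using linear_on_0[of "car H1" A] cinner.sub[OF cinner.intro] bounded_op_linear by blast

lemma bounded_op_bound:
  assumes "inner_space H1" "bounded_op H1 H2 A"
  obtains C where "C > 0" "\<And>x. x \<in> car H1 \<Longrightarrow> hnorm H2 (A x) \<le> C * hnorm H1 x"
proof -
  interpret cinner H1 by unfold_locales fact
  obtain C where C: "\<forall>x\<in>car H1. hnorm H2 (A x) \<le> C * hnorm H1 x"
    using assms(2) by (auto simp: bounded_op_def)
  have "hnorm H2 (A x) \<le> (\<bar>C\<bar> + 1) * hnorm H1 x" if "x \<in> car H1" for x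
  proof -
    have "C * hnorm H1 x \<le> (\<bar>C\<bar> + 1) * hnorm H1 x" using that by (intro mult_right_mono) auto
    then show ?thesis using C that by force
  qed
  then show thesis using that[of "\<bar>C\<bar> + 1"] by simp
qed

lemma bounded_op_compose:
  assumes "inner_space H1" "inner_space H2" "bounded_op H1 H2 A" "bounded_op H2 H3 B"
  shows "bounded_op H1 H3 (\<lambda>x. B (A x))"
proof -
  obtain C D where C: "\<And>x. x \<in> car H1 \<Longrightarrow> hnorm H2 (A x) \<le> C * hnorm H1 x"
    and D: "D > 0" "\<And>x. x \<in> car H2 \<Longrightarrow> hnorm H3 (B x) \<le> D * hnorm H2 x"
    using bounded_op_bound[OF assms(1,3)] bounded_op_bound[OF assms(2,4)] by metis
  show ?thesis
  proof (rule bounded_opI[where C = "D * C"])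
    show "linear_on (car H1) (\<lambda>x. B (A x))"
      using assms by (simp add: linear_on_def bounded_op_add bounded_op_scaleC bounded_op_car)
    show "x \<in> car H1 \<Longrightarrow> B (A x) \<in> car H3" for x
      using assms by (simp add: bounded_op_car)
    show "hnorm H3 (B (A x)) \<le> D * C * hnorm H1 x" if "x \<in> car H1" for x
    proof -
      have "hnorm H3 (B (A x)) \<le> D * hnorm H2 (A x)"
        using D(2) that assms by (simp add: bounded_op_car)
      also have "\<dots> \<le> D * (C * hnorm H1 x)" using D(1) C that by simp
      finally show ?thesis by (simp add: mult.assoc)
    qed
  qed
qed

lemma bounded_op_scale:
  assumes "inner_space H2" "bounded_op H1 H2 A"
  shows "bounded_op H1 H2 (\<lambda>x. a *\<^sub>C A x)"
proof -
  interpret cinner H2 by unfold_locales fact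
  obtain C where C: "\<And>x. x \<in> car H1 \<Longrightarrow> hnorm H2 (A x) \<le> C * hnorm H1 x"
    using assms(2) by (auto simp: bounded_op_def)
  have "hnorm H2 (a *\<^sub>C A x) \<le> (cmod a * C) * hnorm H1 x" if "x \<in> car H1" for x
    using mult_left_mono[OF C[OF that] norm_ge_zero[of a]] bounded_op_car[OF assms(2) that]
    by (simp add: mult.assoc)
  then show ?thesis
    using assms by (intro bounded_opI[where C = "cmod a * C"])
      (auto simp: linear_on_def bounded_op_add bounded_op_scaleC bounded_op_car
        complex_vector.scale_right_distrib complex_vector.scale_scale mult.commute)
qed

lemma bounded_op_plus:
  assumes "inner_space H2" "bounded_op H1 H2 A" "bounded_op H1 H2 B"
  shows "bounded_op H1 H2 (\<lambda>x. A x + B x)"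
proof -
  interpret cinner H2 by unfold_locales fact
  obtain C where C: "\<And>x. x \<in> car H1 \<Longrightarrow> hnorm H2 (A x) \<le> C * hnorm H1 x"
    using assms(2) by (auto simp: bounded_op_def)
  obtain D where D: "\<And>x. x \<in> car H1 \<Longrightarrow> hnorm H2 (B x) \<le> D * hnorm H1 x"
    using assms(3) by (auto simp: bounded_op_def)
  have "hnorm H2 (A x + B x) \<le> (C + D) * hnorm H1 x" if x: "x \<in> car H1" for x
    unfolding distrib_right
    using hnorm_triangle[OF bounded_op_car[OF assms(2) x] bounded_op_car[OF assms(3) x]] C[OF x] D[OF x]
    by linarith
  then show ?thesis
    using assms by (intro bounded_opI[where C = "C + D"])
      (auto simp: linear_on_def bounded_op_add bounded_op_scaleC bounded_op_car scaleC_add_right)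
qed

lemma bounded_op_id: "bounded_op H H (\<lambda>x. x)"
  by (rule bounded_opI[where C = 1]) (auto simp: linear_on_def)


text \<open>A relation instead of the function \<open>adj\<close>: composites, sums and inverses can
  then be given explicit adjoints. \<open>adj_eq\<close> and \<open>adjoint_ops_adj\<close> connect
  it with the definite description.\<close>

definition adjoint_ops ::
    "'a::complex_vector hspace \<Rightarrow> 'b::complex_vector hspace \<Rightarrow> ('a \<Rightarrow> 'b) \<Rightarrow> ('b \<Rightarrow> 'a) \<Rightarrow> bool" where
  "adjoint_ops K H A B \<longleftrightarrow> bounded_op K H A \<and> bounded_op H K B \<and>
     (\<forall>x\<in>car K. \<forall>y\<in>car H. ip H (A x) y = ip K x (B y))"

lemma adjoint_opsD:
  assumes "adjoint_ops K H A B"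
  shows "bounded_op K H A" "bounded_op H K B"
    "x \<in> car K \<Longrightarrow> A x \<in> car H" "y \<in> car H \<Longrightarrow> B y \<in> car K"
    "x \<in> car K \<Longrightarrow> y \<in> car H \<Longrightarrow> ip H (A x) y = ip K x (B y)"
  using assms by (auto simp: adjoint_ops_def bounded_op_car)

lemma adjoint_ops_sym:
  assumes "inner_space K" "inner_space H" "adjoint_ops K H A B"
  shows "adjoint_ops H K B A"
proof -
  interpret K: cinner K by unfold_locales fact
  interpret H: cinner H by unfold_locales fact
  note AB = adjoint_opsD[OF assms(3)]
  have "ip K (B y) x = ip H y (A x)" if "x \<in> car K" "y \<in> car H" for x y
    using AB(5)[OF that] K.ip_commute[OF that(1) AB(4)[OF that(2)]]
      H.ip_commute[OF AB(3)[OF that(1)] that(2)] by simp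
  then show ?thesis using AB by (simp add: adjoint_ops_def)
qed

lemma adjoint_ops_compose:
  assumes "inner_space K" "inner_space H" "inner_space L"
    "adjoint_ops K H A A'" "adjoint_ops H L B B'"
  shows "adjoint_ops K L (\<lambda>x. B (A x)) (\<lambda>x. A' (B' x))"
  unfolding adjoint_ops_def
  using bounded_op_compose[OF assms(1,2) adjoint_opsD(1)[OF assms(4)] adjoint_opsD(1)[OF assms(5)]]
    bounded_op_compose[OF assms(3,2) adjoint_opsD(2)[OF assms(5)] adjoint_opsD(2)[OF assms(4)]]
  by (simp add: adjoint_opsD[OF assms(4)] adjoint_opsD[OF assms(5)])

lemma adjoint_ops_scale:
  assumes "inner_space K" "inner_space H" "adjoint_ops K H A A'"
  shows "adjoint_ops K H (\<lambda>x. a *\<^sub>C A x) (\<lambda>x. cnj a *\<^sub>C A' x)"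
proof -
  interpret K: cinner K by unfold_locales fact
  interpret H: cinner H by unfold_locales fact
  note AB = adjoint_opsD[OF assms(3)]
  show ?thesis using bounded_op_scale[OF assms(2) AB(1)] bounded_op_scale[OF assms(1) AB(2)]
    by (simp add: adjoint_ops_def AB)
qed

lemma adjoint_ops_plus:
  assumes "inner_space K" "inner_space H" "adjoint_ops K H A A'" "adjoint_ops K H B B'"
  shows "adjoint_ops K H (\<lambda>x. A x + B x) (\<lambda>x. A' x + B' x)"
proof -
  interpret K: cinner K by unfold_locales fact
  interpret H: cinner H by unfold_locales fact
  note AB = adjoint_opsD[OF assms(3)] and CD = adjoint_opsD[OF assms(4)]
  show ?thesis using bounded_op_plus[OF assms(2) AB(1) CD(1)] bounded_op_plus[OF assms(1) AB(2) CD(2)]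
    by (simp add: adjoint_ops_def AB CD)
qed

lemma adj_eq:
  assumes "inner_space K" "adjoint_ops K H A B" "y \<in> car H"
  shows "adj K H A y = B y"
proof -
  interpret K: cinner K by unfold_locales fact
  note AB = adjoint_opsD[OF assms(2)]
  show ?thesis
    unfolding adj_def
  proof (rule the_equality)
    show "B y \<in> car K \<and> (\<forall>v\<in>car K. ip H (A v) y = ip K v (B y))" using AB assms by simp
    show "x = B y" if "x \<in> car K \<and> (\<forall>v\<in>car K. ip H (A v) y = ip K v x)" for x
      using that AB assms by (intro K.eq_by_ip) auto
  qed
qed

text \<open>Riesz representation gives a value \<open>B y\<close> for each \<open>y\<close>, and
  linearity follows by pairing with test vectors. The bound comes from testing with
  \<open>B y\<close> itself: its squared norm is \<open>ip H (A (B y)) y\<close>.\<close>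

lemma adjoint_ops_adj:
  assumes "hilbert_space K" "inner_space H" "bounded_op K H A"
  shows "adjoint_ops K H A (adj K H A)"
proof -
  interpret K: chilbert K by unfold_locales fact
  interpret H: cinner H by unfold_locales fact
  obtain C where C: "C > 0" "\<And>x. x \<in> car K \<Longrightarrow> hnorm H (A x) \<le> C * hnorm K x"
    using bounded_op_bound[OF K.inner assms(3)] by blast
  note A = bounded_op_add[OF assms(3)] bounded_op_scaleC[OF assms(3)] bounded_op_car[OF assms(3)]
  have "\<exists>x\<in>car K. \<forall>v\<in>car K. ip H (A v) y = ip K v x" if y: "y \<in> car H" for y
  proof -
    have 1: "cmod (ip H (A v) y) \<le> C * hnorm H y * hnorm K v" if "v \<in> car K" for v
    proof -
      have "cmod (ip H (A v) y) \<le> hnorm H (A v) * hnorm H y" by (simp add: H.cauchy_schwarz A y that)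
      also have "\<dots> \<le> (C * hnorm K v) * hnorm H y" using C(2)[OF that] y by (simp add: mult_right_mono)
      finally show ?thesis by (simp add: mult_ac)
    qed
    have 2: "ip H (A (v + w)) y = ip H (A v) y + ip H (A w) y" if "v \<in> car K" "w \<in> car K" for v w
      using that y by (simp add: A)
    have 3: "ip H (A (a *\<^sub>C v)) y = a * ip H (A v) y" if "v \<in> car K" for a v
      using that y by (simp add: A)
    show ?thesis by (rule K.riesz[of "\<lambda>v. ip H (A v) y", OF 2 3 1]) (assumption+, use that in blast)
  qed
  then obtain B where B: "\<And>y. y \<in> car H \<Longrightarrow> B y \<in> car K"
    "\<And>y v. y \<in> car H \<Longrightarrow> v \<in> car K \<Longrightarrow> ip H (A v) y = ip K v (B y)" by metis
  have "bounded_op H K B"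
  proof (rule bounded_opI[where C = C])
    have "B (x + y) = B x + B y" if "x \<in> car H" "y \<in> car H" for x y
      by (rule K.eq_by_ip) (simp_all add: that B(1) A B(2)[symmetric])
    moreover have "B (a *\<^sub>C x) = a *\<^sub>C B x" if "x \<in> car H" for a x
      by (rule K.eq_by_ip) (simp_all add: that B(1) A B(2)[symmetric])
    ultimately show "linear_on (car H) B" by (simp add: linear_on_def)
    show "y \<in> car H \<Longrightarrow> B y \<in> car K" for y by (rule B)
    show "hnorm K (B y) \<le> C * hnorm H y" if y: "y \<in> car H" for y
    proof (cases "B y = 0")
      case False
      then have pos: "hnorm K (B y) > 0" using B(1)[OF y] by (simp add: less_le)
      have "(hnorm K (B y))\<^sup>2 = Re (ip H (A (B y)) y)" using B y by (simp add: K.Re_ip_self)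
      also have "\<dots> \<le> hnorm H (A (B y)) * hnorm H y"
        using H.cauchy_schwarz[of "A (B y)" y] complex_Re_le_cmod[of "ip H (A (B y)) y"] y B(1)[OF y] A by simp
      also have "\<dots> \<le> C * hnorm K (B y) * hnorm H y" using C(2)[OF B(1)[OF y]] y by (simp add: mult_right_mono)
      finally have "hnorm K (B y) * hnorm K (B y) \<le> hnorm K (B y) * (C * hnorm H y)"
        by (simp add: power2_eq_square mult_ac)
      then show ?thesis using pos by simp
    qed (use C y in simp)
  qed
  then have AB: "adjoint_ops K H A B" using assms(3) B by (simp add: adjoint_ops_def)
  have "adj K H A y = B y" if "y \<in> car H" for y using adj_eq[OF K.inner AB that] .
  then show ?thesis using AB by (simp add: adjoint_ops_def bounded_op_def linear_on_def image_subset_iff)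
qed


section \<open>Bounded inverses and coercive operators\<close>

lemma invertible_opI:
  assumes "inner_space K" "inner_space H" "bounded_op K H A" "\<And>y. y \<in> car H \<Longrightarrow> \<exists>x\<in>car K. A x = y"
    "\<And>x. x \<in> car K \<Longrightarrow> c * hnorm K x \<le> hnorm H (A x)" "c > 0"
  shows "invertible_op K H A"
proof -
  interpret K: cinner K by unfold_locales fact
  interpret H: cinner H by unfold_locales fact
  have inj: "x = y" if "x \<in> car K" "y \<in> car K" "A x = A y" for x y
  proof -
    have "c * hnorm K (x - y) \<le> 0"
      using assms(5)[of "x - y"] bounded_op_diff[OF assms(1,3) that(1,2)] that by simp
    then have "hnorm K (x - y) = 0"
      using \<open>c > 0\<close> that K.hnorm_nonneg[OF K.diff_car[OF that(1,2)]] by (simp add: mult_le_0_iff)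
    then show ?thesis using that by simp
  qed
  obtain B where B: "\<And>y. y \<in> car H \<Longrightarrow> B y \<in> car K" "\<And>y. y \<in> car H \<Longrightarrow> A (B y) = y"
    using assms(4) by metis
  have BA: "B (A x) = x" if "x \<in> car K" for x
    using inj B bounded_op_car[OF assms(3) that] that by metis
  note A = bounded_op_add[OF assms(3)] bounded_op_scaleC[OF assms(3)] bounded_op_car[OF assms(3)]
  have "bounded_op H K B"
  proof (rule bounded_opI[where C = "1 / c"])
    have "B (x + y) = B x + B y" if "x \<in> car H" "y \<in> car H" for x y
      by (rule inj) (auto simp: that B A)
    moreover have "B (a *\<^sub>C x) = a *\<^sub>C B x" if "x \<in> car H" for a x
      by (rule inj) (auto simp: that B A)
    ultimately show "linear_on (car H) B" by (simp add: linear_on_def)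
    show "y \<in> car H \<Longrightarrow> B y \<in> car K" for y by (rule B)
    show "y \<in> car H \<Longrightarrow> hnorm K (B y) \<le> 1 / c * hnorm H y" for y
      using assms(5)[OF B(1), of y] B(2)[of y] \<open>c > 0\<close> by (simp add: field_simps)
  qed
  then show ?thesis unfolding invertible_op_def using assms(3) B BA by blast
qed

lemma invertible_op_inv:
  assumes "invertible_op K H A"
  shows "bounded_op K H A"
    and "x \<in> car K \<Longrightarrow> op_inv K A (A x) = x" and "y \<in> car H \<Longrightarrow> A (op_inv K A y) = y"
    and "x \<in> car K \<Longrightarrow> A x \<in> car H" and "y \<in> car H \<Longrightarrow> op_inv K A y \<in> car K"
    and "x \<in> car K \<Longrightarrow> x' \<in> car K \<Longrightarrow> A x = A x' \<longleftrightarrow> x = x'"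
proof -
  obtain B where B: "bounded_op K H A" "bounded_op H K B" "\<forall>x\<in>car K. B (A x) = x"
    "\<forall>y\<in>car H. A (B y) = y" using assms unfolding invertible_op_def by blast
  have inj: "inj_on A (car K)" using B(3) by (metis inj_onI)
  show "bounded_op K H A" by fact
  show "op_inv K A (A x) = x" if "x \<in> car K" using inj that by simp
  show "x \<in> car K \<Longrightarrow> A x \<in> car H" by (rule bounded_op_car[OF B(1)])
  show "A (op_inv K A y) = y" "op_inv K A y \<in> car K" if "y \<in> car H"
  proof -
    have "y \<in> A ` car K" using B(4) bounded_op_car[OF B(2) that] that by (metis imageI)
    then show "A (op_inv K A y) = y" "op_inv K A y \<in> car K" by (auto intro: f_inv_into_f inv_into_into)
  qed
  show "x \<in> car K \<Longrightarrow> x' \<in> car K \<Longrightarrow> A x = A x' \<longleftrightarrow> x = x'" using inj by (auto simp: inj_on_def)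
qed

lemma bounded_op_op_inv:
  assumes "inner_space H" "invertible_op K H A"
  shows "bounded_op H K (op_inv K A)"
proof -
  interpret H: cinner H by unfold_locales fact
  obtain B where B: "bounded_op K H A" "bounded_op H K B" "\<forall>x\<in>car K. B (A x) = x"
    "\<forall>y\<in>car H. A (B y) = y" using assms unfolding invertible_op_def by blast
  have "op_inv K A y = B y" if "y \<in> car H" for y
    using invertible_op_inv(2)[OF assms(2) bounded_op_car[OF B(2) that]] B(4) that by simp
  then show ?thesis using B(2) by (simp add: bounded_op_def linear_on_def image_subset_iff)
qed

lemma invertible_op_lower_bound:
  assumes "inner_space H" "invertible_op K H A"
  obtains c where "c > 0" "\<And>x. x \<in> car K \<Longrightarrow> c * hnorm K x \<le> hnorm H (A x)"
proof -
  obtain C where C: "C > 0" "\<And>y. y \<in> car H \<Longrightarrow> hnorm K (op_inv K A y) \<le> C * hnorm H y"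
    using bounded_op_bound[OF assms(1) bounded_op_op_inv[OF assms]] by blast
  have "1 / C * hnorm K x \<le> hnorm H (A x)" if "x \<in> car K" for x
    using C(2)[of "A x"] C(1) that invertible_op_inv[OF assms(2)] by (simp add: field_simps)
  then show thesis using that[of "1 / C"] C(1) by simp
qed

lemma invertible_op_compose:
  assumes "inner_space K" "inner_space H" "inner_space L" "invertible_op K H A" "invertible_op H L B"
  shows "invertible_op K L (\<lambda>x. B (A x))"
  unfolding invertible_op_def
  using bounded_op_compose[OF assms(1,2) invertible_op_inv(1)[OF assms(4)] invertible_op_inv(1)[OF assms(5)]]
    bounded_op_compose[OF assms(3,2) bounded_op_op_inv[OF assms(3,5)] bounded_op_op_inv[OF assms(2,4)]]
    invertible_op_inv[OF assms(4)] invertible_op_inv[OF assms(5)]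
  by (intro conjI exI[of _ "\<lambda>x. op_inv K A (op_inv H B x)"]) auto

lemma invertible_op_op_inv:
  assumes "inner_space K" "inner_space H" "invertible_op K H A"
  shows "invertible_op H K (op_inv K A)"
  unfolding invertible_op_def using bounded_op_op_inv[OF assms(2,3)] invertible_op_inv[OF assms(3)] by blast

lemma bounded_op_cong:
  assumes "inner_space K" "bounded_op K H A" "\<And>x. x \<in> car K \<Longrightarrow> A x = A' x"
  shows "bounded_op K H A'"
proof -
  interpret K: cinner K by unfold_locales fact
  show ?thesis using assms(2,3) by (simp add: bounded_op_def linear_on_def image_subset_iff)
qed

lemma invertible_op_cong:
  assumes "inner_space K" "invertible_op K H A" "\<And>x. x \<in> car K \<Longrightarrow> A x = A' x"
  shows "invertible_op K H A'"
proof -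
  obtain B where "bounded_op H K B" "\<forall>x\<in>car K. B (A x) = x" "\<forall>y\<in>car H. A (B y) = y"
    using assms(2) by (auto simp: invertible_op_def)
  then show ?thesis
    unfolding invertible_op_def using assms(2,3) bounded_op_cong[OF assms(1) _ assms(3)]
    by (intro conjI exI[of _ B]) (auto simp: bounded_op_car invertible_op_def)
qed

lemma adjoint_ops_op_inv:
  assumes "inner_space K" "inner_space H" "adjoint_ops K H A A'" "invertible_op K H A" "invertible_op H K A'"
  shows "adjoint_ops H K (op_inv K A) (op_inv H A')"
proof -
  note a = adjoint_opsD(3-5)[OF assms(3)] invertible_op_inv[OF assms(4)] invertible_op_inv[OF assms(5)]
  have "ip K (op_inv K A x) y = ip H x (op_inv H A' y)" if "x \<in> car H" "y \<in> car K" for x y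
    using a(3)[of "op_inv K A x" "op_inv H A' y"] that by (simp add: a)
  then show ?thesis
    using bounded_op_op_inv[OF assms(2,4)] bounded_op_op_inv[OF assms(1,5)] by (simp add: adjoint_ops_def)
qed

text \<open>Coercivity and Cauchy-Schwarz bound \<open>A\<close> from below. For surjectivity, let
  \<open>m\<close> be the limit of range points with \<open>y - m\<close> orthogonal to the range:
  then \<open>y - m\<close> is orthogonal to \<open>A (y - m)\<close>, so coercivity gives
  \<open>y = m\<close>. Thus \<open>y\<close> is a limit of values \<open>A (t n)\<close>, and the
  lower bound makes \<open>t\<close> a Cauchy sequence.\<close>

lemma (in chilbert) lax_milgram:
  assumes A: "bounded_op H H A" and c: "c > 0"
    and coer: "\<And>x. x \<in> car H \<Longrightarrow> c * (hnorm H x)\<^sup>2 \<le> cmod (ip H (A x) x)"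
  shows "invertible_op H H A"
proof -
  note A' = bounded_op_add[OF A] bounded_op_scaleC[OF A] bounded_op_car[OF A]
    bounded_op_diff[OF inner A] bounded_op_zero[OF inner A]
  have lower: "c * hnorm H x \<le> hnorm H (A x)" if x: "x \<in> car H" for x
  proof (cases "x = 0")
    case False
    then have pos: "hnorm H x > 0" using x by (simp add: less_le)
    have "hnorm H x * (c * hnorm H x) \<le> hnorm H x * hnorm H (A x)"
      using coer[OF x] cauchy_schwarz[of "A x" x] A' x by (simp add: power2_eq_square mult_ac)
    then show ?thesis using pos by simp
  qed (simp add: A')
  define M where "M = A ` car H"
  have M: "complex_vector.subspace M" "M \<subseteq> car H"
    using linear_on_image_subspace[OF bounded_op_linear[OF A] sub] A'(3) by (auto simp: M_def)
  have "\<exists>x\<in>car H. A x = y" if y: "y \<in> car H" for y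
  proof -
    obtain s m where s: "\<And>n. s n \<in> M" and m: "m \<in> car H" "(\<lambda>n. hnorm H (s n - m)) \<longlonglongrightarrow> 0"
      "y - m \<in> ortho H M" using projection_seq[OF M y] by blast
    have "ip H (y - m) (A (y - m)) = 0" using m y by (auto simp: ortho_def M_def)
    then have "ip H (A (y - m)) (y - m) = 0" using ip_commute[of "y - m" "A (y - m)"] A' y m by simp
    then have "c * (hnorm H (y - m))\<^sup>2 \<le> 0" using coer[of "y - m"] y m by simp
    then have "y - m = 0" using c y m(1) by (simp add: mult_le_0_iff)
    then have ym: "y = m" by simp
    obtain t where t: "\<And>n. t n \<in> car H" "\<And>n. A (t n) = s n"
      using s unfolding M_def image_iff by metis
    have sH: "s n \<in> car H" for n using s M by blast
    have "MCauchy t"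
      unfolding MCauchy_iff[of t, OF t(1)]
    proof (intro allI impI)
      fix e :: real assume "e > 0"
      then have "c * e > 0" using c by simp
      then obtain N where N: "\<And>k n. N \<le> k \<Longrightarrow> N \<le> n \<Longrightarrow> hnorm H (s k - s n) < c * e"
        using hnorm_tendsto_Cauchy[OF sH m(1,2)] unfolding MCauchy_iff[of s, OF sH] by blast
      have "hnorm H (t k - t n) < e" if "N \<le> k" "N \<le> n" for k n
      proof -
        have "c * hnorm H (t k - t n) \<le> hnorm H (s k - s n)"
          using lower[of "t k - t n"] t by (simp add: A')
        also have "\<dots> < c * e" by (rule N[OF that])
        finally show ?thesis using c by simp
      qed
      then show "\<exists>N. \<forall>m n. N \<le> m \<longrightarrow> N \<le> n \<longrightarrow> hnorm H (t m - t n) < e" by blast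
    qed
    then obtain x where x: "x \<in> car H" "(\<lambda>n. hnorm H (t n - x)) \<longlonglongrightarrow> 0" using complete[of t, OF t(1)] by blast
    obtain C where C: "C > 0" "\<And>x. x \<in> car H \<Longrightarrow> hnorm H (A x) \<le> C * hnorm H x"
      using bounded_op_bound[OF inner A] by blast
    have "(\<lambda>n. C * hnorm H (t n - x)) \<longlonglongrightarrow> 0" using tendsto_mult_right_zero[OF x(2)] .
    moreover have "norm (hnorm H (s n - A x)) \<le> C * hnorm H (t n - x)" for n
      using C(2)[of "t n - x"] t x(1) sH[of n] A'(3)[OF x(1)] by (simp add: A')
    ultimately have "(\<lambda>n. hnorm H (s n - A x)) \<longlonglongrightarrow> 0"
      by (rule Lim_null_comparison[rotated, OF _ always_eventually[OF allI]])
    then have "limitin (htop H) s (A x) sequentially" "limitin (htop H) s y sequentially"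
      using m ym x A' by (simp_all add: limitin_htop_seq sH)
    then have "A x = y" by (rule limitin_htop_unique[OF trivial_limit_sequentially])
    then show ?thesis using x(1) by blast
  qed
  then show ?thesis using invertible_opI[OF inner inner A _ lower c] by blast
qed

section \<open>Positive square roots\<close>

lemma (in cinner) ip_tendsto:
  assumes f: "eventually (\<lambda>w. f w \<in> car H) F" "l \<in> car H" "((\<lambda>w. hnorm H (f w - l)) \<longlongrightarrow> 0) F"
    and g: "eventually (\<lambda>w. g w \<in> car H) F" "m \<in> car H" "((\<lambda>w. hnorm H (g w - m)) \<longlongrightarrow> 0) F"
  shows "((\<lambda>w. ip H (f w) (g w)) \<longlongrightarrow> ip H l m) F"
proof -
  have "((\<lambda>w. (hnorm H (f w - l) + hnorm H l) * hnorm H (g w - m) + hnorm H (f w - l) * hnorm H m)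
      \<longlongrightarrow> (0 + hnorm H l) * 0 + 0 * hnorm H m) F"
    by (intro tendsto_intros f(3) g(3))
  then have "((\<lambda>w. (hnorm H (f w - l) + hnorm H l) * hnorm H (g w - m) + hnorm H (f w - l) * hnorm H m)
      \<longlongrightarrow> 0) F" by simp
  moreover have "eventually (\<lambda>w. norm (ip H (f w) (g w) - ip H l m)
      \<le> (hnorm H (f w - l) + hnorm H l) * hnorm H (g w - m) + hnorm H (f w - l) * hnorm H m) F"
    using f(1) g(1)
  proof eventually_elim
    case (elim w)
    have "ip H (f w) (g w) - ip H l m = ip H (f w) (g w - m) + ip H (f w - l) m"
      using elim f(2) g(2) by simp
    then have "norm (ip H (f w) (g w) - ip H l m) \<le> cmod (ip H (f w) (g w - m)) + cmod (ip H (f w - l) m)"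
      by (metis norm_triangle_ineq)
    also have "\<dots> \<le> hnorm H (f w) * hnorm H (g w - m) + hnorm H (f w - l) * hnorm H m"
      using elim f(2) g(2) by (intro add_mono cauchy_schwarz) auto
    also have "hnorm H (f w) * hnorm H (g w - m) \<le> (hnorm H (f w - l) + hnorm H l) * hnorm H (g w - m)"
      using hnorm_triangle[of "f w - l" l] elim f(2) g(2) by (intro mult_right_mono) auto
    finally show ?case by simp
  qed
  ultimately have "((\<lambda>w. ip H (f w) (g w) - ip H l m) \<longlongrightarrow> 0) F"
    by (rule Lim_null_comparison[rotated])
  then show ?thesis by (simp add: LIM_zero_iff)
qed

context chilbert
begin

lemma geometric_convergent:
  assumes s: "\<And>n. s n \<in> car H" and r: "0 \<le> r" "r < 1"
    and le: "\<And>n. hnorm H (s (Suc n) - s n) \<le> C * r ^ n"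
  obtains x where "x \<in> car H" "(\<lambda>n. hnorm H (s n - x)) \<longlonglongrightarrow> 0"
proof -
  have C: "0 \<le> C" using order_trans[OF hnorm_nonneg[OF diff_car[OF s s]] le[of 0]] by simp
  \<comment> \<open>The geometric sum in closed form, so that the induction over \<open>k\<close>
    needs no separate summation.\<close>
  have tel: "hnorm H (s (n + k) - s n) \<le> C * (r ^ n - r ^ (n + k)) / (1 - r)" for n k
  proof (induction k)
    case (Suc k)
    have "hnorm H (s (n + Suc k) - s n) \<le> hnorm H (s (n + Suc k) - s (n + k)) + hnorm H (s (n + k) - s n)"
      using hnorm_triangle[of "s (n + Suc k) - s (n + k)" "s (n + k) - s n"] s by simp
    also have "\<dots> \<le> C * r ^ (n + k) + C * (r ^ n - r ^ (n + k)) / (1 - r)"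
      using le[of "n + k"] Suc by simp
    also have "\<dots> = C * (r ^ n - r ^ (n + Suc k)) / (1 - r)"
      using r by (simp add: field_simps)
    finally show ?case .
  qed (simp add: s)
  have bd: "hnorm H (s m - s n) \<le> C / (1 - r) * r ^ n" if nm: "n \<le> m" for m n
  proof -
    have "hnorm H (s m - s n) \<le> C * (r ^ n - r ^ m) / (1 - r)"
      using tel[of n "m - n"] nm by simp
    also have "\<dots> \<le> C * r ^ n / (1 - r)"
      using r C by (intro divide_right_mono mult_left_mono) auto
    finally show ?thesis by simp
  qed
  have lim: "(\<lambda>n. C / (1 - r) * r ^ n) \<longlonglongrightarrow> 0"
    using tendsto_mult_right_zero[OF LIMSEQ_realpow_zero[OF r]] .
  have "MCauchy s"
    unfolding MCauchy_iff[of s, OF s]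
  proof (intro allI impI)
    fix e :: real assume "e > 0"
    then obtain N where N: "\<And>n. N \<le> n \<Longrightarrow> C / (1 - r) * r ^ n < e"
      using order_tendstoD(2)[OF lim] by (auto simp: eventually_sequentially)
    have "hnorm H (s m - s n) < e" if "N \<le> m" "N \<le> n" for m n
    proof (cases "n \<le> m")
      case True
      then show ?thesis using bd[of n m] N[of n] that by simp
    next
      case False
      then show ?thesis using bd[of m n] N[of m] that s by (simp add: hnorm_diff_commute)
    qed
    then show "\<exists>N. \<forall>m n. N \<le> m \<longrightarrow> N \<le> n \<longrightarrow> hnorm H (s m - s n) < e" by blast
  qed
  then show thesis using complete[of s, OF s] that by blast
qed

text \<open>
  For a symmetric \<open>X\<close> with \<open>\<parallel>X\<parallel> \<le> p < 1\<close> the iteration \<open>Y \<mapsto> (X + Y\<^sup>2) / 2\<close> is a contraction on the ball of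
  radius \<open>r = 1 - sqrt (1 - p)\<close>, which satisfies \<open>r = (p + r\<^sup>2) / 2\<close>.  Its fixed point \<open>Y\<close> gives
  \<open>(I - Y)\<^sup>2 = I - X\<close> and commutes with everything that commutes with \<open>X\<close>.
\<close>

lemma sqrt_iteration:
  assumes X: "adjoint_ops H H X X" and p: "0 \<le> p" "p < 1"
    and Xp: "\<And>x. x \<in> car H \<Longrightarrow> hnorm H (X x) \<le> p * hnorm H x"
  obtains Y r where "adjoint_ops H H Y Y" "r < 1" "\<And>x. x \<in> car H \<Longrightarrow> hnorm H (Y x) \<le> r * hnorm H x"
    "\<And>x. x \<in> car H \<Longrightarrow> Y (Y x) = 2 *\<^sub>C Y x - X x"
    "\<And>B x. bounded_op H H B \<Longrightarrow> (\<And>x. x \<in> car H \<Longrightarrow> B (X x) = X (B x)) \<Longrightarrow> x \<in> car H \<Longrightarrow> B (Y x) = Y (B x)"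
proof -
  define r where "r = 1 - sqrt (1 - p)"
  have r: "0 \<le> r" "r < 1" using p by (auto simp: r_def)
  have r2: "p + r * r = 2 * r" using p by (simp add: r_def algebra_simps)
  define Y where "Y = rec_nat (\<lambda>x. 0) (\<lambda>_ Y x. (1/2) *\<^sub>C (X x + Y (Y x)))"
  have Y0: "Y 0 = (\<lambda>x. 0)" and YS: "Y (Suc n) = (\<lambda>x. (1/2) *\<^sub>C (X x + Y n (Y n x)))" for n
    by (simp_all add: Y_def)
  have adj: "adjoint_ops H H (Y n) (Y n)" for n
  proof (induction n)
    case 0
    show ?case unfolding Y0
      by (auto simp: adjoint_ops_def linear_on_def intro!: bounded_opI[where C = 0])
  next
    case (Suc n)
    show ?case unfolding YS
      using adjoint_ops_scale[OF inner inner adjoint_ops_plus[OF inner inner X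
        adjoint_ops_compose[OF inner inner inner Suc Suc]], of "1/2"] by simp
  qed
  note Yc [simp] = adjoint_opsD(3)[OF adj] and Xc [simp] = adjoint_opsD(3)[OF X]
  have Yd: "Y n (x - y) = Y n x - Y n y" if "x \<in> car H" "y \<in> car H" for n x y
    using bounded_op_diff[OF inner adjoint_opsD(1)[OF adj]] that by blast
  have Yr: "hnorm H (Y n x) \<le> r * hnorm H x" if "x \<in> car H" for n x
    using that
  proof (induction n arbitrary: x)
    case 0
    then show ?case using r by (simp add: Y0)
  next
    case (Suc n)
    have "hnorm H (Y n (Y n x)) \<le> r * (r * hnorm H x)"
      using Suc.IH[of "Y n x"] mult_left_mono[OF Suc.IH[OF Suc.prems] r(1)] Suc.prems by simp
    then have "hnorm H (X x + Y n (Y n x)) \<le> (p + r * r) * hnorm H x"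
      using hnorm_triangle[of "X x" "Y n (Y n x)"] Xp[OF Suc.prems] Suc.prems
      by (simp add: algebra_simps)
    then show ?case using Suc.prems by (simp add: YS r2)
  qed
  have step: "hnorm H (Y (Suc n) x - Y n x) \<le> hnorm H x * r ^ n" if "x \<in> car H" for n x
    using that
  proof (induction n arbitrary: x)
    case 0
    have "hnorm H (Y (Suc 0) x) \<le> 1 * hnorm H x"
      using Yr[OF 0, of "Suc 0"] r 0 by (meson hnorm_nonneg less_imp_le mult_right_mono order_trans)
    then show ?case using 0 by (simp add: Y0)
  next
    case (Suc n)
    note x = Suc.prems
    \<comment> \<open>The difference of squares is split as \<open>A (A - B) + (A - B) B\<close>
      with \<open>A\<close> and \<open>B\<close> two consecutive iterates. Each summand gains a
      factor \<open>r\<close>, and the factor \<open>1/2\<close> absorbs the fact that there are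
      two.\<close>
    have "Y (Suc (Suc n)) x - Y (Suc n) x
        = (1/2) *\<^sub>C (Y (Suc n) (Y (Suc n) x - Y n x) + (Y (Suc n) (Y n x) - Y n (Y n x)))"
      unfolding YS[of "Suc n"] YS[of n, THEN fun_cong, of x] complex_vector.scale_right_diff_distrib[symmetric]
      by (simp add: Yd x YS[of n, symmetric, THEN fun_cong])
    then have "hnorm H (Y (Suc (Suc n)) x - Y (Suc n) x)
        = 1/2 * hnorm H (Y (Suc n) (Y (Suc n) x - Y n x) + (Y (Suc n) (Y n x) - Y n (Y n x)))"
      using x by simp
    also have "\<dots> \<le> 1/2 * (hnorm H (Y (Suc n) (Y (Suc n) x - Y n x)) + hnorm H (Y (Suc n) (Y n x) - Y n (Y n x)))"
      using x by (intro mult_left_mono hnorm_triangle) auto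
    also have "hnorm H (Y (Suc n) (Y (Suc n) x - Y n x)) \<le> r * (hnorm H x * r ^ n)"
      using order_trans[OF Yr mult_left_mono[OF Suc.IH[OF x] r(1)]] x by simp
    also have "hnorm H (Y (Suc n) (Y n x) - Y n (Y n x)) \<le> (r * hnorm H x) * r ^ n"
      using order_trans[OF Suc.IH mult_right_mono[OF Yr[OF x, of n] zero_le_power[OF r(1), of n]]] x by simp
    finally show ?case by (simp add: mult_ac)
  qed
  have "\<exists>l\<in>car H. (\<lambda>n. hnorm H (Y n x - l)) \<longlonglongrightarrow> 0" if "x \<in> car H" for x
    using geometric_convergent[of "\<lambda>n. Y n x", OF _ r step[OF that]] that by auto
  then obtain L where L [simp]: "\<And>x. x \<in> car H \<Longrightarrow> L x \<in> car H"
    and lim: "\<And>x. x \<in> car H \<Longrightarrow> (\<lambda>n. hnorm H (Y n x - L x)) \<longlonglongrightarrow> 0" by metis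
  have T: "(\<lambda>n. ip H v (Y n x)) \<longlonglongrightarrow> ip H v (L x)" if "v \<in> car H" "x \<in> car H" for v x
    using ip_tendsto_right[OF _ L[OF that(2)] that(1) lim[OF that(2)]] that by simp
  have T2: "(\<lambda>n. ip H (Y n v) (Y n x)) \<longlonglongrightarrow> ip H (L v) (L x)" if "v \<in> car H" "x \<in> car H" for v x
    using ip_tendsto[OF _ L lim _ L lim] that by simp
  have Lsym: "ip H (L x) y = ip H x (L y)" if "x \<in> car H" "y \<in> car H" for x y
  proof -
    have "(\<lambda>n. ip H (Y n x) y) \<longlonglongrightarrow> ip H (L x) y"
      using ip_tendsto_left[OF _ L[OF that(1)] that(2) lim[OF that(1)]] that by simp
    then have "(\<lambda>n. ip H x (Y n y)) \<longlonglongrightarrow> ip H (L x) y" using adjoint_opsD(5)[OF adj] that by simp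
    then show ?thesis using LIMSEQ_unique T[OF that] by blast
  qed
  \<comment> \<open>Symmetry alone gives linearity: in \<open>ip H v (L (x + y))\<close> the map
    \<open>L\<close> moves to \<open>v\<close>.\<close>
  have Ladd: "L (x + y) = L x + L y" if "x \<in> car H" "y \<in> car H" for x y
    by (rule eq_by_ip) (simp_all add: that Lsym[symmetric])
  have Lscale: "L (a *\<^sub>C x) = a *\<^sub>C L x" if "x \<in> car H" for a x
    by (rule eq_by_ip) (simp_all add: that Lsym[symmetric])
  have Lr: "hnorm H (L x) \<le> r * hnorm H x" if x: "x \<in> car H" for x
  proof -
    have "hnorm H (L x) \<le> hnorm H (Y n x - L x) + r * hnorm H x" for n
      using hnorm_triangle_diff[of "Y n x" "Y n x - L x"] Yr[OF x, of n] x by simp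
    moreover have "(\<lambda>n. hnorm H (Y n x - L x) + r * hnorm H x) \<longlonglongrightarrow> 0 + r * hnorm H x"
      by (intro tendsto_intros lim x)
    ultimately have "hnorm H (L x) \<le> 0 + r * hnorm H x" by (intro LIMSEQ_le_const) auto
    then show ?thesis by simp
  qed
  have "bounded_op H H L"
    by (rule bounded_opI[where C = r]) (auto simp: linear_on_def Ladd Lscale Lr)
  then have 1: "adjoint_ops H H L L" by (simp add: adjoint_ops_def Lsym)
  have 2: "L (L x) = 2 *\<^sub>C L x - X x" if x: "x \<in> car H" for x
  proof (rule eq_by_ip)
    fix v assume v: "v \<in> car H"
    \<comment> \<open>The recursion is passed to the limit in weak form. Moving one factor
      \<open>Y n\<close> to the left leaves two strongly convergent sequences.\<close>
    have "(\<lambda>n. 2 * ip H v (Y (Suc n) x) - ip H v (X x)) \<longlonglongrightarrow> 2 * ip H v (L x) - ip H v (X x)"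
      by (intro tendsto_intros LIMSEQ_Suc[OF T] v x)
    moreover have "2 * ip H v (Y (Suc n) x) - ip H v (X x) = ip H (Y n v) (Y n x)" for n
      using x v adjoint_opsD(5)[OF adj, of v "Y n x" n] by (simp add: YS add_divide_distrib)
    ultimately have "ip H (L v) (L x) = 2 * ip H v (L x) - ip H v (X x)"
      using T2[OF v x] LIMSEQ_unique by auto
    then show "ip H v (L (L x)) = ip H v (2 *\<^sub>C L x - X x)" using v x by (simp add: Lsym)
  qed (use x in auto)
  have 3: "B (L x) = L (B x)"
    if B: "bounded_op H H B" and BX: "\<And>x. x \<in> car H \<Longrightarrow> B (X x) = X (B x)" and x: "x \<in> car H" for B x
  proof (rule eq_by_ip)
    note Bc [simp] = bounded_op_car[OF B]
    show "B (L x) \<in> car H" "L (B x) \<in> car H" using x by auto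
    fix v assume v: "v \<in> car H"
    have BY: "B (Y n x) = Y n (B x)" if "x \<in> car H" for n x
      using that
    proof (induction n arbitrary: x)
      case (Suc n)
      then show ?case by (simp add: YS BX bounded_op_scaleC[OF B] bounded_op_add[OF B])
    qed (simp add: Y0 bounded_op_zero[OF inner B])
    note B' = adjoint_ops_sym[OF inner inner adjoint_ops_adj[OF hilbert inner B]]
    have "(\<lambda>n. ip H (adj H H B v) (Y n x)) \<longlonglongrightarrow> ip H (adj H H B v) (L x)"
      using T adjoint_opsD(3)[OF B' v] x by blast
    then have "(\<lambda>n. ip H v (Y n (B x))) \<longlonglongrightarrow> ip H v (B (L x))"
      using adjoint_opsD(5)[OF B' v] x BY[OF x] by simp
    then show "ip H v (B (L x)) = ip H v (L (B x))"
      using T[OF v bounded_op_car[OF B x]] LIMSEQ_unique by blast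
  qed
  show thesis by (rule that[OF 1 r(2) Lr 2 3])
qed

text \<open>The operator \<open>X = I - t A\<close> has norm at most \<open>sqrt q < 1\<close>, and
  a solution of \<open>(I - Y)^2 = I - X = t A\<close> gives the root
  \<open>R = (I - Y) / sqrt t\<close>. Since \<open>Y\<close> has norm below 1, \<open>R\<close> is
  coercive, hence invertible. Uniqueness: a positive root \<open>B\<close> commutes with
  \<open>A\<close>, therefore with \<open>Y\<close> and \<open>R\<close>, so that
  \<open>(B + R) (B - R) = 0\<close>, and coercivity of \<open>R\<close> forces
  \<open>B = R\<close>.\<close>

lemma op_sqrt_props:
  assumes A: "adjoint_ops H H A A" and c: "c > 0"
    and coer: "\<And>x. x \<in> car H \<Longrightarrow> c * (hnorm H x)\<^sup>2 \<le> Re (ip H (A x) x)"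
  shows "adjoint_ops H H (op_sqrt H A) (op_sqrt H A)"
    and "x \<in> car H \<Longrightarrow> op_sqrt H A (op_sqrt H A x) = A x"
    and "invertible_op H H (op_sqrt H A)"
proof -
  note Ac [simp] = adjoint_opsD(3)[OF A]
  obtain M0 where M0: "M0 > 0" "\<And>x. x \<in> car H \<Longrightarrow> hnorm H (A x) \<le> M0 * hnorm H x"
    using bounded_op_bound[OF inner adjoint_opsD(1)[OF A]] by blast
  \<comment> \<open>The maximum ensures \<open>c \<le> M\<close>, so that \<open>q\<close> below is
    not negative.\<close>
  define M where "M = max M0 c"
  have M: "M > 0" "c \<le> M" using c by (auto simp: M_def)
  have AM: "hnorm H (A x) \<le> M * hnorm H x" if "x \<in> car H" for x
    using M0(2)[OF that] mult_right_mono[of M0 M "hnorm H x"] that by (simp add: M_def)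
  \<comment> \<open>This value minimises the bound \<open>1 - 2 t c + (t M)^2\<close> for the
    squared norm of \<open>I - t A\<close>; the minimum is \<open>q\<close>.\<close>
  define t where "t = c / M\<^sup>2"
  have t: "t > 0" using c M by (simp add: t_def)
  define q where "q = 1 - c\<^sup>2 / M\<^sup>2"
  have q: "0 \<le> q" "q < 1" using c M by (auto simp: q_def power_mono)
  define X where "X x = x + complex_of_real (- t) *\<^sub>C A x" for x
  have id: "adjoint_ops H H (\<lambda>x. x) (\<lambda>x. x)" by (simp add: adjoint_ops_def bounded_op_id)
  have X: "adjoint_ops H H X X"
    using adjoint_ops_plus[OF inner inner id adjoint_ops_scale[OF inner inner A, of "of_real (- t)"]]
    by (simp add: X_def[abs_def])
  have Xq: "hnorm H (X x) \<le> sqrt q * hnorm H x" if x: "x \<in> car H" for x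
  proof -
    have "(hnorm H (X x))\<^sup>2 = (hnorm H x)\<^sup>2 - 2 * t * Re (ip H (A x) x) + t\<^sup>2 * (hnorm H (A x))\<^sup>2"
      unfolding X_def using x t ip_commute[of "A x" x] by (subst hnorm_add_sq) (auto simp: power_mult_distrib)
    also have "\<dots> \<le> (hnorm H x)\<^sup>2 - 2 * t * (c * (hnorm H x)\<^sup>2) + t\<^sup>2 * (M * hnorm H x)\<^sup>2"
      using coer[OF x] AM[OF x] x t by (intro add_mono diff_mono mult_left_mono power_mono) auto
    also have "\<dots> = (1 - 2 * t * c + (t * M)\<^sup>2) * (hnorm H x)\<^sup>2"
      by (simp add: power2_eq_square algebra_simps)
    also have "1 - 2 * t * c + (t * M)\<^sup>2 = q"
      using M by (simp add: q_def t_def power2_eq_square field_simps)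
    finally have "sqrt ((hnorm H (X x))\<^sup>2) \<le> sqrt (q * (hnorm H x)\<^sup>2)" by (rule real_sqrt_le_mono)
    then show ?thesis using x adjoint_opsD(3)[OF X x] by (simp add: real_sqrt_mult)
  qed
  have "0 \<le> sqrt q" "sqrt q < 1" using q by auto
  then obtain Y r where Y: "adjoint_ops H H Y Y" and r: "r < 1"
    and Yr: "\<And>x. x \<in> car H \<Longrightarrow> hnorm H (Y x) \<le> r * hnorm H x"
    and YY: "\<And>x. x \<in> car H \<Longrightarrow> Y (Y x) = 2 *\<^sub>C Y x - X x"
    and comm: "\<And>B x. bounded_op H H B \<Longrightarrow> (\<And>x. x \<in> car H \<Longrightarrow> B (X x) = X (B x)) \<Longrightarrow> x \<in> car H \<Longrightarrow> B (Y x) = Y (B x)"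
    by (rule sqrt_iteration[OF X _ _ Xq]) blast+
  note Yc [simp] = adjoint_opsD(3)[OF Y]
  define k where "k = 1 / sqrt t"
  have k: "k > 0" "k * k * t = 1" using t by (auto simp: k_def)
  \<comment> \<open>The value 0 off the carrier matches the normalisation in \<open>op_sqrt\<close>,
    which asks for equality of functions.\<close>
  define R where "R x = (if x \<in> car H then of_real k *\<^sub>C (x + (- 1) *\<^sub>C Y x) else 0)" for x
  have Rc [simp]: "R x \<in> car H" for x by (simp add: R_def)
  have adjR: "adjoint_ops H H (\<lambda>x. of_real k *\<^sub>C (x + (- 1) *\<^sub>C Y x)) (\<lambda>x. of_real k *\<^sub>C (x + (- 1) *\<^sub>C Y x))"
    using adjoint_ops_scale[OF inner inner adjoint_ops_plus[OF inner inner id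
      adjoint_ops_scale[OF inner inner Y, of "- 1"]], of "of_real k"] by simp
  have R: "adjoint_ops H H R R"
    using adjR bounded_op_cong[OF inner adjoint_opsD(1)[OF adjR], of R] by (simp add: adjoint_ops_def R_def)
  have RR: "R (R x) = A x" if x: "x \<in> car H" for x
  proof (rule eq_by_ip)
    fix v assume v: "v \<in> car H"
    have "ip H v (R (R x)) = ip H (R v) (R x)" using adjoint_opsD(5)[OF R v, of "R x"] by simp
    also have "\<dots> = (k * k) * (ip H v x - ip H v (Y x) - ip H (Y v) x + ip H (Y v) (Y x))"
      using v x by (simp add: R_def algebra_simps)
    also have "ip H (Y v) (Y x) = 2 * ip H v (Y x) - ip H v (X x)"
      using v x adjoint_opsD(3)[OF X x] by (simp add: adjoint_opsD(5)[OF Y] YY)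
    also have "ip H (Y v) x = ip H v (Y x)" using v x by (simp add: adjoint_opsD(5)[OF Y])
    also have "ip H v (X x) = ip H v x - t * ip H v (A x)" using v x by (simp add: X_def)
    finally have "ip H v (R (R x)) = of_real (k * k * t) * ip H v (A x)" by (simp add: algebra_simps)
    then show "ip H v (R (R x)) = ip H v (A x)" by (simp only: k) simp
  qed (use x in auto)
  have Rcoer: "k * (1 - r) * (hnorm H x)\<^sup>2 \<le> Re (ip H (R x) x)" if x: "x \<in> car H" for x
  proof -
    have "Re (ip H (Y x) x) \<le> hnorm H (Y x) * hnorm H x"
      using cauchy_schwarz[of "Y x" x] complex_Re_le_cmod[of "ip H (Y x) x"] x by simp
    also have "\<dots> \<le> r * hnorm H x * hnorm H x" using Yr[OF x] x by (simp add: mult_right_mono)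
    finally have "(1 - r) * (hnorm H x)\<^sup>2 \<le> Re (ip H x x - ip H (Y x) x)"
      using x by (simp add: Re_ip_self power2_eq_square algebra_simps)
    then have "k * ((1 - r) * (hnorm H x)\<^sup>2) \<le> k * Re (ip H x x - ip H (Y x) x)"
      using k by (intro mult_left_mono) auto
    then show ?thesis using x by (simp add: R_def mult.assoc)
  qed
  have kr: "k * (1 - r) > 0" using k r by simp
  have Rpos: "positive_op H R"
    unfolding positive_op_def
  proof (intro conjI ballI adjoint_opsD(1)[OF R])
    fix x assume x: "x \<in> car H"
    have "ip H (R x) x = cnj (ip H (R x) x)"
      using adjoint_opsD(5)[OF R x x] ip_commute[of "R x" x] x by simp
    from arg_cong[OF this, of Im] show "Im (ip H (R x) x) = 0" by simp
    show "0 \<le> Re (ip H (R x) x)" using Rcoer[OF x] kr by (meson less_imp_le mult_nonneg_nonneg order_trans zero_le_power2)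
  qed
  have uniq: "B = R" if B: "positive_op H B" "\<forall>x\<in>car H. B (B x) = A x" "\<forall>x. x \<notin> car H \<longrightarrow> B x = 0" for B
  proof
    fix x
    have Bb: "bounded_op H H B" using B(1) by (simp add: positive_op_def)
    note Bs [simp] = bounded_op_car[OF Bb] bounded_op_add[OF Bb] bounded_op_scaleC[OF Bb] bounded_op_diff[OF inner Bb]
    note Rs [simp] = bounded_op_add[OF adjoint_opsD(1)[OF R]] bounded_op_scaleC[OF adjoint_opsD(1)[OF R]]
      bounded_op_diff[OF inner adjoint_opsD(1)[OF R]]
    show "B x = R x"
    proof (cases "x \<in> car H")
      case x [simp]: True
      have "B (A y) = A (B y)" if "y \<in> car H" for y using B(2) that Bs(1) by metis
      then have "B (X y) = X (B y)" if "y \<in> car H" for y using that by (simp add: X_def)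
      then have "B (Y y) = Y (B y)" if "y \<in> car H" for y using comm[OF Bb] that by blast
      then have BR: "B (R y) = R (B y)" if "y \<in> car H" for y using that by (simp add: R_def)
      \<comment> \<open>Because \<open>B\<close> and \<open>R\<close> commute on the carrier,
        \<open>B y + R y\<close> reduces to \<open>B (B x) - R (R x) = 0\<close>. Both quadratic
        forms are nonnegative, so the coercive one vanishes at \<open>y\<close>.\<close>
      define y where "y = B x - R x"
      have y: "y \<in> car H" by (simp add: y_def)
      have "B y + R y = 0" using B(2) RR BR by (simp add: y_def)
      then have "ip H (B y) y + ip H (R y) y = 0" using y by (metis Bs(1) Rc ip_add_left ip_zero_left)
      then have "Re (ip H (B y) y) + Re (ip H (R y) y) = 0" by (metis plus_complex.sel(1) zero_complex.sel(1))
      moreover have "Re (ip H (B y) y) \<ge> 0" using B(1) y by (simp add: positive_op_def)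
      ultimately have "k * (1 - r) * (hnorm H y)\<^sup>2 \<le> 0" using Rcoer[OF y] by linarith
      then have "y = 0" using k(1) r y by (auto simp: mult_le_0_iff)
      then show ?thesis by (simp add: y_def)
    qed (simp add: B(3) R_def)
  qed
  have S: "op_sqrt H A = R"
    unfolding op_sqrt_def
  proof (rule the_equality)
    have "\<forall>x. x \<notin> car H \<longrightarrow> R x = 0" by (simp add: R_def)
    then show "positive_op H R \<and> (\<forall>x\<in>car H. R (R x) = A x) \<and> (\<forall>x. x \<notin> car H \<longrightarrow> R x = 0)"
      using Rpos RR by blast
  qed (use uniq in blast)
  have "k * (1 - r) * (hnorm H x)\<^sup>2 \<le> cmod (ip H (R x) x)" if "x \<in> car H" for x
    using Rcoer[OF that] complex_Re_le_cmod order_trans by blast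
  then have "invertible_op H H R" using lax_milgram[OF adjoint_opsD(1)[OF R] kr] by blast
  then show "adjoint_ops H H (op_sqrt H A) (op_sqrt H A)" "invertible_op H H (op_sqrt H A)"
    "x \<in> car H \<Longrightarrow> op_sqrt H A (op_sqrt H A x) = A x"
    using R RR by (auto simp: S)
qed

end

section \<open>Transport along unitary maps\<close>

lemma eventually_nonreal:
  assumes "z \<in> nonreal"
  shows "\<forall>\<^sub>F w in at z. w \<in> nonreal"
proof -
  have "open (nonreal)" unfolding nonreal_def by (intro open_Collect_neq continuous_intros)
  then show ?thesis using assms by (rule eventually_at_in_open')
qed

lemma cnj_nonreal [simp]: "cnj z \<in> nonreal \<longleftrightarrow> z \<in> nonreal"
  by (simp add: nonreal_def)

locale cunitary = H1: cinner H1 + H2: cinner H2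
  for H1 :: "'a::complex_vector hspace" and H2 :: "'b::complex_vector hspace" +
  fixes U :: "'a \<Rightarrow> 'b"
  assumes unitary: "unitary_op H1 H2 U"
begin

lemma U_linear: "linear_on (car H1) U"
  and U_image: "U ` car H1 = car H2"
  and U_ip [simp]: "x \<in> car H1 \<Longrightarrow> y \<in> car H1 \<Longrightarrow> ip H2 (U x) (U y) = ip H1 x y"
  using unitary by (auto simp: unitary_op_def)

lemma U_car [simp]: "x \<in> car H1 \<Longrightarrow> U x \<in> car H2"
  using U_image by blast

lemma U_add: "x \<in> car H1 \<Longrightarrow> y \<in> car H1 \<Longrightarrow> U (x + y) = U x + U y"
  and U_scaleC: "x \<in> car H1 \<Longrightarrow> U (a *\<^sub>C x) = a *\<^sub>C U x"
  and U_diff: "x \<in> car H1 \<Longrightarrow> y \<in> car H1 \<Longrightarrow> U (x - y) = U x - U y"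
  and U_0: "U 0 = 0"
  using linear_on_add[OF U_linear] linear_on_scaleC[OF U_linear] linear_on_diff[OF U_linear H1.sub]
    linear_on_0[OF U_linear H1.sub] by auto

lemma hnorm_U [simp]: "x \<in> car H1 \<Longrightarrow> hnorm H2 (U x) = hnorm H1 x"
  by (simp add: hnorm_def)

lemma inj_U: "inj_on U (car H1)"
proof (rule inj_onI)
  fix x y assume x: "x \<in> car H1" "y \<in> car H1" "U x = U y"
  then have "hnorm H1 (x - y) = 0" by (metis H1.diff_car U_diff diff_self H2.hnorm_zero hnorm_U)
  then show "x = y" using x by simp
qed

lemma U_bounded: "bounded_op H1 H2 U"
  by (rule bounded_opI[where C = 1]) (simp_all add: U_linear)

definition Ui where "Ui = inv_into (car H1) U"

lemma Ui_U [simp]: "x \<in> car H1 \<Longrightarrow> Ui (U x) = x"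
  by (simp add: Ui_def inj_U)

lemma U_Ui [simp]: "y \<in> car H2 \<Longrightarrow> U (Ui y) = y"
  using U_image by (simp add: Ui_def f_inv_into_f)

lemma Ui_car [simp]: "y \<in> car H2 \<Longrightarrow> Ui y \<in> car H1"
  using U_image by (simp add: Ui_def inv_into_into)

lemma Ui_eqI: "x \<in> car H1 \<Longrightarrow> U x = y \<Longrightarrow> Ui y = x"
  using Ui_U by blast

lemma ip_Ui: "y \<in> car H2 \<Longrightarrow> z \<in> car H2 \<Longrightarrow> ip H1 (Ui y) (Ui z) = ip H2 y z"
  using U_ip[of "Ui y" "Ui z"] by simp

lemma unitary_Ui: "unitary_op H2 H1 Ui"
  unfolding unitary_op_def linear_on_def
proof (intro conjI ballI allI)
  show "Ui ` car H2 = car H1" using Ui_U Ui_car U_car by (metis image_eqI image_subset_iff subsetI subset_antisym)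
  show "Ui (x + y) = Ui x + Ui y" if "x \<in> car H2" "y \<in> car H2" for x y
    by (rule Ui_eqI) (simp_all add: that U_add)
  show "Ui (a *\<^sub>C x) = a *\<^sub>C Ui x" if "x \<in> car H2" for a x
    by (rule Ui_eqI) (simp_all add: that U_scaleC)
qed (simp add: ip_Ui)

lemma hdist_U: "x \<in> car H1 \<Longrightarrow> y \<in> car H1 \<Longrightarrow> hdist H2 (U x) (U y) = hdist H1 x y"
  by (simp add: hdist_def U_diff[symmetric])

lemma continuous_map_U: "continuous_map (htop H1) (htop H2) U"
  unfolding H1.htop_eq H2.htop_eq H1.metric_continuous_map[OF H2.Metric_space_axioms]
  using hdist_U by auto

lemma cunitary_Ui: "cunitary H2 H1 Ui"
  by unfold_locales (rule unitary_Ui)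

lemma homeomorphic_maps_U: "homeomorphic_maps (htop H1) (htop H2) U Ui"
  by (simp add: homeomorphic_maps_def continuous_map_U cunitary.continuous_map_U[OF cunitary_Ui])

lemma homeomorphic_map_U: "homeomorphic_map (htop H1) (htop H2) U"
  using homeomorphic_maps_U homeomorphic_maps_imp_map by blast

lemma closure_of_U: "S \<subseteq> car H1 \<Longrightarrow> htop H2 closure_of (U ` S) = U ` (htop H1 closure_of S)"
  using homeomorphic_map_closure_of[OF homeomorphic_map_U] by simp

lemma span_U:
  assumes B: "B \<subseteq> car H1"
  shows "complex_vector.span (U ` B) = U ` complex_vector.span B"
proof
  have sp: "complex_vector.span B \<subseteq> car H1" using B H1.sub by (rule complex_vector.span_minimal)
  have "complex_vector.subspace (U ` complex_vector.span B)"
    by (intro linear_on_image_subspace linear_on_subset[OF U_linear sp] complex_vector.subspace_span)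
  moreover have "U ` B \<subseteq> U ` complex_vector.span B" using complex_vector.span_superset by blast
  ultimately show "complex_vector.span (U ` B) \<subseteq> U ` complex_vector.span B"
    by (simp add: complex_vector.span_minimal)
  have "x \<in> car H1 \<and> U x \<in> complex_vector.span (U ` B)" if "x \<in> complex_vector.span B" for x
    using that
  proof (induction rule: complex_vector.span_induct_alt)
    case base
    then show ?case by (simp add: U_0 complex_vector.span_zero)
  next
    case (step c x y)
    then have "x \<in> car H1" "U x \<in> complex_vector.span (U ` B)" using B by (auto intro: complex_vector.span_base)
    then show ?case using step
      by (simp add: U_add U_scaleC complex_vector.span_add complex_vector.span_scale)
  qed
  then show "U ` complex_vector.span B \<subseteq> complex_vector.span (U ` B)" by blast
qed

lemma closed_span_U: "B \<subseteq> car H1 \<Longrightarrow> closed_span H2 (U ` B) = U ` closed_span H1 B"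
  unfolding closed_span_def span_U
  by (intro closure_of_U complex_vector.span_minimal H1.sub)

lemma has_hdim_U:
  assumes "has_hdim H1 n"
  shows "has_hdim H2 n"
proof -
  obtain B where B: "B \<subseteq> car H1" "\<forall>x\<in>B. \<forall>y\<in>B. ip H1 x y = (if x = y then 1 else 0)"
    "closed_span H1 B = car H1" "n = (if finite B then enat (card B) else \<infinity>)"
    using assms by (auto simp: has_hdim_def)
  have inj: "inj_on U B" using inj_U B(1) by (rule inj_on_subset)
  have ip: "ip H2 (U x) (U y) = (if U x = U y then 1 else 0)" if "x \<in> B" "y \<in> B" for x y
  proof -
    have "x \<in> car H1" "y \<in> car H1" using that B(1) by auto
    then show ?thesis using that B(2) inj by (simp add: inj_on_eq_iff)
  qed
  show ?thesis unfolding has_hdim_def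
  proof (intro exI[of _ "U ` B"] conjI)
    show "closed_span H2 (U ` B) = car H2" using closed_span_U[OF B(1)] B(3) U_image by simp
    show "n = (if finite (U ` B) then enat (card (U ` B)) else \<infinity>)"
      using B(4) inj by (simp add: finite_image_iff card_image)
  qed (use B(1) ip in auto)
qed

lemma ortho_U:
  assumes S: "S \<subseteq> car H1"
  shows "ortho H2 (U ` S) = U ` ortho H1 S"
proof
  show "U ` ortho H1 S \<subseteq> ortho H2 (U ` S)"
  proof clarify
    fix x assume "x \<in> ortho H1 S"
    then have x: "x \<in> car H1" "\<And>y. y \<in> S \<Longrightarrow> ip H1 x y = 0" by (auto simp: ortho_def)
    then show "U x \<in> ortho H2 (U ` S)" using S by (auto simp: ortho_def subset_iff)
  qed
  show "ortho H2 (U ` S) \<subseteq> U ` ortho H1 S"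
  proof
    fix y assume "y \<in> ortho H2 (U ` S)"
    then have y: "y \<in> car H2" "\<And>s. s \<in> S \<Longrightarrow> ip H2 y (U s) = 0" by (auto simp: ortho_def)
    have "ip H1 (Ui y) s = 0" if "s \<in> S" for s
    proof -
      have "s \<in> car H1" using that S by blast
      then show ?thesis using y(2)[OF that] U_ip[of "Ui y" s] y(1) by simp
    qed
    then have "Ui y \<in> ortho H1 S" using y by (simp add: ortho_def)
    then show "y \<in> U ` ortho H1 S" using y(1) by (metis U_Ui imageI)
  qed
qed

lemma hilbert_U:
  assumes "hilbert_space H1"
  shows "hilbert_space H2"
proof -
  have "\<exists>x. limitin H2.mtopology s x sequentially" if "H2.MCauchy s" for s
  proof -
    have s: "s n \<in> car H2" for n using that by (auto simp: H2.MCauchy_def)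
    have "H1.MCauchy (\<lambda>n. Ui (s n))"
      using that s by (simp add: H1.MCauchy_def H2.MCauchy_def image_subset_iff cunitary.hdist_U[OF cunitary_Ui])
    then obtain x where "limitin H1.mtopology (\<lambda>n. Ui (s n)) x sequentially"
      using assms by (auto simp: hilbert_space_def H1.mcomplete_def)
    then have "limitin (htop H2) (U \<circ> (\<lambda>n. Ui (s n))) (U x) sequentially"
      by (intro continuous_map_limit[OF continuous_map_U]) (simp add: H1.htop_eq)
    moreover have "U \<circ> (\<lambda>n. Ui (s n)) = s" using s by (simp add: o_def)
    ultimately show ?thesis by (auto simp: H2.htop_eq)
  qed
  then show ?thesis by (simp add: hilbert_space_def H2.inner H2.mcomplete_def)
qed

lemma separable_U: "separable_hilbert_space H1 \<Longrightarrow> separable_hilbert_space H2"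
  unfolding separable_hilbert_space_def
  using hilbert_U homeomorphic_maps_U homeomorphic_separable_space homeomorphic_space_def by blast

lemma restr_unitary:
  assumes S: "S \<subseteq> car H1" "complex_vector.subspace S"
  shows "cunitary (restr H1 S) (restr H2 (U ` S)) U"
proof (intro cunitary.intro cinner.intro cunitary_axioms.intro)
  show "inner_space (restr H1 S)" by (rule H1.inner_restr[OF S])
  show "inner_space (restr H2 (U ` S))"
    using S by (intro H2.inner_restr linear_on_image_subspace linear_on_subset[OF U_linear]) auto
  show "unitary_op (restr H1 S) (restr H2 (U ` S)) U"
    using linear_on_subset[OF U_linear S(1)] S(1) by (auto simp: unitary_op_def subset_iff)
qed

end

lemma op_range_subset:
  assumes "inner_space H" "linear_operator H T"
  shows "op_range T \<mu> \<subseteq> car H"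
proof -
  interpret cinner H by unfold_locales fact
  show ?thesis using assms(2) by (auto simp: linear_operator_def op_range_def subset_iff image_subset_iff)
qed

text \<open>Each condition in \<open>sym_class\<close>, and also being a model, is stated through
  inner products, ranges and topology, all preserved by \<open>U\<close>. A single intertwining
  unitary therefore settles these conditions for the multiplication operator.\<close>

locale intertwined = cunitary H1 H2 U
  for H1 :: "'a::complex_vector hspace" and H2 :: "'b::complex_vector hspace" and U +
  fixes T1 :: "'a lin_op" and T2 :: "'b lin_op"
  assumes op1: "linear_operator H1 T1"
    and dom: "U ` opdom T1 = opdom T2"
    and app: "x \<in> opdom T1 \<Longrightarrow> U (opapp T1 x) = opapp T2 (U x)"
begin

lemma dom1: "x \<in> opdom T1 \<Longrightarrow> x \<in> car H1" "x \<in> opdom T1 \<Longrightarrow> opapp T1 x \<in> car H1"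
  using op1 by (auto simp: linear_operator_def)

lemma dom_subset: "opdom T1 \<subseteq> car H1"
  using dom1 by blast

lemma op_range_U: "op_range T2 \<mu> = U ` op_range T1 \<mu>"
  unfolding op_range_def dom[symmetric] image_image
  by (intro image_cong refl) (simp add: dom1 app[symmetric] U_diff U_scaleC)

lemma op_range1: "op_range T1 \<mu> \<subseteq> car H1"
  by (rule op_range_subset[OF H1.inner op1])

lemma ortho_range_U: "ortho H2 (op_range T2 \<mu>) = U ` ortho H1 (op_range T1 \<mu>)"
  by (simp add: op_range_U ortho_U[OF op_range1])

lemma ortho_range_unitary:
  "cunitary (restr H1 (ortho H1 (op_range T1 \<mu>))) (restr H2 (ortho H2 (op_range T2 \<mu>))) U"
  unfolding ortho_range_U
  by (intro restr_unitary H1.ortho_subspace op_range1) (auto simp: ortho_def)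

lemma linear_operator_U: "linear_operator H2 T2"
proof -
  have s1: "complex_vector.subspace (opdom T1)" and l1: "linear_on (opdom T1) (opapp T1)"
    using op1 by (auto simp: linear_operator_def)
  have "linear_on (opdom T2) (opapp T2)"
    unfolding dom[symmetric] linear_on_def
  proof safe
    fix x y assume xy: "x \<in> opdom T1" "y \<in> opdom T1"
    then have "opapp T2 (U x + U y) = U (opapp T1 (x + y))"
      by (simp add: app complex_vector.subspace_add[OF s1] U_add dom1)
    then show "opapp T2 (U x + U y) = opapp T2 (U x) + opapp T2 (U y)"
      using xy by (simp add: linear_on_add[OF l1] U_add dom1 app)
  next
    fix a x assume x: "x \<in> opdom T1"
    then have "opapp T2 (a *\<^sub>C U x) = U (opapp T1 (a *\<^sub>C x))"
      by (simp add: app complex_vector.subspace_scale[OF s1] U_scaleC dom1)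
    then show "opapp T2 (a *\<^sub>C U x) = a *\<^sub>C opapp T2 (U x)"
      using x by (simp add: linear_on_scaleC[OF l1] U_scaleC dom1 app)
  qed
  moreover have "complex_vector.subspace (opdom T2)"
    unfolding dom[symmetric] by (intro linear_on_image_subspace linear_on_subset[OF U_linear] dom_subset s1)
  moreover have "opapp T2 ` opdom T2 \<subseteq> car H2" "opdom T2 \<subseteq> car H2"
    unfolding dom[symmetric] by (auto simp: app[symmetric] dom1)
  ultimately show ?thesis by (simp add: linear_operator_def)
qed

lemma closed_operator_U:
  assumes "closed_operator H1 T1"
  shows "closed_operator H2 T2"
proof -
  have "homeomorphic_map (prod_topology (htop H1) (htop H1)) (prod_topology (htop H2) (htop H2))
      (\<lambda>(x, y). (U x, U y))"
    using homeomorphic_maps_prod homeomorphic_maps_U homeomorphic_maps_imp_map by blast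
  then have "closedin (prod_topology (htop H2) (htop H2))
      ((\<lambda>(x, y). (U x, U y)) ` (\<lambda>x. (x, opapp T1 x)) ` opdom T1)"
    using assms unfolding closed_operator_def by (meson homeomorphic_map_closedness_eq)
  also have "(\<lambda>(x, y). (U x, U y)) ` (\<lambda>x. (x, opapp T1 x)) ` opdom T1 = (\<lambda>x. (x, opapp T2 x)) ` opdom T2"
    by (auto simp: dom[symmetric] image_image app)
  finally show ?thesis by (simp add: closed_operator_def)
qed

lemma simple_operator_U:
  assumes "simple_operator T1"
  shows "simple_operator T2"
proof -
  have ne: "\<i> \<in> nonreal" by (simp add: nonreal_def)
  have "(\<Inter>\<mu>\<in>nonreal. op_range T2 \<mu>) = U ` (\<Inter>\<mu>\<in>nonreal. op_range T1 \<mu>)"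
    unfolding op_range_U
    by (rule image_INT[symmetric, where C = "car H1", OF inj_U _ ne]) (use op_range1 in blast)
  also have "\<dots> = {0}" using assms by (simp add: simple_operator_def U_0)
  finally show ?thesis by (simp add: simple_operator_def)
qed

lemma sym_class_U:
  assumes "T1 \<in> \<S>\<^bsub>n\<^esub> H1"
  shows "T2 \<in> \<S>\<^bsub>n\<^esub> H2"
proof -
  have "densely_defined H2 T2"
    using assms closure_of_U[OF dom_subset] by (simp add: densely_defined_def sym_class_def dom U_image)
  moreover have "symmetric_operator H2 T2"
    using assms by (auto simp: symmetric_operator_def sym_class_def dom[symmetric] app[symmetric] dom1)
  ultimately show ?thesis
    using assms linear_operator_U closed_operator_U simple_operator_U separable_U
      cunitary.has_hdim_U[OF ortho_range_unitary]
    by (simp add: sym_class_def)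
qed

text \<open>\<open>model_kernel\<close> depends only on inner products of vectors
  \<open>\<Gamma> \<mu> x\<close>, which \<open>U\<close> preserves, so both models have the same
  kernel on \<open>car K\<close>; the remaining conditions are images under
  \<open>U\<close>.\<close>

lemma is_model_U:
  assumes model: "is_model K H1 T1 \<Gamma>" and K: "inner_space K"
  shows "is_model K H2 T2 (\<lambda>\<mu> x. U (\<Gamma> \<mu> x))"
proof -
  interpret K: cinner K by unfold_locales fact
  have G: "bounded_op K H1 (\<Gamma> \<mu>)" if "\<mu> \<in> nonreal" for \<mu> using model that by (simp add: is_model_def)
  note Gc [simp] = bounded_op_car[OF G]
  show ?thesis
    unfolding is_model_def
  proof (intro conjI ballI allI impI)
    show "bounded_op K H2 (\<lambda>x. U (\<Gamma> \<mu> x))" if "\<mu> \<in> nonreal" for \<mu>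
      by (rule bounded_op_compose[OF K H1.inner G[OF that] U_bounded])
    show "op_coanalytic K H2 (\<lambda>\<mu> x. U (\<Gamma> \<mu> x))"
      unfolding op_coanalytic_def op_analytic_on_def
    proof
      fix z assume z: "z \<in> nonreal"
      obtain D where D: "bounded_op K H1 D" and lim: "\<And>e. e > 0 \<Longrightarrow> \<forall>\<^sub>F w in at z. \<forall>x\<in>car K.
           hnorm H1 (inverse (w - z) *\<^sub>C (\<Gamma> (cnj w) x - \<Gamma> (cnj z) x) - D x) \<le> e * hnorm K x"
        using model z unfolding is_model_def op_coanalytic_def op_analytic_on_def by blast
      have nr: "\<forall>\<^sub>F w in at z. cnj w \<in> nonreal" using eventually_nonreal[OF z] by simp
      show "\<exists>D. bounded_op K H2 D \<and> (\<forall>e>0. \<forall>\<^sub>F w in at z. \<forall>x\<in>car K.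
           hnorm H2 (inverse (w - z) *\<^sub>C (U (\<Gamma> (cnj w) x) - U (\<Gamma> (cnj z) x)) - D x) \<le> e * hnorm K x)"
      proof (intro exI[of _ "\<lambda>x. U (D x)"] conjI allI impI bounded_op_compose[OF K H1.inner D U_bounded])
        fix e :: real assume "e > 0"
        from lim[OF this] nr show "\<forall>\<^sub>F w in at z. \<forall>x\<in>car K.
           hnorm H2 (inverse (w - z) *\<^sub>C (U (\<Gamma> (cnj w) x) - U (\<Gamma> (cnj z) x)) - U (D x)) \<le> e * hnorm K x"
          by eventually_elim (simp add: z bounded_op_car[OF D] U_diff[symmetric] U_scaleC[symmetric])
      qed
    qed
    show "invertible_op K (restr H2 (ortho H2 (op_range T2 \<mu>))) (\<lambda>x. U (\<Gamma> \<mu> x))" if "\<mu> \<in> nonreal" for \<mu>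
    proof -
      interpret R: cunitary "restr H1 (ortho H1 (op_range T1 \<mu>))" "restr H2 (ortho H2 (op_range T2 \<mu>))" U
        by (rule ortho_range_unitary)
      have U: "invertible_op (restr H1 (ortho H1 (op_range T1 \<mu>))) (restr H2 (ortho H2 (op_range T2 \<mu>))) U"
        unfolding invertible_op_def using R.U_bounded cunitary.U_bounded[OF R.cunitary_Ui] R.Ui_U R.U_Ui by blast
      show ?thesis
        using model that by (intro invertible_op_compose[OF K R.H1.inner R.H2.inner _ U]) (simp add: is_model_def)
    qed
    show "invertible_op K K (model_kernel K H2 (\<lambda>\<mu> x. U (\<Gamma> \<mu> x)) \<mu> z)"
      if h: "0 < Im \<mu> \<and> 0 < Im z \<or> Im \<mu> < 0 \<and> Im z < 0" for \<mu> z
    proof (rule invertible_op_cong[OF K])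
      show "invertible_op K K (model_kernel K H1 \<Gamma> \<mu> z)" using model h unfolding is_model_def by blast
      have "z \<in> nonreal" "\<mu> \<in> nonreal" using h by (auto simp: nonreal_def)
      then show "model_kernel K H1 \<Gamma> \<mu> z x = model_kernel K H2 (\<lambda>\<mu> x. U (\<Gamma> \<mu> x)) \<mu> z x" if "x \<in> car K" for x
        using that by (simp add: model_kernel_def adj_def cong: conj_cong ball_cong)
    qed
    show "closed_span H2 (\<Union>\<mu>\<in>nonreal. (\<lambda>x. U (\<Gamma> \<mu> x)) ` car K) = car H2"
    proof -
      have "(\<Union>\<mu>\<in>nonreal. (\<lambda>x. U (\<Gamma> \<mu> x)) ` car K) = U ` (\<Union>\<mu>\<in>nonreal. \<Gamma> \<mu> ` car K)" by auto
      moreover have "(\<Union>\<mu>\<in>nonreal. \<Gamma> \<mu> ` car K) \<subseteq> car H1" by auto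
      moreover have "closed_span H1 (\<Union>\<mu>\<in>nonreal. \<Gamma> \<mu> ` car K) = car H1"
        using model by (simp add: is_model_def)
      ultimately show ?thesis by (simp add: closed_span_U U_image)
    qed
  qed
qed

end

section \<open>Invertibility and limits in operator norm\<close>

lemma invertible_op_scale:
  assumes "inner_space K" "inner_space H" "invertible_op K H A" "a \<noteq> 0"
  shows "invertible_op K H (\<lambda>x. a *\<^sub>C A x)"
proof -
  interpret K: cinner K by unfold_locales fact
  interpret H: cinner H by unfold_locales fact
  note A = invertible_op_inv[OF assms(3)]
  show ?thesis
    unfolding invertible_op_def
  proof (intro conjI exI[of _ "\<lambda>y. op_inv K A (inverse a *\<^sub>C y)"] ballI)
    show "bounded_op K H (\<lambda>x. a *\<^sub>C A x)" by (rule bounded_op_scale[OF assms(2) A(1)])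
    show "bounded_op H K (\<lambda>y. op_inv K A (inverse a *\<^sub>C y))"
      by (rule bounded_op_compose[OF assms(2,2) bounded_op_scale[OF assms(2) bounded_op_id]
            bounded_op_op_inv[OF assms(2,3)]])
  qed (use assms(4) A in \<open>auto simp: scaleC_scaleC scaleC_one\<close>)
qed

text \<open>The inverse of the adjoint is the adjoint of the inverse.\<close>

lemma invertible_op_adjoint:
  assumes "inner_space K" "hilbert_space H" "adjoint_ops K H A A'" "invertible_op K H A"
  shows "invertible_op H K A'"
proof -
  interpret K: cinner K by unfold_locales fact
  interpret H: chilbert H by unfold_locales fact
  note A = adjoint_opsD[OF assms(3)] and I = invertible_op_inv[OF assms(4)]
  define B where "B = op_inv K A"
  have B: "adjoint_ops H K B (adj H K B)"
    unfolding B_def by (rule adjoint_ops_adj[OF assms(2,1) bounded_op_op_inv[OF H.inner assms(4)]])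
  note B' = adjoint_opsD[OF B]
  have "A' (adj H K B x) = x" if x: "x \<in> car K" for x
  proof (rule K.eq_by_ip)
    fix v assume v: "v \<in> car K"
    have "ip K v (A' (adj H K B x)) = ip H (A v) (adj H K B x)" using A(5)[OF v] B'(4)[OF x] by simp
    also have "\<dots> = ip K (B (A v)) x" using B'(5)[OF A(3)[OF v] x] by simp
    finally show "ip K v (A' (adj H K B x)) = ip K v x" using I v by (simp add: B_def)
  qed (use x A B' in auto)
  moreover have "adj H K B (A' y) = y" if y: "y \<in> car H" for y
  proof (rule H.eq_by_ip)
    fix v assume v: "v \<in> car H"
    have "ip H v (adj H K B (A' y)) = ip K (B v) (A' y)" using B'(5)[OF v A(4)[OF y]] by simp
    also have "\<dots> = ip H (A (B v)) y" using A(5)[OF B'(3)[OF v] y] by simp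
    finally show "ip H v (adj H K B (A' y)) = ip H v y" using I v by (simp add: B_def)
  qed (use y A B' in auto)
  ultimately show ?thesis unfolding invertible_op_def using A(2) B'(2) by blast
qed

lemma adj_cong:
  assumes "\<And>x. x \<in> car K \<Longrightarrow> A x = B x"
  shows "adj K H A y = adj K H B y"
  unfolding adj_def using assms by (simp cong: ball_cong)

text \<open>
  If \<open>\<parallel>P\<^sup>* x\<parallel>\<^sup>2 - \<parallel>Q\<^sup>* x\<parallel>\<^sup>2\<close> is bounded below and \<open>P\<^sup>*\<close> is invertible, then \<open>P\<^sup>*\<close> strictly dominates \<open>Q\<^sup>*\<close>, which
  makes \<open>(P + a Q) P\<^sup>*\<close> coercive.
\<close>

lemma (in chilbert) invertible_op_dominated_plus:
  assumes P: "adjoint_ops H H P P'" and Q: "adjoint_ops H H Q Q'" and inv: "invertible_op H H P'"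
    and c: "c > 0" and le: "\<And>x. x \<in> car H \<Longrightarrow> c * (hnorm H x)\<^sup>2 \<le> (hnorm H (P' x))\<^sup>2 - (hnorm H (Q' x))\<^sup>2"
    and a: "cmod a = 1"
  shows "invertible_op H H (\<lambda>x. P x + a *\<^sub>C Q x)"
proof -
  let ?E = "\<lambda>x. P x + a *\<^sub>C Q x"
  have E: "bounded_op H H ?E"
    using bounded_op_plus[OF inner adjoint_opsD(1)[OF P] bounded_op_scale[OF inner adjoint_opsD(1)[OF Q]]] .
  have EP: "bounded_op H H (\<lambda>x. ?E (P' x))"
    using bounded_op_compose[OF inner inner adjoint_opsD(2)[OF P] E] .
  have "c / 2 * (hnorm H x)\<^sup>2 \<le> cmod (ip H (?E (P' x)) x)" if x: "x \<in> car H" for x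
  proof -
    note c' [simp] = adjoint_opsD(3,4)[OF P] adjoint_opsD(3,4)[OF Q]
    define p q where "p = hnorm H (P' x)" and "q = hnorm H (Q' x)"
    have pq: "0 \<le> p" "0 \<le> q" using x by (simp_all add: p_def q_def)
    have le': "c * (hnorm H x)\<^sup>2 \<le> p\<^sup>2 - q\<^sup>2" using le[OF x] by (simp add: p_def q_def)
    have "0 \<le> c * (hnorm H x)\<^sup>2" using c by simp
    then have "q\<^sup>2 \<le> p\<^sup>2" using le' by linarith
    then have qp: "q \<le> p" using pq by (simp add: power2_le_iff_abs_le)
    \<comment> \<open>With \<open>P'\<close> composed on the right the form has the leading term
      \<open>p^2\<close>, and the cross term is at most \<open>p q\<close>. Since
      \<open>(p - q)^2\<close> is nonnegative, \<open>p^2 - p q\<close> is at least half of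
      \<open>p^2 - q^2\<close>, which is where \<open>c / 2\<close> comes from.\<close>
    have "ip H (?E (P' x)) x = of_real (p\<^sup>2) + a * ip H (P' x) (Q' x)"
      using x adjoint_opsD(5)[OF P, of "P' x" x] adjoint_opsD(5)[OF Q, of "P' x" x] ip_self[of "P' x"]
      by (simp add: p_def)
    moreover have "cmod (a * ip H (P' x) (Q' x)) \<le> p * q"
      using cauchy_schwarz[of "P' x" "Q' x"] x a by (simp add: norm_mult p_def q_def)
    ultimately have "p\<^sup>2 - p * q \<le> cmod (ip H (?E (P' x)) x)"
      using norm_triangle_ineq2[of "of_real (p\<^sup>2)" "- (a * ip H (P' x) (Q' x))"] by (simp add: norm_power)
    moreover have "(p\<^sup>2 - q\<^sup>2) / 2 \<le> p\<^sup>2 - p * q"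
      using zero_le_power2[of "p - q", unfolded power2_diff] by argo
    ultimately show ?thesis using le' by simp
  qed
  then have B: "invertible_op H H (\<lambda>x. ?E (P' x))"
    using lax_milgram[OF EP, of "c / 2"] c by simp
  show ?thesis
    by (rule invertible_op_cong[OF inner invertible_op_compose[OF inner inner inner
          invertible_op_op_inv[OF inner inner inv] B]]) (simp add: invertible_op_inv[OF inv])
qed


text \<open>Convergence in operator norm, written with explicit bounds because operators are plain
  functions whose values count on the carrier only.\<close>

definition op_lim ::
    "'a::complex_vector hspace \<Rightarrow> 'b::complex_vector hspace \<Rightarrow> ('c \<Rightarrow> 'a \<Rightarrow> 'b) \<Rightarrow> ('a \<Rightarrow> 'b) \<Rightarrow> 'c filter \<Rightarrow> bool"
  where
  "op_lim K H A L F \<longleftrightarrow> (\<forall>e>0. \<forall>\<^sub>F w in F. \<forall>x\<in>car K. hnorm H (A w x - L x) \<le> e * hnorm K x)"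

lemma op_limD: "op_lim K H A L F \<Longrightarrow> e > 0 \<Longrightarrow> \<forall>\<^sub>F w in F. \<forall>x\<in>car K. hnorm H (A w x - L x) \<le> e * hnorm K x"
  by (simp add: op_lim_def)

lemma op_lim_tendsto:
  assumes "inner_space K" "inner_space H" "op_lim K H A L F" "x \<in> car K" "L x \<in> car H"
    "\<forall>\<^sub>F w in F. A w x \<in> car H"
  shows "((\<lambda>w. hnorm H (A w x - L x)) \<longlongrightarrow> 0) F"
proof -
  interpret K: cinner K by unfold_locales fact
  interpret H: cinner H by unfold_locales fact
  show ?thesis
  proof (rule tendstoI)
    fix e :: real assume e: "e > 0"
    define d where "d = e / (hnorm K x + 1)"
    have d: "d > 0" "d * hnorm K x < e"
      using e K.hnorm_nonneg[OF assms(4)] by (auto simp: d_def field_simps)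
    show "\<forall>\<^sub>F w in F. dist (hnorm H (A w x - L x)) 0 < e"
      using op_limD[OF assms(3) d(1)] assms(6)
    proof eventually_elim
      case (elim w)
      then have "hnorm H (A w x - L x) < e" using assms(4) d(2) by force
      then show ?case using elim assms(5) by simp
    qed
  qed
qed

text \<open>An operator and its adjoint have the same norm; the estimate is obtained by pairing
  \<open>v = A' w y - L' y\<close> with itself.\<close>

lemma op_lim_adjoint:
  assumes "inner_space K" "inner_space H" "op_lim K H A L F" "\<forall>\<^sub>F w in F. adjoint_ops K H (A w) (A' w)"
    "adjoint_ops K H L L'"
  shows "op_lim H K A' L' F"
  unfolding op_lim_def
proof (intro allI impI)
  interpret K: cinner K by unfold_locales fact
  interpret H: cinner H by unfold_locales fact
  note L = adjoint_opsD[OF assms(5)]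
  fix e :: real assume e: "e > 0"
  show "\<forall>\<^sub>F w in F. \<forall>y\<in>car H. hnorm K (A' w y - L' y) \<le> e * hnorm H y"
    using op_limD[OF assms(3) e] assms(4)
  proof eventually_elim
    case (elim w)
    note A = adjoint_opsD[OF elim(2)]
    show ?case
    proof
      fix y assume y: "y \<in> car H"
      define v where "v = A' w y - L' y"
      have v: "v \<in> car K" using A L y by (simp add: v_def)
      have "(hnorm K v)\<^sup>2 = Re (ip K v v)" using v by (simp add: K.Re_ip_self)
      also have "ip K v v = ip K v (A' w y) - ip K v (L' y)"
        using v A L y K.ip_diff_right[of "A' w y" "L' y" v] by (simp add: v_def[symmetric])
      also have "\<dots> = ip H (A w v - L v) y" using v A L y by simp
      also have "Re \<dots> \<le> hnorm H (A w v - L v) * hnorm H y"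
        using H.cauchy_schwarz[of "A w v - L v" y] complex_Re_le_cmod[of "ip H (A w v - L v) y"] v A L y by simp
      also have "\<dots> \<le> (e * hnorm K v) * hnorm H y" using elim(1) v y by (intro mult_right_mono) auto
      finally have "hnorm K v * hnorm K v \<le> hnorm K v * (e * hnorm H y)"
        by (simp add: power2_eq_square mult_ac)
      moreover have "hnorm K v = 0 \<or> hnorm K v > 0" using K.hnorm_nonneg[OF v] by linarith
      ultimately show "hnorm K (A' w y - L' y) \<le> e * hnorm H y"
        using e H.hnorm_nonneg[OF y] by (auto simp: v_def[symmetric])
    qed
  qed
qed

lemma op_lim_compose:
  assumes "inner_space K" "inner_space H" "op_lim K H A L F" "bounded_op M K B" "inner_space M"
  shows "op_lim M H (\<lambda>w x. A w (B x)) (\<lambda>x. L (B x)) F"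
  unfolding op_lim_def
proof (intro allI impI)
  obtain C where C: "C > 0" "\<And>x. x \<in> car M \<Longrightarrow> hnorm K (B x) \<le> C * hnorm M x"
    using bounded_op_bound[OF assms(5,4)] by blast
  fix e :: real assume e: "e > 0"
  then have "e / C > 0" using C by simp
  from op_limD[OF assms(3) this]
  show "\<forall>\<^sub>F w in F. \<forall>x\<in>car M. hnorm H (A w (B x) - L (B x)) \<le> e * hnorm M x"
  proof eventually_elim
    case (elim w)
    show ?case
    proof
      fix x assume x: "x \<in> car M"
      have "hnorm H (A w (B x) - L (B x)) \<le> e / C * hnorm K (B x)"
        using elim bounded_op_car[OF assms(4) x] by blast
      also have "\<dots> \<le> e / C * (C * hnorm M x)" using C(2)[OF x] C(1) e by (intro mult_left_mono) auto
      finally show "hnorm H (A w (B x) - L (B x)) \<le> e * hnorm M x" using C(1) by simp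
    qed
  qed
qed

lemma op_lim_plus:
  assumes "inner_space H" "op_lim K H A L F" "op_lim K H B M F"
    and c: "\<And>x. x \<in> car K \<Longrightarrow> L x \<in> car H" "\<And>x. x \<in> car K \<Longrightarrow> M x \<in> car H"
    "\<forall>\<^sub>F w in F. \<forall>x\<in>car K. A w x \<in> car H" "\<forall>\<^sub>F w in F. \<forall>x\<in>car K. B w x \<in> car H"
  shows "op_lim K H (\<lambda>w x. A w x + B w x) (\<lambda>x. L x + M x) F"
  unfolding op_lim_def
proof (intro allI impI)
  interpret H: cinner H by unfold_locales fact
  fix e :: real assume e: "e > 0"
  then have e2: "e / 2 > 0" by simp
  from op_limD[OF assms(2) e2] op_limD[OF assms(3) e2] c(3,4)
  show "\<forall>\<^sub>F w in F. \<forall>x\<in>car K. hnorm H (A w x + B w x - (L x + M x)) \<le> e * hnorm K x"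
  proof eventually_elim
    case (elim w)
    show ?case
    proof
      fix x assume x: "x \<in> car K"
      have eq: "A w x + B w x - (L x + M x) = (A w x - L x) + (B w x - M x)" by simp
      have "hnorm H (A w x + B w x - (L x + M x)) \<le> hnorm H (A w x - L x) + hnorm H (B w x - M x)"
        unfolding eq using elim x c(1,2) by (intro H.hnorm_triangle) auto
      also have "\<dots> \<le> e / 2 * hnorm K x + e / 2 * hnorm K x" using elim x by (intro add_mono) auto
      finally show "hnorm H (A w x + B w x - (L x + M x)) \<le> e * hnorm K x" by simp
    qed
  qed
qed

lemma op_lim_scale:
  assumes "inner_space K" "inner_space H" "op_lim K H A L F" "bounded_op K H L" "(a \<longlongrightarrow> b) F"
    and c: "\<forall>\<^sub>F w in F. \<forall>x\<in>car K. A w x \<in> car H"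
  shows "op_lim K H (\<lambda>w x. a w *\<^sub>C A w x) (\<lambda>x. b *\<^sub>C L x) F"
  unfolding op_lim_def
proof (intro allI impI)
  interpret K: cinner K by unfold_locales fact
  interpret H: cinner H by unfold_locales fact
  note Lc = bounded_op_car[OF assms(4)]
  obtain C where C: "C > 0" "\<And>x. x \<in> car K \<Longrightarrow> hnorm H (L x) \<le> C * hnorm K x"
    using bounded_op_bound[OF assms(1,4)] by blast
  fix e :: real assume e: "e > 0"
  define m where "m = cmod b + 1"
  have nb: "0 < m" by (simp add: m_def add_nonneg_pos)
  define d where "d = e / (2 * m)"
  have d: "d > 0" "m * d = e / 2" using e nb by (auto simp: d_def)
  have "\<forall>\<^sub>F w in F. dist (a w) b < min 1 (e / (2 * C))" using assms(5) C(1) e by (intro tendstoD) auto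
  with op_limD[OF assms(3) d(1)] c
  show "\<forall>\<^sub>F w in F. \<forall>x\<in>car K. hnorm H (a w *\<^sub>C A w x - b *\<^sub>C L x) \<le> e * hnorm K x"
  proof eventually_elim
    case (elim w)
    have ab: "cmod (a w - b) \<le> e / (2 * C)" "cmod (a w) \<le> m"
      using elim(3) norm_triangle_ineq2[of "a w" b] by (auto simp: dist_norm m_def)
    show ?case
    proof
      fix x assume x: "x \<in> car K"
      have "a w *\<^sub>C A w x - b *\<^sub>C L x = a w *\<^sub>C (A w x - L x) + (a w - b) *\<^sub>C L x"
        by (simp add: complex_vector.scale_right_diff_distrib complex_vector.scale_left_diff_distrib)
      then have "hnorm H (a w *\<^sub>C A w x - b *\<^sub>C L x)
          \<le> cmod (a w) * hnorm H (A w x - L x) + cmod (a w - b) * hnorm H (L x)"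
        using H.hnorm_triangle[of "a w *\<^sub>C (A w x - L x)" "(a w - b) *\<^sub>C L x"] elim(2) x Lc by simp
      also have "\<dots> \<le> m * (d * hnorm K x) + e / (2 * C) * (C * hnorm K x)"
        using ab elim x C e nb Lc by (intro add_mono mult_mono) auto
      also have "\<dots> = e * hnorm K x" using C(1) by (simp add: mult.assoc[symmetric] d(2))
      finally show "hnorm H (a w *\<^sub>C A w x - b *\<^sub>C L x) \<le> e * hnorm K x" .
    qed
  qed
qed

text \<open>\<open>E0\<close> is bounded below by some \<open>c\<close>. Once \<open>E w\<close> is
  within \<open>c / 2\<close> of \<open>E0\<close> it is bounded below by \<open>c / 2\<close>,
  uniformly in \<open>w\<close>. Applying \<open>E w\<close> to the error of the solution leaves
  \<open>(y w - y0) - (E w u - E0 u)\<close>, which tends to 0.\<close>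

lemma op_lim_inverse_tendsto:
  assumes "inner_space K" "inner_space H" "op_lim K H E E0 F" "invertible_op K H E0"
    and E: "\<forall>\<^sub>F w in F. invertible_op K H (E w)"
    and y: "\<forall>\<^sub>F w in F. y w \<in> car H" "y0 \<in> car H" "((\<lambda>w. hnorm H (y w - y0)) \<longlongrightarrow> 0) F"
  shows "((\<lambda>w. hnorm K (op_inv K (E w) (y w) - op_inv K E0 y0)) \<longlongrightarrow> 0) F"
proof -
  interpret K: cinner K by unfold_locales fact
  interpret H: cinner H by unfold_locales fact
  note I0 = invertible_op_inv[OF assms(4)]
  define u where "u = op_inv K E0 y0"
  have u: "u \<in> car K" "E0 u = y0" using I0 y(2) by (auto simp: u_def)
  obtain c where c: "c > 0" "\<And>x. x \<in> car K \<Longrightarrow> c * hnorm K x \<le> hnorm H (E0 x)"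
    using invertible_op_lower_bound[OF assms(2,4)] by blast
  have Eu: "\<forall>\<^sub>F w in F. E w u \<in> car H" using E by eventually_elim (simp add: invertible_op_inv u)
  have "((\<lambda>w. hnorm H (E w u - E0 u)) \<longlongrightarrow> 0) F"
    by (rule op_lim_tendsto[OF assms(1-3) u(1) _ Eu]) (simp add: u y)
  then have "((\<lambda>w. 2 / c * (hnorm H (y w - y0) + hnorm H (E w u - E0 u))) \<longlongrightarrow> 2 / c * (0 + 0)) F"
    by (intro tendsto_intros y(3))
  then have lim: "((\<lambda>w. 2 / c * (hnorm H (y w - y0) + hnorm H (E w u - E0 u))) \<longlongrightarrow> 0) F" by simp
  have c2: "c / 2 > 0" using c by simp
  have "\<forall>\<^sub>F w in F. norm (hnorm K (op_inv K (E w) (y w) - u)) \<le> 2 / c * (hnorm H (y w - y0) + hnorm H (E w u - E0 u))"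
    using op_limD[OF assms(3) c2] E y(1)
  proof eventually_elim
    case (elim w)
    note I = invertible_op_inv[OF elim(2)]
    define x where "x = op_inv K (E w) (y w) - u"
    have x: "x \<in> car K" using I elim(3) u by (simp add: x_def)
    have Ex: "E w x = (y w - y0) - (E w u - E0 u)"
      using bounded_op_diff[OF assms(1) I(1), of "op_inv K (E w) (y w)" u] I elim(3) u by (simp add: x_def)
    have "c * hnorm K x \<le> hnorm H (E0 x)" by (rule c(2)[OF x])
    also have "hnorm H (E0 x) \<le> hnorm H (E w x) + hnorm H (E w x - E0 x)"
      using H.hnorm_triangle_diff[of "E w x" "E w x - E0 x"] x I I0 by simp
    also have "hnorm H (E w x - E0 x) \<le> c / 2 * hnorm K x" using elim(1) x by blast
    finally have "c / 2 * hnorm K x \<le> hnorm H (E w x)" by simp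
    also have "\<dots> \<le> hnorm H (y w - y0) + hnorm H (E w u - E0 u)"
      unfolding Ex using elim(3) y(2) I I0 u by (intro H.hnorm_triangle_diff) auto
    finally have "hnorm K x \<le> 2 / c * (hnorm H (y w - y0) + hnorm H (E w u - E0 u))"
      using c(1) by (simp add: field_simps)
    then show ?case using x by (simp add: x_def[symmetric])
  qed
  then show ?thesis unfolding u_def[symmetric] using lim by (rule Lim_null_comparison)
qed

section \<open>Models of symmetric operators\<close>

locale closed_symmetric = H: chilbert H for H :: "'h::complex_vector hspace" +
  fixes T :: "'h lin_op"
  assumes lin: "linear_operator H T" and closed: "closed_operator H T" and symm: "symmetric_operator H T"
begin

lemma dom_sub: "complex_vector.subspace (opdom T)"
  and T_lin: "linear_on (opdom T) (opapp T)"
  and dom_car: "g \<in> opdom T \<Longrightarrow> g \<in> car H"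
  and app_car: "g \<in> opdom T \<Longrightarrow> opapp T g \<in> car H"
  using lin by (auto simp: linear_operator_def)

lemmas T_car [simp] = dom_car app_car

definition D where "D w g = opapp T g - w *\<^sub>C g"

lemma D_car [simp]: "g \<in> opdom T \<Longrightarrow> D w g \<in> car H"
  by (simp add: D_def)

lemma range_iff: "f \<in> op_range T w \<longleftrightarrow> (\<exists>g\<in>opdom T. f = D w g)"
  by (auto simp: op_range_def D_def)

lemma D_range: "g \<in> opdom T \<Longrightarrow> D w g \<in> op_range T w"
  by (auto simp: range_iff)

lemma D_linear: "linear_on (opdom T) (D w)"
  using linear_on_add[OF T_lin] linear_on_scaleC[OF T_lin]
  by (simp add: linear_on_def D_def complex_vector.scale_right_distrib
      complex_vector.scale_right_diff_distrib mult.commute)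

lemma range_sub: "complex_vector.subspace (op_range T w)"
proof -
  have "op_range T w = D w ` opdom T" by (auto simp: op_range_def D_def)
  then show ?thesis using linear_on_image_subspace[OF D_linear dom_sub] by simp
qed

lemma range_car: "op_range T w \<subseteq> car H"
  by (rule op_range_subset[OF H.inner lin])

lemma ip_app: "g \<in> opdom T \<Longrightarrow> h \<in> opdom T \<Longrightarrow> ip H (opapp T g) h = ip H g (opapp T h)"
  using symm by (simp add: symmetric_operator_def)

text \<open>Symmetry makes \<open>ip H (opapp T g) g\<close> real, so the imaginary part of
  \<open>ip H (D w g) g\<close> is \<open>- Im w\<close> times the squared norm of
  \<open>g\<close>.\<close>

lemma D_lower: "g \<in> opdom T \<Longrightarrow> \<bar>Im w\<bar> * hnorm H g \<le> hnorm H (D w g)"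
proof (cases "g = 0")
  case False
  assume g: "g \<in> opdom T"
  then have pos: "hnorm H g > 0" using False by (simp add: less_le)
  have "ip H (opapp T g) g = cnj (ip H (opapp T g) g)"
    using ip_app[OF g g] H.ip_commute[of "opapp T g" g] g by simp
  from arg_cong[OF this, of Im] have "Im (ip H (opapp T g) g) = 0" by simp
  then have "Im (ip H (D w g) g) = - Im w * (hnorm H g)\<^sup>2"
    using g by (simp add: D_def H.ip_self)
  then have "\<bar>Im w\<bar> * (hnorm H g)\<^sup>2 = \<bar>Im (ip H (D w g) g)\<bar>" by (simp add: abs_mult)
  also have "\<dots> \<le> hnorm H (D w g) * hnorm H g"
    using abs_Im_le_cmod[of "ip H (D w g) g"] H.cauchy_schwarz[of "D w g" g] g by simp
  finally have "(\<bar>Im w\<bar> * hnorm H g) * hnorm H g \<le> hnorm H (D w g) * hnorm H g"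
    by (simp add: power2_eq_square mult_ac)
  then show ?thesis using pos by simp
qed simp

text \<open>By \<open>D_lower\<close> the preimages \<open>t n\<close> of a convergent sequence in
  the range are Cauchy. Then \<open>opapp T (t n) = s n + w *\<^sub>C t n\<close> converges as well,
  and closedness of the graph puts the limit into the domain.\<close>

lemma range_closed:
  assumes w: "w \<in> nonreal"
  shows "closedin (htop H) (op_range T w)"
proof -
  have "y \<in> op_range T w" if "y \<in> htop H closure_of op_range T w" for y
  proof -
    have y: "y \<in> car H" and "\<exists>s. (\<forall>n. s n \<in> op_range T w) \<and> (\<lambda>n. hnorm H (s n - y)) \<longlonglongrightarrow> 0"
      using that H.closure_of_htop[OF range_car, of y w] by simp_all
    then obtain s where s: "\<And>n. s n \<in> op_range T w" "(\<lambda>n. hnorm H (s n - y)) \<longlonglongrightarrow> 0" by auto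
    then obtain t where t: "\<And>n. t n \<in> opdom T" "\<And>n. s n = D w (t n)"
      unfolding range_iff by metis
    have tH: "t n \<in> car H" and sH: "s n \<in> car H" for n using t by auto
    have "H.MCauchy t"
      unfolding H.MCauchy_iff[of t, OF tH]
    proof (intro allI impI)
      fix e :: real assume "e > 0"
      then have "\<bar>Im w\<bar> * e > 0" using w by (simp add: nonreal_def)
      then obtain N where N: "\<And>k n. N \<le> k \<Longrightarrow> N \<le> n \<Longrightarrow> hnorm H (s k - s n) < \<bar>Im w\<bar> * e"
        using H.hnorm_tendsto_Cauchy[of s, OF sH y s(2)] unfolding H.MCauchy_iff[of s, OF sH] by blast
      have "hnorm H (t k - t n) < e" if "N \<le> k" "N \<le> n" for k n
      proof -
        have "s k - s n = D w (t k - t n)"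
          using linear_on_diff[OF D_linear dom_sub t(1) t(1)] by (simp add: t(2))
        then have "\<bar>Im w\<bar> * hnorm H (t k - t n) \<le> hnorm H (s k - s n)"
          using D_lower[OF complex_vector.subspace_diff[OF dom_sub t(1) t(1)], of w] by simp
        also have "\<dots> < \<bar>Im w\<bar> * e" by (rule N[OF that])
        finally show ?thesis using w by (simp add: nonreal_def)
      qed
      then show "\<exists>N. \<forall>m n. N \<le> m \<longrightarrow> N \<le> n \<longrightarrow> hnorm H (t m - t n) < e" by blast
    qed
    then obtain x where x: "x \<in> car H" "(\<lambda>n. hnorm H (t n - x)) \<longlonglongrightarrow> 0"
      using H.complete[of t, OF tH] by blast
    have "(\<lambda>n. hnorm H (s n - y) + cmod w * hnorm H (t n - x)) \<longlonglongrightarrow> 0 + cmod w * 0"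
      by (intro tendsto_intros s(2) x(2))
    then have lim: "(\<lambda>n. hnorm H (s n - y) + cmod w * hnorm H (t n - x)) \<longlonglongrightarrow> 0" by simp
    have "norm (hnorm H (opapp T (t n) - (y + w *\<^sub>C x))) \<le> hnorm H (s n - y) + cmod w * hnorm H (t n - x)" for n
    proof -
      have eq: "opapp T (t n) - (y + w *\<^sub>C x) = (s n - y) + w *\<^sub>C (t n - x)"
        by (simp add: t D_def complex_vector.scale_right_diff_distrib)
      have "hnorm H ((s n - y) + w *\<^sub>C (t n - x)) \<le> hnorm H (s n - y) + hnorm H (w *\<^sub>C (t n - x))"
        using sH tH x y by (intro H.hnorm_triangle) auto
      then show ?thesis unfolding eq using sH tH x y by simp
    qed
    then have "(\<lambda>n. hnorm H (opapp T (t n) - (y + w *\<^sub>C x))) \<longlonglongrightarrow> 0"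
      by (intro Lim_null_comparison[OF _ lim] always_eventually allI)
    then have "limitin (htop H) (\<lambda>n. opapp T (t n)) (y + w *\<^sub>C x) sequentially"
      using t x y by (simp add: H.limitin_htop_seq)
    moreover have "limitin (htop H) t x sequentially" using x tH by (simp add: H.limitin_htop_seq)
    ultimately have "limitin (prod_topology (htop H) (htop H)) (\<lambda>n. (t n, opapp T (t n))) (x, y + w *\<^sub>C x) sequentially"
      by (simp add: limitin_pairwise o_def)
    then have "(x, y + w *\<^sub>C x) \<in> (\<lambda>x. (x, opapp T x)) ` opdom T"
      by (rule limitin_closedin) (use closed t in \<open>auto simp: closed_operator_def\<close>)
    then have "x \<in> opdom T" "y = D w x" by (auto simp: D_def eq_diff_eq)
    then show ?thesis using D_range by blast
  qed
  then show ?thesis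
    using range_car closure_of_subset_eq[of "op_range T w" "htop H"] by auto
qed

end

locale livsic_model = K: chilbert K + closed_symmetric H T
  for K :: "'k::complex_vector hspace" and H :: "'h::complex_vector hspace" and T +
  fixes \<Gamma> :: "complex \<Rightarrow> 'k \<Rightarrow> 'h"
  assumes simple: "simple_operator T" and model: "is_model K H T \<Gamma>"
begin

lemma G_bounded: "z \<in> nonreal \<Longrightarrow> bounded_op K H (\<Gamma> z)"
  using model by (simp add: is_model_def)

lemma G_invertible: "z \<in> nonreal \<Longrightarrow> invertible_op K (restr H (ortho H (op_range T z))) (\<Gamma> z)"
  using model by (simp add: is_model_def)

lemma kernel_invertible:
  "0 < Im \<mu> \<and> 0 < Im z \<or> Im \<mu> < 0 \<and> Im z < 0 \<Longrightarrow> invertible_op K K (model_kernel K H \<Gamma> \<mu> z)"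
  using model unfolding is_model_def by blast

definition Gs where "Gs z = adj K H (\<Gamma> z)"

lemma adjG: "z \<in> nonreal \<Longrightarrow> adjoint_ops K H (\<Gamma> z) (Gs z)"
  unfolding Gs_def by (rule adjoint_ops_adj[OF K.hilbert H.inner G_bounded])

lemma adjGs: "z \<in> nonreal \<Longrightarrow> adjoint_ops H K (Gs z) (\<Gamma> z)"
  by (rule adjoint_ops_sym[OF K.inner H.inner adjG])

lemma model_kernel_eq: "model_kernel K H \<Gamma> \<mu> z = (\<lambda>x. Gs z (\<Gamma> \<mu> x))"
  by (simp add: model_kernel_def Gs_def)

lemma G_car [simp]: "z \<in> nonreal \<Longrightarrow> x \<in> car K \<Longrightarrow> \<Gamma> z x \<in> car H"
  and Gs_car [simp]: "z \<in> nonreal \<Longrightarrow> f \<in> car H \<Longrightarrow> Gs z f \<in> car K"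
  and ip_G: "z \<in> nonreal \<Longrightarrow> x \<in> car K \<Longrightarrow> f \<in> car H \<Longrightarrow> ip H (\<Gamma> z x) f = ip K x (Gs z f)"
  and ip_Gs: "z \<in> nonreal \<Longrightarrow> f \<in> car H \<Longrightarrow> x \<in> car K \<Longrightarrow> ip K (Gs z f) x = ip H f (\<Gamma> z x)"
  using adjoint_opsD[OF adjG] adjoint_opsD[OF adjGs] by auto

lemma Gs_lin:
  assumes "z \<in> nonreal" "f \<in> car H"
  shows "g \<in> car H \<Longrightarrow> Gs z (f + g) = Gs z f + Gs z g" "g \<in> car H \<Longrightarrow> Gs z (f - g) = Gs z f - Gs z g"
    "Gs z (a *\<^sub>C f) = a *\<^sub>C Gs z f"
  using assms(2) bounded_op_add[OF adjoint_opsD(1)[OF adjGs[OF assms(1)]]]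
    bounded_op_diff[OF H.inner adjoint_opsD(1)[OF adjGs[OF assms(1)]]]
    bounded_op_scaleC[OF adjoint_opsD(1)[OF adjGs[OF assms(1)]]] by blast+

lemma adj_kernel: "\<mu> \<in> nonreal \<Longrightarrow> z \<in> nonreal \<Longrightarrow> adjoint_ops K K (\<lambda>x. Gs z (\<Gamma> \<mu> x)) (\<lambda>x. Gs \<mu> (\<Gamma> z x))"
  by (rule adjoint_ops_compose[OF K.inner H.inner K.inner adjG adjGs])

lemma G_lower:
  assumes "z \<in> nonreal"
  obtains c where "c > 0" "\<And>x. x \<in> car K \<Longrightarrow> c * hnorm K x \<le> hnorm H (\<Gamma> z x)"
proof -
  have "inner_space (restr H (ortho H (op_range T z)))"
    by (intro H.inner_restr H.ortho_subspace range_car) (auto simp: ortho_def)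
  from invertible_op_lower_bound[OF this G_invertible[OF assms]] that show thesis by auto
qed

lemma G_image: "z \<in> nonreal \<Longrightarrow> \<Gamma> z ` car K = ortho H (op_range T z)"
proof -
  assume z: "z \<in> nonreal"
  note I = invertible_op_inv[OF G_invertible[OF z], simplified]
  show ?thesis
  proof
    show "\<Gamma> z ` car K \<subseteq> ortho H (op_range T z)" using I(4) by blast
    show "ortho H (op_range T z) \<subseteq> \<Gamma> z ` car K" using I(3,5) by (metis image_eqI subsetI)
  qed
qed

lemma G_ortho: "z \<in> nonreal \<Longrightarrow> x \<in> car K \<Longrightarrow> g \<in> opdom T \<Longrightarrow> ip H (\<Gamma> z x) (D z g) = 0"
  using G_image[of z] D_range[of g z] by (auto simp: ortho_def image_def)

text \<open>The kernel of the adjoint is the orthogonal complement of the image of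
  \<open>\<Gamma> z\<close>, that is, the double complement of the range of \<open>T - z\<close>;
  this is the range itself because it is closed.\<close>

lemma Gs_eq_0_iff: "z \<in> nonreal \<Longrightarrow> f \<in> car H \<Longrightarrow> Gs z f = 0 \<longleftrightarrow> f \<in> op_range T z"
proof
  assume z: "z \<in> nonreal" and f: "f \<in> car H"
  show "f \<in> op_range T z" if "Gs z f = 0"
  proof (rule H.ortho_ortho[OF range_sub range_closed[OF z] f])
    fix y assume "y \<in> ortho H (op_range T z)"
    then obtain x where x: "x \<in> car K" "y = \<Gamma> z x" using G_image[OF z] by blast
    then have "ip H y f = 0" using that ip_G[OF z x(1) f] by simp
    then show "ip H f y = 0" using H.ip_commute[of y f] f x z by simp
  qed
  show "Gs z f = 0" if "f \<in> op_range T z"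
  proof (rule K.eq_by_ip)
    obtain g where g: "g \<in> opdom T" "f = D z g" using \<open>f \<in> op_range T z\<close> range_iff by blast
    show "ip K v (Gs z f) = ip K v 0" if "v \<in> car K" for v
      using G_ortho[OF z that g(1)] ip_G[OF z that f] that g by simp
  qed (use z f in auto)
qed

lemma Gs_app: "z \<in> nonreal \<Longrightarrow> g \<in> opdom T \<Longrightarrow> Gs z (opapp T g) = z *\<^sub>C Gs z g"
proof -
  assume z: "z \<in> nonreal" and g: "g \<in> opdom T"
  have "Gs z (D z g) = 0" using Gs_eq_0_iff[OF z D_car[OF g]] D_range[OF g] by blast
  then show ?thesis using z g by (simp add: D_def Gs_lin)
qed

lemma Gs_D: "z \<in> nonreal \<Longrightarrow> g \<in> opdom T \<Longrightarrow> Gs z (D w g) = (z - w) *\<^sub>C Gs z g"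
  by (simp add: D_def Gs_lin Gs_app complex_vector.scale_left_diff_distrib)

lemma ip_G_D: "z \<in> nonreal \<Longrightarrow> x \<in> car K \<Longrightarrow> g \<in> opdom T \<Longrightarrow>
    ip H (\<Gamma> z x) (D w g) = (cnj z - cnj w) * ip H (\<Gamma> z x) g"
  by (simp add: ip_G Gs_D)

lemma eq_0_if_Gs: "f \<in> car H \<Longrightarrow> (\<And>z. z \<in> nonreal \<Longrightarrow> Gs z f = 0) \<Longrightarrow> f = 0"
  using simple Gs_eq_0_iff unfolding simple_operator_def by blast


section \<open>Square roots of the diagonal kernel, deficiency projections and the Cayley
  transform\<close>

definition S where "S s = op_sqrt K (model_kernel K H \<Gamma> s s)"

text \<open>\<open>R s\<close> is the normalising factor in \<open>\<Phi>\<close> and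
  \<open>\<Psi>\<close>. It makes \<open>\<lambda>x. \<Gamma> s (R s x)\<close> isometric, since
  \<open>R s\<close> composed with the square of \<open>S s\<close> and \<open>R s\<close> is the
  identity.\<close>

definition R where "R s = op_inv K (S s)"

lemma S_props:
  assumes s: "s \<in> nonreal"
  shows "adjoint_ops K K (S s) (S s)" "x \<in> car K \<Longrightarrow> S s (S s x) = Gs s (\<Gamma> s x)" "invertible_op K K (S s)"
proof -
  obtain c where c: "c > 0" "\<And>x. x \<in> car K \<Longrightarrow> c * hnorm K x \<le> hnorm H (\<Gamma> s x)" using G_lower[OF s] by blast
  have c2: "c\<^sup>2 > 0" using c by simp
  have "c\<^sup>2 * (hnorm K x)\<^sup>2 \<le> Re (ip K (Gs s (\<Gamma> s x)) x)" if "x \<in> car K" for x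
    using power_mono[OF c(2)[OF that], of 2] c(1) that s
    by (simp add: ip_Gs H.Re_ip_self power_mult_distrib)
  note * = K.op_sqrt_props[OF adj_kernel[OF s s] c2 this, folded model_kernel_eq, folded S_def]
  show "adjoint_ops K K (S s) (S s)" "x \<in> car K \<Longrightarrow> S s (S s x) = Gs s (\<Gamma> s x)" "invertible_op K K (S s)"
    using * by (simp_all add: model_kernel_eq)
qed

lemma adjR: "s \<in> nonreal \<Longrightarrow> adjoint_ops K K (R s) (R s)"
  unfolding R_def by (rule adjoint_ops_op_inv[OF K.inner K.inner S_props(1,3) S_props(3)])

lemma R_invertible: "s \<in> nonreal \<Longrightarrow> invertible_op K K (R s)"
  unfolding R_def by (rule invertible_op_op_inv[OF K.inner K.inner S_props(3)])

lemma R_car [simp]: "s \<in> nonreal \<Longrightarrow> x \<in> car K \<Longrightarrow> R s x \<in> car K"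
  and S_car [simp]: "s \<in> nonreal \<Longrightarrow> x \<in> car K \<Longrightarrow> S s x \<in> car K"
  and R_S [simp]: "s \<in> nonreal \<Longrightarrow> x \<in> car K \<Longrightarrow> R s (S s x) = x"
  and S_R [simp]: "s \<in> nonreal \<Longrightarrow> x \<in> car K \<Longrightarrow> S s (R s x) = x"
  unfolding R_def using invertible_op_inv[OF S_props(3)] by auto

lemma kernel_R_R: "s \<in> nonreal \<Longrightarrow> x \<in> car K \<Longrightarrow> Gs s (\<Gamma> s (R s (R s x))) = x"
  by (simp flip: S_props(2))

text \<open>The orthogonal projection onto the complement of the range of \<open>T - s\<close>.\<close>

definition P where "P s h = \<Gamma> s (R s (R s (Gs s h)))"

lemma P_car [simp]: "s \<in> nonreal \<Longrightarrow> h \<in> car H \<Longrightarrow> P s h \<in> car H"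
  by (simp add: P_def)

text \<open>By \<open>kernel_R_R\<close>, applying \<open>Gs s\<close> to \<open>P s h\<close> gives
  back \<open>Gs s h\<close>, so the difference lies in the kernel of \<open>Gs s\<close>.\<close>

lemma P_diff_range: "s \<in> nonreal \<Longrightarrow> h \<in> car H \<Longrightarrow> h - P s h \<in> op_range T s"
  by (subst Gs_eq_0_iff[symmetric]) (simp_all add: Gs_lin P_def kernel_R_R)

lemma P_ortho: "s \<in> nonreal \<Longrightarrow> h \<in> car H \<Longrightarrow> P s h \<in> ortho H (op_range T s)"
  unfolding P_def G_image[symmetric] by simp

lemma i_nonreal [simp]: "\<i> \<in> nonreal" "- \<i> \<in> nonreal"
  by (simp_all add: nonreal_def)

text \<open>
  The adjoint of the Cayley transform \<open>(T + \<i>) g \<mapsto> (T - \<i>) g\<close> maps \<open>h - P \<i> h = (T - \<i>) g\<close> to \<open>(T + \<i>) g\<close>;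
  on \<open>h = \<Gamma> \<mu> x\<close> this is a multiple of \<open>h - P (- \<i>) h\<close>.
\<close>

lemma cayley_identity:
  assumes z: "z \<in> nonreal" and \<mu>: "\<mu> \<in> nonreal" and x: "x \<in> car K"
  shows "((z + \<i>) * (cnj \<mu> - \<i>)) *\<^sub>C Gs z (P \<i> (\<Gamma> \<mu> x)) - ((z - \<i>) * (cnj \<mu> + \<i>)) *\<^sub>C Gs z (P (- \<i>) (\<Gamma> \<mu> x))
    = (2 * \<i> * (cnj \<mu> - z)) *\<^sub>C Gs z (\<Gamma> \<mu> x)"
proof -
  define h where "h = \<Gamma> \<mu> x"
  have h [simp]: "h \<in> car H" using \<mu> x by (simp add: h_def)
  obtain g where g: "g \<in> opdom T" "h - P \<i> h = D \<i> g" using P_diff_range[of \<i> h] range_iff by auto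
  \<comment> \<open>\<open>u\<close> will vanish because it lies in the range of
    \<open>T + \<i>\<close> and is orthogonal to that range. This is the claim that the Cayley step
    sends \<open>h - P \<i> h\<close> to a multiple of \<open>h - P (- \<i>) h\<close>.\<close>
  define u where "u = (cnj \<mu> - \<i>) *\<^sub>C D (- \<i>) g - (cnj \<mu> + \<i>) *\<^sub>C (h - P (- \<i>) h)"
  have uc: "u \<in> car H" using g by (simp add: u_def)
  have ur: "u \<in> op_range T (- \<i>)"
    unfolding u_def
    by (rule complex_vector.subspace_diff[OF range_sub
          complex_vector.subspace_scale[OF range_sub D_range[OF g(1)]]
          complex_vector.subspace_scale[OF range_sub P_diff_range[OF i_nonreal(2) h]]])
  have "ip H u (D (- \<i>) k) = 0" if k: "k \<in> opdom T" for k
  proof -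
    \<comment> \<open>The Cayley transform is isometric: by symmetry the mixed terms cancel and both
      sides equal \<open>ip H (opapp T g) (opapp T k) + ip H g k\<close>.\<close>
    have iso: "ip H (D (- \<i>) g) (D (- \<i>) k) = ip H (D \<i> g) (D \<i> k)"
      using g(1) k by (simp add: D_def ip_app algebra_simps)
    have "ip H (D \<i> g) (D \<i> k) = ip H h (D \<i> k) - ip H (P \<i> h) (D \<i> k)"
      using k by (simp flip: g(2))
    also have "ip H (P \<i> h) (D \<i> k) = 0"
      using P_ortho[of \<i> h] D_range[OF k] by (simp add: ortho_def)
    finally have 1: "ip H (D (- \<i>) g) (D (- \<i>) k) = (cnj \<mu> + \<i>) * ip H h k"
      using iso ip_G_D[OF \<mu> x k] by (simp add: h_def)
    have 2: "ip H h (D (- \<i>) k) = (cnj \<mu> - \<i>) * ip H h k" using ip_G_D[OF \<mu> x k] by (simp add: h_def)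
    have 3: "ip H (P (- \<i>) h) (D (- \<i>) k) = 0"
      using P_ortho[of "- \<i>" h] D_range[OF k] by (simp add: ortho_def)
    show ?thesis using g(1) k by (simp add: u_def 1 2 3)
  qed
  then have "ip H u u = 0" using ur range_iff by metis
  then have "u = 0" using H.ip_eq_zero uc by blast
  then have "(cnj \<mu> + \<i>) *\<^sub>C (h - P (- \<i>) h) = (cnj \<mu> - \<i>) *\<^sub>C D (- \<i>) g" by (simp add: u_def)
  then have "Gs z ((cnj \<mu> + \<i>) *\<^sub>C (h - P (- \<i>) h)) = Gs z ((cnj \<mu> - \<i>) *\<^sub>C D (- \<i>) g)" by simp
  then have 4: "(cnj \<mu> + \<i>) *\<^sub>C (Gs z h - Gs z (P (- \<i>) h)) = (cnj \<mu> - \<i>) *\<^sub>C ((z + \<i>) *\<^sub>C Gs z g)"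
    using z g(1) by (simp add: Gs_lin[OF z] Gs_D)
  have 5: "Gs z h - Gs z (P \<i> h) = (z - \<i>) *\<^sub>C Gs z g"
    using Gs_D[OF z g(1), of \<i>] by (simp add: Gs_lin[OF z] flip: g(2))
  show ?thesis
    unfolding h_def[symmetric]
  proof (rule K.eq_by_ip)
    fix v assume v: "v \<in> car K"
    \<comment> \<open>Pairing with \<open>v\<close> makes the identity scalar, so that
      \<open>d\<close>, the only trace of \<open>g\<close>, can be eliminated algebraically.
      Coefficients appear conjugated because the inner product is conjugate linear in its second
      argument.\<close>
    define a b c d where "a = ip K v (Gs z h)" and "b = ip K v (Gs z (P (- \<i>) h))"
      and "c = ip K v (Gs z (P \<i> h))" and "d = ip K v (Gs z g)"
    have "ip K v ((cnj \<mu> + \<i>) *\<^sub>C (Gs z h - Gs z (P (- \<i>) h))) = ip K v ((cnj \<mu> - \<i>) *\<^sub>C ((z + \<i>) *\<^sub>C Gs z g))"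
      using 4 by simp
    then have e1: "(\<mu> - \<i>) * (a - b) = (\<mu> + \<i>) * ((cnj z - \<i>) * d)"
      using v z g(1) by (simp add: a_def b_def d_def)
    have "ip K v (Gs z h - Gs z (P \<i> h)) = ip K v ((z - \<i>) *\<^sub>C Gs z g)" using 5 by simp
    then have e2: "a - c = (cnj z + \<i>) * d" using v z g(1) by (simp add: a_def c_def d_def)
    have "(cnj z - \<i>) * (\<mu> + \<i>) * c - (cnj z + \<i>) * (\<mu> - \<i>) * b = - 2 * \<i> * (\<mu> - cnj z) * a"
      using e1 e2 by algebra
    then show "ip K v (((z + \<i>) * (cnj \<mu> - \<i>)) *\<^sub>C Gs z (P \<i> h) - ((z - \<i>) * (cnj \<mu> + \<i>)) *\<^sub>C Gs z (P (- \<i>) h))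
      = ip K v ((2 * \<i> * (cnj \<mu> - z)) *\<^sub>C Gs z h)"
      using v z by (simp add: a_def b_def c_def)
  qed (use z in auto)
qed

end

section \<open>The Cayley identity in terms of \<open>\<Phi>\<close> and \<open>\<Psi>\<close>, and
  the function \<open>\<Omega>\<close>\<close>

context livsic_model
begin

text \<open>
  \<open>Th s z\<close> is \<open>\<Phi>(z)\<close> for \<open>s = \<i>\<close> and \<open>\<Psi>(z)\<close> for \<open>s = - \<i>\<close>.  From here on a prime marks the adjoint.  Clearing the
  denominator of \<open>b\<close>, as in \<open>Pt z = (z + \<i>) \<Phi>(z)\<close> and \<open>Qt z = (z - \<i>) \<Psi>(z)\<close>, treats the pole of \<open>b\<close> at \<open>- \<i>\<close>
  like any other point of the lower half plane.
\<close>

definition Th where "Th s z x = Gs z (\<Gamma> s (R s x))"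

definition Th' where "Th' s z x = R s (Gs s (\<Gamma> z x))"

lemma adjTh: "s \<in> nonreal \<Longrightarrow> z \<in> nonreal \<Longrightarrow> adjoint_ops K K (Th s z) (Th' s z)"
  unfolding Th_def[abs_def] Th'_def[abs_def]
  by (rule adjoint_ops_compose[OF K.inner K.inner K.inner adjR adj_kernel])

lemma model_Phi_eq: "model_Phi K H \<Gamma> z = Th \<i> z"
  and model_Psi_eq: "model_Psi K H \<Gamma> z = Th (- \<i>) z"
  by (simp_all add: model_Phi_def model_Psi_def Th_def fun_eq_iff model_kernel_eq R_def S_def)

lemma Th_Th': "Th s z (Th' s \<mu> x) = Gs z (P s (\<Gamma> \<mu> x))"
  by (simp add: Th_def Th'_def P_def)

lemma Th_invertible:
  assumes "0 < Im s \<and> 0 < Im z \<or> Im s < 0 \<and> Im z < 0"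
  shows "invertible_op K K (Th s z)" "invertible_op K K (Th' s z)"
proof -
  have s: "s \<in> nonreal" and z: "z \<in> nonreal" using assms by (auto simp: nonreal_def)
  have 1: "invertible_op K K (\<lambda>x. Gs z (\<Gamma> s x))" "invertible_op K K (\<lambda>x. Gs s (\<Gamma> z x))"
    using kernel_invertible[of s z] kernel_invertible[of z s] assms by (auto simp: model_kernel_eq)
  show "invertible_op K K (Th s z)" "invertible_op K K (Th' s z)"
    unfolding Th_def[abs_def] Th'_def[abs_def]
    by (rule invertible_op_compose[OF K.inner K.inner K.inner R_invertible[OF s] 1(1)])
      (rule invertible_op_compose[OF K.inner K.inner K.inner 1(2) R_invertible[OF s]])
qed

definition Pt where "Pt z x = (z + \<i>) *\<^sub>C Th \<i> z x"
definition Pt' where "Pt' z x = cnj (z + \<i>) *\<^sub>C Th' \<i> z x"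
definition Qt where "Qt z x = (z - \<i>) *\<^sub>C Th (- \<i>) z x"
definition Qt' where "Qt' z x = cnj (z - \<i>) *\<^sub>C Th' (- \<i>) z x"

lemma adjPt: "z \<in> nonreal \<Longrightarrow> adjoint_ops K K (Pt z) (Pt' z)"
  and adjQt: "z \<in> nonreal \<Longrightarrow> adjoint_ops K K (Qt z) (Qt' z)"
  unfolding Pt_def[abs_def] Pt'_def[abs_def] Qt_def[abs_def] Qt'_def[abs_def]
  by (rule adjoint_ops_scale[OF K.inner K.inner adjTh]; simp)+

lemma Pt_car [simp]:
  assumes "z \<in> nonreal" "x \<in> car K"
  shows "Pt z x \<in> car K" "Pt' z x \<in> car K" "Qt z x \<in> car K" "Qt' z x \<in> car K"
  by (rule adjoint_opsD(3)[OF adjPt[OF assms(1)] assms(2)] adjoint_opsD(4)[OF adjPt[OF assms(1)] assms(2)]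
      adjoint_opsD(3)[OF adjQt[OF assms(1)] assms(2)] adjoint_opsD(4)[OF adjQt[OF assms(1)] assms(2)])+

lemma Pt_lin:
  assumes "z \<in> nonreal" "x \<in> car K"
  shows "y \<in> car K \<Longrightarrow> Pt z (x + y) = Pt z x + Pt z y" "y \<in> car K \<Longrightarrow> Pt z (x - y) = Pt z x - Pt z y"
    "Pt z (a *\<^sub>C x) = a *\<^sub>C Pt z x"
    "y \<in> car K \<Longrightarrow> Qt z (x + y) = Qt z x + Qt z y" "y \<in> car K \<Longrightarrow> Qt z (x - y) = Qt z x - Qt z y"
    "Qt z (a *\<^sub>C x) = a *\<^sub>C Qt z x"
proof -
  note P = adjoint_opsD(1)[OF adjPt[OF assms(1)]] and Q = adjoint_opsD(1)[OF adjQt[OF assms(1)]]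
  show "y \<in> car K \<Longrightarrow> Pt z (x + y) = Pt z x + Pt z y" by (rule bounded_op_add[OF P assms(2)])
  show "y \<in> car K \<Longrightarrow> Pt z (x - y) = Pt z x - Pt z y" by (rule bounded_op_diff[OF K.inner P assms(2)])
  show "Pt z (a *\<^sub>C x) = a *\<^sub>C Pt z x" by (rule bounded_op_scaleC[OF P assms(2)])
  show "y \<in> car K \<Longrightarrow> Qt z (x + y) = Qt z x + Qt z y" by (rule bounded_op_add[OF Q assms(2)])
  show "y \<in> car K \<Longrightarrow> Qt z (x - y) = Qt z x - Qt z y" by (rule bounded_op_diff[OF K.inner Q assms(2)])
  show "Qt z (a *\<^sub>C x) = a *\<^sub>C Qt z x" by (rule bounded_op_scaleC[OF Q assms(2)])
qed

text \<open>\<open>Th s z\<close> followed after \<open>Th' s \<mu>\<close> is \<open>P s\<close>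
  compressed by \<open>Gs z\<close> and \<open>\<Gamma> \<mu>\<close>, so this is
  \<open>cayley_identity\<close> with its scalar factors distributed over the operators.\<close>

lemma Pt_Qt_identity:
  assumes "z \<in> nonreal" "\<mu> \<in> nonreal" "x \<in> car K"
  shows "Pt z (Pt' \<mu> x) - Qt z (Qt' \<mu> x) = (2 * \<i> * (cnj \<mu> - z)) *\<^sub>C Gs z (\<Gamma> \<mu> x)"
proof -
  have c: "Th' s \<mu> x \<in> car K" if "s \<in> nonreal" for s
    using adjoint_opsD(4)[OF adjTh[OF that assms(2)] assms(3)] .
  have "Pt z (Pt' \<mu> x) = ((z + \<i>) * (cnj \<mu> - \<i>)) *\<^sub>C Gs z (P \<i> (\<Gamma> \<mu> x))"
    unfolding Pt_def Pt'_def using bounded_op_scaleC[OF adjoint_opsD(1)[OF adjTh[OF i_nonreal(1) assms(1)]] c]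
    by (simp add: Th_Th')
  moreover have "Qt z (Qt' \<mu> x) = ((z - \<i>) * (cnj \<mu> + \<i>)) *\<^sub>C Gs z (P (- \<i>) (\<Gamma> \<mu> x))"
    unfolding Qt_def Qt'_def using bounded_op_scaleC[OF adjoint_opsD(1)[OF adjTh[OF i_nonreal(2) assms(1)]] c]
    by (simp add: Th_Th')
  ultimately show ?thesis using cayley_identity[OF assms] by simp
qed

text \<open>The case \<open>\<mu> = z\<close>, where
  \<open>2 * \<i> * (cnj z - z) = 4 * Im z\<close>. The sign of \<open>Im z\<close> decides which of
  \<open>Pt'\<close> and \<open>Qt'\<close> dominates.\<close>

lemma Pt_Qt_norm:
  assumes z: "z \<in> nonreal" and x: "x \<in> car K"
  shows "(hnorm K (Pt' z x))\<^sup>2 - (hnorm K (Qt' z x))\<^sup>2 = 4 * Im z * (hnorm H (\<Gamma> z x))\<^sup>2"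
proof -
  have "of_real ((hnorm K (Pt' z x))\<^sup>2 - (hnorm K (Qt' z x))\<^sup>2)
      = ip K (Pt z (Pt' z x) - Qt z (Qt' z x)) x"
    using z x K.ip_self[of "Pt' z x"] K.ip_self[of "Qt' z x"]
    by (simp add: adjoint_opsD(5)[OF adjPt] adjoint_opsD(5)[OF adjQt])
  also have "\<dots> = of_real (4 * Im z * (hnorm H (\<Gamma> z x))\<^sup>2)"
    unfolding Pt_Qt_identity[OF z z x] using z x
    by (simp add: ip_Gs H.ip_self) (simp add: complex_eq_iff)
  finally show ?thesis using of_real_eq_iff by blast
qed

text \<open>On the upper half plane, multiplying \<open>I - \<i> V\<close> and
  \<open>I + \<i> V\<close> from the left by \<open>Pt z\<close> gives \<open>E z\<close> and
  \<open>F z\<close>. Unlike \<open>V\<close>, these make sense at every nonreal point.\<close>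

definition E where "E z x = Pt z x + (- \<i>) *\<^sub>C Qt z x"
definition E' where "E' z x = Pt' z x + \<i> *\<^sub>C Qt' z x"
definition F where "F z x = Pt z x + \<i> *\<^sub>C Qt z x"
definition F' where "F' z x = Pt' z x + (- \<i>) *\<^sub>C Qt' z x"

lemma adjE: "z \<in> nonreal \<Longrightarrow> adjoint_ops K K (E z) (E' z)"
  and adjF: "z \<in> nonreal \<Longrightarrow> adjoint_ops K K (F z) (F' z)"
  using adjoint_ops_plus[OF K.inner K.inner adjPt adjoint_ops_scale[OF K.inner K.inner adjQt, of z "- \<i>"]]
    adjoint_ops_plus[OF K.inner K.inner adjPt adjoint_ops_scale[OF K.inner K.inner adjQt, of z \<i>]]
  by (simp_all add: E_def[abs_def] E'_def[abs_def] F_def[abs_def] F'_def[abs_def])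

lemma E_car [simp]:
  assumes "z \<in> nonreal" "x \<in> car K"
  shows "E z x \<in> car K" "E' z x \<in> car K" "F z x \<in> car K" "F' z x \<in> car K"
  using assms by (simp_all add: E_def E'_def F_def F'_def)

text \<open>The lower bound for \<open>\<Gamma> z\<close> turns \<open>Pt_Qt_norm\<close> into a
  strict domination: of \<open>Qt'\<close> by \<open>Pt'\<close> for \<open>Im z > 0\<close>, and of
  \<open>Pt'\<close> by \<open>Qt'\<close> for \<open>Im z < 0\<close>. The dominating operator is
  invertible by the third model condition.\<close>

lemma E_invertible: "z \<in> nonreal \<Longrightarrow> invertible_op K K (E z)"
proof -
  assume z: "z \<in> nonreal"
  obtain c where c: "c > 0" "\<And>x. x \<in> car K \<Longrightarrow> c * hnorm K x \<le> hnorm H (\<Gamma> z x)"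
    using G_lower[OF z] by blast
  define d where "d = 4 * \<bar>Im z\<bar> * c\<^sup>2"
  have d: "d > 0" using z c by (simp add: d_def nonreal_def)
  have le: "d * (hnorm K x)\<^sup>2 \<le> \<bar>(hnorm K (Pt' z x))\<^sup>2 - (hnorm K (Qt' z x))\<^sup>2\<bar>" if "x \<in> car K" for x
    using mult_left_mono[OF power_mono[OF c(2)[OF that], of 2], of "4 * \<bar>Im z\<bar>"] c(1) that
    by (simp add: Pt_Qt_norm[OF z that] abs_mult d_def power_mult_distrib mult_ac)
  show ?thesis
  proof (cases "Im z > 0")
    case True
    have ne: "cnj (z + \<i>) \<noteq> 0" using True by (simp add: complex_eq_iff)
    have inv: "invertible_op K K (Pt' z)"
      unfolding Pt'_def[abs_def] using True
      by (intro invertible_op_scale[OF K.inner K.inner _ ne] Th_invertible) simp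
    have "d * (hnorm K x)\<^sup>2 \<le> (hnorm K (Pt' z x))\<^sup>2 - (hnorm K (Qt' z x))\<^sup>2" if "x \<in> car K" for x
      using le[OF that] Pt_Qt_norm[OF z that] True by simp
    then show ?thesis
      unfolding E_def[abs_def]
      using K.invertible_op_dominated_plus[OF adjPt[OF z] adjQt[OF z] inv d, of "- \<i>"] by simp
  next
    case False
    then have neg: "Im z < 0" using z by (simp add: nonreal_def)
    have ne: "cnj (z - \<i>) \<noteq> 0" using neg by (simp add: complex_eq_iff)
    have inv: "invertible_op K K (Qt' z)"
      unfolding Qt'_def[abs_def] using neg
      by (intro invertible_op_scale[OF K.inner K.inner _ ne] Th_invertible) simp
    have "d * (hnorm K x)\<^sup>2 \<le> (hnorm K (Qt' z x))\<^sup>2 - (hnorm K (Pt' z x))\<^sup>2" if "x \<in> car K" for x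
    proof -
      have "4 * Im z * (hnorm H (\<Gamma> z x))\<^sup>2 \<le> 0" using neg by (simp add: mult_nonpos_nonneg)
      then show ?thesis using le[OF that] Pt_Qt_norm[OF z that] by linarith
    qed
    then have "invertible_op K K (\<lambda>x. Qt z x + \<i> *\<^sub>C Pt z x)"
      using K.invertible_op_dominated_plus[OF adjQt[OF z] adjPt[OF z] inv d, of \<i>] by simp
    \<comment> \<open>Domination by \<open>Qt'\<close> concerns \<open>Qt z + \<i> Pt z\<close>,
      which is \<open>\<i>\<close> times \<open>E z\<close>.\<close>
    then have "invertible_op K K (\<lambda>x. (- \<i>) *\<^sub>C (Qt z x + \<i> *\<^sub>C Pt z x))"
      by (rule invertible_op_scale[OF K.inner K.inner]) simp
    then show ?thesis
      by (rule invertible_op_cong[OF K.inner])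
        (simp add: E_def complex_vector.scale_right_distrib)
  qed
qed

lemma E'_invertible: "z \<in> nonreal \<Longrightarrow> invertible_op K K (E' z)"
  by (rule invertible_op_adjoint[OF K.inner K.hilbert adjE E_invertible])

definition Ei where "Ei z = op_inv K (E z)"
definition Ei' where "Ei' z = op_inv K (E' z)"

lemma Ei [simp]:
  assumes "z \<in> nonreal" "x \<in> car K"
  shows "Ei z x \<in> car K" "Ei' z x \<in> car K" "E z (Ei z x) = x" "Ei z (E z x) = x"
    "E' z (Ei' z x) = x" "Ei' z (E' z x) = x"
  using invertible_op_inv[OF E_invertible[OF assms(1)]] invertible_op_inv[OF E'_invertible[OF assms(1)]] assms(2)
  by (auto simp: Ei_def Ei'_def)

lemma E_cancel: "z \<in> nonreal \<Longrightarrow> x \<in> car K \<Longrightarrow> y \<in> car K \<Longrightarrow> E z x = E z y \<longleftrightarrow> x = y"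
  by (metis Ei(4))

lemma adjEi: "z \<in> nonreal \<Longrightarrow> adjoint_ops K K (Ei z) (Ei' z)"
  unfolding Ei_def Ei'_def by (rule adjoint_ops_op_inv[OF K.inner K.inner adjE E_invertible E'_invertible])

lemma E_lin:
  assumes "z \<in> nonreal" "x \<in> car K"
  shows "y \<in> car K \<Longrightarrow> E z (x + y) = E z x + E z y" "y \<in> car K \<Longrightarrow> E z (x - y) = E z x - E z y"
    "E z (a *\<^sub>C x) = a *\<^sub>C E z x" "E z (- x) = - E z x"
proof -
  note b = adjoint_opsD(1)[OF adjE[OF assms(1)]]
  show "y \<in> car K \<Longrightarrow> E z (x + y) = E z x + E z y" by (rule bounded_op_add[OF b assms(2)])
  show "y \<in> car K \<Longrightarrow> E z (x - y) = E z x - E z y" by (rule bounded_op_diff[OF K.inner b assms(2)])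
  show "E z (a *\<^sub>C x) = a *\<^sub>C E z x" by (rule bounded_op_scaleC[OF b assms(2)])
  show "E z (- x) = - E z x"
    using bounded_op_diff[OF K.inner b K.zero_car assms(2)] bounded_op_zero[OF K.inner b] by simp
qed

text \<open>Cross terms cancel: \<open>(P + \<i> Q) (P' + \<i> Q') + (P - \<i> Q) (P' - \<i> Q') = 2
  (P P' - Q Q')\<close>.\<close>

lemma E_F_identity:
  assumes "z \<in> nonreal" "\<mu> \<in> nonreal" "x \<in> car K"
  shows "F z (E' \<mu> x) + E z (F' \<mu> x) = (4 * \<i> * (cnj \<mu> - z)) *\<^sub>C Gs z (\<Gamma> \<mu> x)"
proof (rule K.eq_by_ip)
  fix v assume v: "v \<in> car K"
  have "F z (E' \<mu> x) + E z (F' \<mu> x) = 2 *\<^sub>C (Pt z (Pt' \<mu> x) - Qt z (Qt' \<mu> x))"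
    by (rule K.eq_by_ip) (use assms in \<open>auto simp: E_def F_def E'_def F'_def Pt_lin algebra_simps\<close>)
  then show "ip K v (F z (E' \<mu> x) + E z (F' \<mu> x)) = ip K v ((4 * \<i> * (cnj \<mu> - z)) *\<^sub>C Gs z (\<Gamma> \<mu> x))"
    by (simp add: Pt_Qt_identity[OF assms] mult.assoc)
qed (use assms in auto)

text \<open>On the upper half plane \<open>V(z) = Pt(z)\<^sup>-\<^sup>1 Qt(z)\<close>, so that \<open>\<Omega>(z) = E(z)\<^sup>-\<^sup>1 F(z)\<close>.\<close>

definition Om where "Om z x = Ei z (F z x)"
definition Om' where "Om' z x = F' z (Ei' z x)"

lemma adjOm: "z \<in> nonreal \<Longrightarrow> adjoint_ops K K (Om z) (Om' z)"
  unfolding Om_def[abs_def] Om'_def[abs_def]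
  by (rule adjoint_ops_compose[OF K.inner K.inner K.inner adjF adjEi])

lemma Om_car [simp]: "z \<in> nonreal \<Longrightarrow> x \<in> car K \<Longrightarrow> Om z x \<in> car K" "z \<in> nonreal \<Longrightarrow> x \<in> car K \<Longrightarrow> Om' z x \<in> car K"
  by (simp_all add: Om_def Om'_def)

text \<open>At \<open>\<mu> = cnj z\<close> the right-hand side of \<open>E_F_identity\<close> is 0.
  Thus the inverse of \<open>E z\<close> applied to \<open>F z\<close> obeys the rule by which
  \<open>herglotz_Omega\<close> is defined below the axis.\<close>

lemma Om'_reflect:
  assumes "z \<in> nonreal" "x \<in> car K"
  shows "- Om' (cnj z) x = Om z x"
proof -
  have "F z x + E z (Om' (cnj z) x) = 0"
    using E_F_identity[of z "cnj z" "Ei' (cnj z) x"] assms by (simp add: Om'_def)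
  then have "F z x = - E z (Om' (cnj z) x)" by (simp add: eq_neg_iff_add_eq_0)
  then have "E z (- Om' (cnj z) x) = F z x" using assms by (simp add: E_lin)
  then show ?thesis using Ei(4)[of z "- Om' (cnj z) x"] assms by (simp add: Om_def)
qed

text \<open>The constant is the square root of \<open>4 / pi\<close>, the quotient of the factor
  \<open>4 * \<i>\<close> in \<open>E_F_identity\<close> and the factor \<open>pi * \<i>\<close> in
  the denominator of the Herglotz kernel.\<close>

definition Gm where "Gm z f = (2 / complex_of_real (sqrt pi)) *\<^sub>C Ei z (Gs z f)"
definition Gm' where "Gm' z x = (2 / complex_of_real (sqrt pi)) *\<^sub>C \<Gamma> z (Ei' z x)"

lemma adjGm: "z \<in> nonreal \<Longrightarrow> adjoint_ops H K (Gm z) (Gm' z)"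
  unfolding Gm_def[abs_def] Gm'_def[abs_def]
  using adjoint_ops_scale[OF H.inner K.inner
      adjoint_ops_compose[OF H.inner K.inner K.inner adjGs adjEi], of z z "2 / complex_of_real (sqrt pi)"]
  by simp

lemma Gm_car [simp]: "z \<in> nonreal \<Longrightarrow> f \<in> car H \<Longrightarrow> Gm z f \<in> car K" "z \<in> nonreal \<Longrightarrow> x \<in> car K \<Longrightarrow> Gm' z x \<in> car H"
  by (simp_all add: Gm_def Gm'_def)

lemma sqrt_pi: "(2 / complex_of_real (sqrt pi)) * (2 / complex_of_real (sqrt pi)) = 4 / of_real pi"
  by (simp add: flip: of_real_mult)

text \<open>Put \<open>x = E' \<mu> s\<close> in \<open>E_F_identity\<close> and cancel
  \<open>E z\<close> from the left.\<close>

lemma Om_sum: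
  assumes z: "z \<in> nonreal" and \<mu>: "\<mu> \<in> nonreal" and x: "x \<in> car K" and ne: "z \<noteq> cnj \<mu>"
  shows "inverse (of_real pi * \<i> * (cnj \<mu> - z)) *\<^sub>C (Om z x + Om' \<mu> x) = Gm z (Gm' \<mu> x)"
proof -
  define s where "s = Ei' \<mu> x"
  have s: "s \<in> car K" "E' \<mu> s = x" using \<mu> x by (simp_all add: s_def)
  note bi = adjoint_opsD(1)[OF adjEi[OF z]]
  have "E z (Om z x + Om' \<mu> x) = (4 * \<i> * (cnj \<mu> - z)) *\<^sub>C Gs z (\<Gamma> \<mu> s)"
    using E_F_identity[OF z \<mu> s(1)] z \<mu> x s by (simp add: E_lin Om_def) (simp add: Om'_def s_def)
  then have "Om z x + Om' \<mu> x = Ei z ((4 * \<i> * (cnj \<mu> - z)) *\<^sub>C Gs z (\<Gamma> \<mu> s))"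
    using Ei(4)[OF z, of "Om z x + Om' \<mu> x"] z \<mu> x by simp
  also have "\<dots> = (4 * \<i> * (cnj \<mu> - z)) *\<^sub>C Ei z (Gs z (\<Gamma> \<mu> s))"
    by (rule bounded_op_scaleC[OF bi]) (use z \<mu> s in simp)
  finally have "inverse (of_real pi * \<i> * (cnj \<mu> - z)) *\<^sub>C (Om z x + Om' \<mu> x)
      = (inverse (of_real pi * \<i> * (cnj \<mu> - z)) * (4 * \<i> * (cnj \<mu> - z))) *\<^sub>C Ei z (Gs z (\<Gamma> \<mu> s))"
    by (simp only: scaleC_scaleC)
  also have "inverse (of_real pi * \<i> * (cnj \<mu> - z)) * (4 * \<i> * (cnj \<mu> - z)) = 4 / of_real pi"
    using ne by (simp add: divide_simps)
  finally have 1: "inverse (of_real pi * \<i> * (cnj \<mu> - z)) *\<^sub>C (Om z x + Om' \<mu> x) = (4 / of_real pi) *\<^sub>C Ei z (Gs z (\<Gamma> \<mu> s))" .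
  have "Gm z (Gm' \<mu> x) = (2 / complex_of_real (sqrt pi)) *\<^sub>C (2 / complex_of_real (sqrt pi)) *\<^sub>C Ei z (Gs z (\<Gamma> \<mu> s))"
    using z \<mu> x s by (simp add: Gm_def Gm'_def Gs_lin bounded_op_scaleC[OF bi] flip: s_def)
  then show ?thesis unfolding 1 by (simp only: scaleC_scaleC sqrt_pi)
qed

section \<open>Continuity in the parameter \<open>z\<close>\<close>

lemma G_op_lim:
  assumes z: "z \<in> nonreal"
  shows "op_lim K H (\<lambda>w. \<Gamma> (cnj w)) (\<Gamma> (cnj z)) (at z)"
proof -
  obtain D where D: "bounded_op K H D" and lim: "\<And>e. e > 0 \<Longrightarrow> \<forall>\<^sub>F w in at z. \<forall>x\<in>car K.
       hnorm H (inverse (w - z) *\<^sub>C (\<Gamma> (cnj w) x - \<Gamma> (cnj z) x) - D x) \<le> e * hnorm K x"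
    using model z unfolding is_model_def op_coanalytic_def op_analytic_on_def by blast
  obtain C where C: "C > 0" "\<And>x. x \<in> car K \<Longrightarrow> hnorm H (D x) \<le> C * hnorm K x"
    using bounded_op_bound[OF K.inner D] by blast
  show ?thesis
    unfolding op_lim_def
  proof (intro allI impI)
    fix e :: real assume e: "e > 0"
    \<comment> \<open>Near \<open>z\<close> the difference quotient is within 1 of the derivative
      \<open>D\<close>, so its norm is at most \<open>C + 1\<close>.\<close>
    have "\<forall>\<^sub>F w in at z. dist w z < e / (C + 1)"
      using e C(1) by (intro tendstoD tendsto_ident_at) auto
    moreover have "\<forall>\<^sub>F w in at z. w \<noteq> z" by (simp add: eventually_at_filter)
    moreover note lim[of 1, simplified] eventually_nonreal[OF z]
    ultimately show "\<forall>\<^sub>F w in at z. \<forall>x\<in>car K. hnorm H (\<Gamma> (cnj w) x - \<Gamma> (cnj z) x) \<le> e * hnorm K x"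
    proof eventually_elim
      case (elim w)
      show ?case
      proof
        fix x assume x: "x \<in> car K"
        define y where "y = inverse (w - z) *\<^sub>C (\<Gamma> (cnj w) x - \<Gamma> (cnj z) x)"
        have y: "y \<in> car H" using elim z x by (simp add: y_def)
        have eq: "\<Gamma> (cnj w) x - \<Gamma> (cnj z) x = (w - z) *\<^sub>C y" using elim(2) by (simp add: y_def)
        have Dx: "D x \<in> car H" using bounded_op_car[OF D x] .
        have "hnorm H y \<le> hnorm H (y - D x) + hnorm H (D x)"
          using H.hnorm_triangle[of "y - D x" "D x"] y Dx by simp
        also have "\<dots> \<le> hnorm K x + C * hnorm K x" using elim(3) x C(2)[OF x] by (force simp: y_def)
        finally have "hnorm H y \<le> (C + 1) * hnorm K x" by (simp add: algebra_simps)
        then have "cmod (w - z) * hnorm H y \<le> e / (C + 1) * ((C + 1) * hnorm K x)"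
          using elim(1) y C(1) e by (intro mult_mono) (auto simp: dist_norm)
        then show "hnorm H (\<Gamma> (cnj w) x - \<Gamma> (cnj z) x) \<le> e * hnorm K x"
          unfolding eq using y C(1) by simp
      qed
    qed
  qed
qed

text \<open>Co-analyticity makes \<open>\<Gamma>\<close> continuous along \<open>cnj\<close>;
  substituting \<open>cnj\<close> once more gives continuity at \<open>z\<close>, and passing to
  adjoints preserves it.\<close>

lemma Gs_op_lim:
  assumes z: "z \<in> nonreal"
  shows "op_lim H K Gs (Gs z) (at z)"
proof (rule op_lim_adjoint[OF K.inner H.inner _ _ adjG[OF z]])
  have cnj: "filterlim cnj (at (cnj z)) (at z)"
    by (rule filterlim_atI) (auto intro!: tendsto_intros simp: eventually_at_filter)
  have lim: "op_lim K H (\<lambda>w. \<Gamma> (cnj w)) (\<Gamma> z) (at (cnj z))" using G_op_lim[of "cnj z"] z by simp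
  show "op_lim K H \<Gamma> (\<Gamma> z) (at z)"
    unfolding op_lim_def
    using eventually_compose_filterlim[OF op_limD[OF lim] cnj] by simp
  show "\<forall>\<^sub>F w in at z. adjoint_ops K H (\<Gamma> w) (Gs w)"
    using eventually_nonreal[OF z] by eventually_elim (rule adjG)
qed

lemma Gs_tendsto:
  assumes "z \<in> nonreal" "f \<in> car H"
  shows "((\<lambda>w. hnorm K (Gs w f - Gs z f)) \<longlongrightarrow> 0) (at z)"
proof (rule op_lim_tendsto[OF H.inner K.inner Gs_op_lim[OF assms(1)] assms(2)])
  show "\<forall>\<^sub>F w in at z. Gs w f \<in> car K"
    using eventually_nonreal[OF assms(1)] by eventually_elim (simp add: assms)
qed (simp add: assms)

lemma Th_op_lim:
  assumes s: "s \<in> nonreal" and z: "z \<in> nonreal"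
  shows "op_lim K K (Th s) (Th s z) (at z)"
  unfolding Th_def[abs_def]
  by (rule op_lim_compose[OF H.inner K.inner Gs_op_lim[OF z] _ K.inner])
    (rule bounded_op_compose[OF K.inner K.inner adjoint_opsD(1)[OF adjR[OF s]] G_bounded[OF s]])

lemma E_op_lim:
  assumes z: "z \<in> nonreal"
  shows "op_lim K K E (E z) (at z)"
proof -
  have b: "bounded_op K K (Th s z)" if "s \<in> nonreal" for s
    using adjoint_opsD(1)[OF adjTh[OF that z]] .
  have c: "\<forall>\<^sub>F w in at z. \<forall>x\<in>car K. Th s w x \<in> car K" if "s \<in> nonreal" for s
    using eventually_nonreal[OF z] by eventually_elim (use that in \<open>simp add: Th_def\<close>)
  have 1: "op_lim K K (\<lambda>w x. (w + \<i>) *\<^sub>C Th \<i> w x) (\<lambda>x. (z + \<i>) *\<^sub>C Th \<i> z x) (at z)"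
    by (intro op_lim_scale[OF K.inner K.inner Th_op_lim b _ c] tendsto_intros) (use z in auto)
  have 2: "op_lim K K (\<lambda>w x. (- \<i> * (w - \<i>)) *\<^sub>C Th (- \<i>) w x) (\<lambda>x. (- \<i> * (z - \<i>)) *\<^sub>C Th (- \<i>) z x) (at z)"
    by (intro op_lim_scale[OF K.inner K.inner Th_op_lim b _ c] tendsto_intros) (use z in auto)
  have E: "E = (\<lambda>w x. (w + \<i>) *\<^sub>C Th \<i> w x + (- \<i> * (w - \<i>)) *\<^sub>C Th (- \<i>) w x)"
    by (simp add: E_def[abs_def] Pt_def Qt_def scaleC_scaleC)
  have c': "\<forall>\<^sub>F w in at z. \<forall>x\<in>car K. a w *\<^sub>C Th s w x \<in> car K" if "s \<in> nonreal" for s a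
    using c[OF that] by eventually_elim simp
  show ?thesis unfolding E
    by (rule op_lim_plus[OF K.inner 1 2 _ _ c' c']) (simp_all add: Th_def z)
qed

text \<open>This serves two isolated points: the removable singularity of the kernel at
  \<open>z = cnj \<mu>\<close>, and the point \<open>\<i>\<close> in the determination of the
  domain.\<close>

lemma Gm_tendsto:
  assumes z: "z \<in> nonreal" and f: "f \<in> car H"
  shows "((\<lambda>w. hnorm K (Gm w f - Gm z f)) \<longlongrightarrow> 0) (at z)"
proof -
  have "((\<lambda>w. hnorm K (Ei w (Gs w f) - Ei z (Gs z f))) \<longlongrightarrow> 0) (at z)"
    unfolding Ei_def
  proof (rule op_lim_inverse_tendsto[OF K.inner K.inner E_op_lim[OF z] E_invertible[OF z] _ _ _ Gs_tendsto[OF z f]])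
    show "\<forall>\<^sub>F w in at z. invertible_op K K (E w)"
      using eventually_nonreal[OF z] by eventually_elim (rule E_invertible)
    show "\<forall>\<^sub>F w in at z. Gs w f \<in> car K"
      using eventually_nonreal[OF z] by eventually_elim (simp add: f)
  qed (simp add: z f)
  then have "((\<lambda>w. cmod (2 / complex_of_real (sqrt pi)) * hnorm K (Ei w (Gs w f) - Ei z (Gs z f))) \<longlongrightarrow> 0) (at z)"
    by (rule tendsto_mult_right_zero)
  moreover have "\<forall>\<^sub>F w in at z. cmod (2 / complex_of_real (sqrt pi)) * hnorm K (Ei w (Gs w f) - Ei z (Gs z f))
      = hnorm K (Gm w f - Gm z f)"
    using eventually_nonreal[OF z]
  proof eventually_elim
    case (elim w)
    have "Gm w f - Gm z f = (2 / complex_of_real (sqrt pi)) *\<^sub>C (Ei w (Gs w f) - Ei z (Gs z f))"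
      by (simp add: Gm_def complex_vector.scale_right_diff_distrib)
    then show ?case using elim z f by (simp only: K.hnorm_scaleC K.diff_car Ei Gs_car)
  qed
  ultimately show ?thesis by (rule Lim_transform_eventually)
qed

lemma Gm_eq_0: "z \<in> nonreal \<Longrightarrow> f \<in> car H \<Longrightarrow> Gm z f = 0 \<longleftrightarrow> Gs z f = 0"
proof -
  assume z: "z \<in> nonreal" and f: "f \<in> car H"
  have "Gm z f = 0 \<longleftrightarrow> Ei z (Gs z f) = 0" by (simp add: Gm_def)
  also have "\<dots> \<longleftrightarrow> Gs z f = 0"
  proof
    assume "Ei z (Gs z f) = 0"
    then have "E z (Ei z (Gs z f)) = 0"
      by (simp only: bounded_op_zero[OF K.inner adjoint_opsD(1)[OF adjE[OF z]]])
    then show "Gs z f = 0" using z f by simp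
  qed (simp add: bounded_op_zero[OF K.inner adjoint_opsD(1)[OF adjEi[OF z]]])
  finally show ?thesis .
qed

end

section \<open>Identification of the Herglotz kernel\<close>

locale livsic_function = livsic_model K H T \<Gamma>
  for K :: "'k::complex_vector hspace" and H :: "'h::complex_vector hspace" and T \<Gamma> +
  fixes V :: "complex \<Rightarrow> 'k \<Rightarrow> 'k"
  assumes V: "z \<in> nonreal \<Longrightarrow> x \<in> car K \<Longrightarrow> V z x = livsic K H \<Gamma> z x"
begin

text \<open>For \<open>Im z > 0\<close> the operator \<open>\<Phi>(z)\<close> is invertible and
  \<open>z\<close> differs from \<open>- \<i>\<close>, so the first case of \<open>livsic\<close>
  applies.\<close>

lemma V_upper:
  assumes z: "0 < Im z" and x: "x \<in> car K"
  shows "V z x \<in> car K" "Pt z (V z x) = Qt z x"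
proof -
  have nr: "z \<in> nonreal" using z by (simp add: nonreal_def)
  have inv: "invertible_op K K (Th \<i> z)" using Th_invertible[of \<i> z] z by simp
  note I = invertible_op_inv[OF inv]
  have ne: "z + \<i> \<noteq> 0" "z \<noteq> - \<i>" using z by (auto simp: complex_eq_iff)
  have Psi: "Th (- \<i>) z x \<in> car K" using x nr by (simp add: Th_def)
  have V': "V z x = ((z - \<i>) / (z + \<i>)) *\<^sub>C op_inv K (Th \<i> z) (Th (- \<i>) z x)"
    using V[OF nr x] inv ne by (simp add: livsic_def model_Phi_eq model_Psi_eq)
  show "V z x \<in> car K" using I Psi by (simp add: V')
  show "Pt z (V z x) = Qt z x"
    unfolding V' Pt_def Qt_def using I Psi ne(1)
    by (simp add: bounded_op_scaleC[OF I(1)])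
qed

lemma herglotz_upper_eq:
  assumes z: "0 < Im z" and x: "x \<in> car K"
  shows "herglotz_upper K V z x = Om z x"
proof -
  have nr: "z \<in> nonreal" using z by (simp add: nonreal_def)
  have Pinj: "Pt z u = Pt z v \<longleftrightarrow> u = v" if "u \<in> car K" "v \<in> car K" for u v
  proof -
    have "invertible_op K K (Th \<i> z)" using Th_invertible[of \<i> z] z by simp
    moreover have "z + \<i> \<noteq> 0" using z by (auto simp: complex_eq_iff)
    ultimately have "invertible_op K K (Pt z)"
      unfolding Pt_def[abs_def] by (intro invertible_op_scale[OF K.inner K.inner])
    then show ?thesis using invertible_op_inv(6) that by blast
  qed
  have E: "Pt z (u - \<i> *\<^sub>C V z u) = E z u" if "u \<in> car K" for u
    using that nr V_upper[OF z that] by (simp add: Pt_lin E_def)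
  \<comment> \<open>As \<open>E z\<close> equals \<open>Pt z\<close> applied after
    \<open>I - \<i> V\<close>, this is the solution of
    \<open>y - \<i> *\<^sub>C V z y = x\<close>.\<close>
  define y where "y = Ei z (Pt z x)"
  have y: "y \<in> car K" "E z y = Pt z x" using nr x by (simp_all add: y_def)
  have "op_inv K (\<lambda>u. u - \<i> *\<^sub>C V z u) x = y"
  proof (rule inv_into_f_eq)
    show "inj_on (\<lambda>u. u - \<i> *\<^sub>C V z u) (car K)"
    proof (rule inj_onI)
      fix u v assume uv: "u \<in> car K" "v \<in> car K" "u - \<i> *\<^sub>C V z u = v - \<i> *\<^sub>C V z v"
      then have "E z u = E z v" by (simp flip: E)
      then show "u = v" using E_cancel[OF nr uv(1,2)] by simp
    qed
    have "Pt z (y - \<i> *\<^sub>C V z y) = Pt z x" using E[OF y(1)] y(2) by simp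
    then show "y - \<i> *\<^sub>C V z y = x" using Pinj x y V_upper[OF z y(1)] by simp
  qed (rule y)
  then have h: "herglotz_upper K V z x = y + \<i> *\<^sub>C V z y" by (simp add: herglotz_upper_def)
  have "Pt z (y + \<i> *\<^sub>C V z y) = F z y"
    using y nr V_upper[OF z y(1)] by (simp add: Pt_lin F_def)
  have "y - \<i> *\<^sub>C V z y = x"
    using E[OF y(1)] y x V_upper[OF z y(1)] Pinj by simp
  then have "y + \<i> *\<^sub>C V z y = 2 *\<^sub>C y - x"
    by (metis (no_types, lifting) add_diff_cancel_left' diff_add_eq_diff_diff_swap diff_diff_eq2
        one_add_one scaleC_add_left scaleC_one add.commute)
  \<comment> \<open>Here \<open>E z y = Pt z x\<close>, and \<open>2 Pt - E = F\<close>.\<close>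
  moreover have "E z (2 *\<^sub>C y - x) = F z x"
  proof (rule K.eq_by_ip)
    show "ip K v (E z (2 *\<^sub>C y - x)) = ip K v (F z x)" if "v \<in> car K" for v
      using that nr x y by (simp add: E_lin) (simp add: E_def F_def algebra_simps)
  qed (use nr x y in auto)
  then have "2 *\<^sub>C y - x = Om z x"
    using Ei(4)[OF nr, of "2 *\<^sub>C y - x"] x y by (simp add: Om_def)
  ultimately show ?thesis using h by simp
qed

lemma Omega_eq:
  assumes z: "z \<in> nonreal" and x: "x \<in> car K"
  shows "herglotz_Omega K V z x = Om z x"
proof (cases "0 < Im z")
  case True
  then show ?thesis using herglotz_upper_eq[OF True x] by (simp add: herglotz_Omega_def)
next
  case False
  then have up: "0 < Im (cnj z)" using z by (simp add: nonreal_def)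
  have "adj K K (herglotz_upper K V (cnj z)) x = adj K K (Om (cnj z)) x"
    using herglotz_upper_eq[OF up] by (rule adj_cong)
  also have "\<dots> = Om' (cnj z) x" by (rule adj_eq[OF K.inner adjOm x]) (simp add: z)
  finally show ?thesis using False Om'_reflect[OF z x] by (simp add: herglotz_Omega_def)
qed

lemma quotient_eq:
  assumes z: "z \<in> nonreal" and \<mu>: "\<mu> \<in> nonreal" and x: "x \<in> car K" and ne: "z \<noteq> cnj \<mu>"
  shows "herglotz_quotient K V \<mu> z x = Gm z (Gm' \<mu> x)"
proof -
  have "adj K K (herglotz_Omega K V \<mu>) x = adj K K (Om \<mu>) x"
    using Omega_eq[OF \<mu>] by (rule adj_cong)
  also have "\<dots> = Om' \<mu> x" by (rule adj_eq[OF K.inner adjOm[OF \<mu>] x])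
  finally show ?thesis using Om_sum[OF z \<mu> x ne] Omega_eq[OF z x] by (simp add: herglotz_quotient_def)
qed

lemma kernel_eq:
  assumes z: "z \<in> nonreal" and \<mu>: "\<mu> \<in> nonreal" and x: "x \<in> car K"
  shows "herglotz_kernel K V \<mu> z x = Gm z (Gm' \<mu> x)"
proof (cases "z = cnj \<mu>")
  case True
  \<comment> \<open>Near the removable singularity the quotient coincides with
    \<open>Gm w (Gm' \<mu> x)\<close>, whose continuity supplies the limit.\<close>
  have ev: "\<forall>\<^sub>F w in at z. herglotz_quotient K V \<mu> w x = Gm w (Gm' \<mu> x)"
  proof -
    have "\<forall>\<^sub>F w in at z. w \<noteq> z" by (simp add: eventually_at_filter)
    with eventually_nonreal[OF z] show ?thesis
      by eventually_elim (simp add: quotient_eq \<mu> x True)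
  qed
  have "limitin (htop K) (\<lambda>w. herglotz_quotient K V \<mu> w x) (Gm z (Gm' \<mu> x)) (at z)"
    unfolding K.limitin_htop
  proof (intro conjI)
    show "\<forall>\<^sub>F w in at z. herglotz_quotient K V \<mu> w x \<in> car K"
      using ev eventually_nonreal[OF z] by eventually_elim (simp add: \<mu> x)
    have "\<forall>\<^sub>F w in at z. hnorm K (Gm w (Gm' \<mu> x) - Gm z (Gm' \<mu> x))
        = hnorm K (herglotz_quotient K V \<mu> w x - Gm z (Gm' \<mu> x))"
      using ev by eventually_elim simp
    with Gm_tendsto[OF z Gm_car(2)[OF \<mu> x]]
    show "((\<lambda>w. hnorm K (herglotz_quotient K V \<mu> w x - Gm z (Gm' \<mu> x))) \<longlongrightarrow> 0) (at z)"
      by (rule Lim_transform_eventually)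
  qed (simp add: z \<mu> x)
  then have "(THE l. limitin (htop K) (\<lambda>w. herglotz_quotient K V \<mu> w x) l (at z)) = Gm z (Gm' \<mu> x)"
    by (intro the_equality) (auto intro: K.limitin_htop_unique[OF trivial_limit_at])
  then show ?thesis using True by (simp add: herglotz_kernel_def)
next
  case False
  then show ?thesis using quotient_eq[OF z \<mu> x False] by (simp add: herglotz_kernel_def)
qed

end

section \<open>The Herglotz space\<close>

text \<open>
  Two reproducing kernel spaces with the same kernel contain the span of the kernel functions densely
  and agree on it, so limits in one space converge in the other, pointwise to the same function.
\<close>

lemma rkhs_subset:
  assumes K: "inner_space K" and S1: "is_rkhs X K k S1" and S2: "is_rkhs X K k S2" and f: "f \<in> car S1"
  shows "f \<in> car S2" "g \<in> car S1 \<Longrightarrow> g \<in> car S2 \<Longrightarrow> ip S1 g f = ip S2 g f"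
proof -
  interpret K: cinner K by unfold_locales fact
  interpret S1: chilbert S1 by unfold_locales (use S1 in \<open>simp add: is_rkhs_def\<close>)
  interpret S2: chilbert S2 by unfold_locales (use S2 in \<open>simp add: is_rkhs_def\<close>)
  define kf where "kf \<mu> x = (\<lambda>z. if z \<in> X then k \<mu> z x else 0)" for \<mu> x
  have val1: "f \<mu> \<in> car K" if "f \<in> car S1" "\<mu> \<in> X" for f \<mu> using S1 that by (simp add: is_rkhs_def)
  have val2: "f \<mu> \<in> car K" if "f \<in> car S2" "\<mu> \<in> X" for f \<mu> using S2 that by (simp add: is_rkhs_def)
  have off1: "f \<mu> = 0" if "f \<in> car S1" "\<mu> \<notin> X" for f \<mu> using S1 that by (simp add: is_rkhs_def)
  have off2: "f \<mu> = 0" if "f \<in> car S2" "\<mu> \<notin> X" for f \<mu> using S2 that by (simp add: is_rkhs_def)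
  have kf1: "kf \<mu> x \<in> car S1" and kf2: "kf \<mu> x \<in> car S2" if "\<mu> \<in> X" "x \<in> car K" for \<mu> x
    using S1 S2 that by (simp_all add: is_rkhs_def kf_def)
  have rep1: "ip S1 f (kf \<mu> x) = ip K (f \<mu>) x" if "f \<in> car S1" "\<mu> \<in> X" "x \<in> car K" for f \<mu> x
    using S1 that by (simp add: is_rkhs_def kf_def)
  have rep2: "ip S2 f (kf \<mu> x) = ip K (f \<mu>) x" if "f \<in> car S2" "\<mu> \<in> X" "x \<in> car K" for f \<mu> x
    using S2 that by (simp add: is_rkhs_def kf_def)
  define B where "B = {kf \<mu> x |\<mu> x. \<mu> \<in> X \<and> x \<in> car K}"
  define M where "M = complex_vector.span B"
  have M: "complex_vector.subspace M" by (simp add: M_def complex_vector.subspace_span)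
  have M1: "M \<subseteq> car S1" unfolding M_def
    by (rule complex_vector.span_minimal) (auto simp: B_def kf1 S1.sub)
  have M2: "M \<subseteq> car S2" unfolding M_def
    by (rule complex_vector.span_minimal) (auto simp: B_def kf2 S2.sub)
  \<comment> \<open>On kernel functions both inner products equal \<open>ip K (g \<mu>) x\<close> by
    the reproducing property; the rest is linearity.\<close>
  have agree: "ip S1 g h = ip S2 g h" if g: "g \<in> car S1" "g \<in> car S2" and h: "h \<in> M" for g h
  proof -
    have "h \<in> car S1 \<and> h \<in> car S2 \<and> ip S1 g h = ip S2 g h"
      using h unfolding M_def
    proof (induction rule: complex_vector.span_induct_alt)
      case base
      show ?case
        by (intro conjI S1.zero_car S2.zero_car) (simp only: S1.ip_zero_right[OF g(1)] S2.ip_zero_right[OF g(2)])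
    next
      case (step c x y)
      have "x \<in> car S1" "x \<in> car S2" "ip S1 g x = ip S2 g x"
        using step.hyps(1) g by (auto simp: B_def kf1 kf2 rep1 rep2)
      moreover have "y \<in> car S1" "y \<in> car S2" "ip S1 g y = ip S2 g y" using step.IH by blast+
      ultimately show ?case
        by (simp only: S1.add_car S1.scaleC_car S2.add_car S2.scaleC_car S1.ip_add_right
            S2.ip_add_right S1.ip_scaleC_right S2.ip_scaleC_right g)
    qed
    then show ?thesis by simp
  qed
  \<comment> \<open>A function orthogonal to every kernel function at \<open>\<mu>\<close> has a
    value there that is orthogonal to all of \<open>K\<close>.\<close>
  have triv: "ortho S1 M \<subseteq> {0}"
  proof
    fix u assume "u \<in> ortho S1 M"
    then have u: "u \<in> car S1" "\<And>h. h \<in> M \<Longrightarrow> ip S1 u h = 0" by (auto simp: ortho_def)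
    have "u \<mu> = 0" for \<mu>
    proof (cases "\<mu> \<in> X")
      case True
      have "ip K (u \<mu>) x = 0" if "x \<in> car K" for x
      proof -
        have "kf \<mu> x \<in> M" unfolding M_def B_def using True that by (intro complex_vector.span_base) auto
        then show ?thesis using rep1[OF u(1) True that] u(2) by simp
      qed
      then show ?thesis using val1[OF u(1) True] K.ip_eq_zero by blast
    qed (simp add: off1 u(1))
    then show "u \<in> {0}" by (simp add: fun_eq_iff)
  qed
  have "f \<in> htop S1 closure_of M" using S1.dense_if_ortho_trivial[OF M M1 triv] f by simp
  then have "\<exists>s. (\<forall>n. s n \<in> M) \<and> (\<lambda>n. hnorm S1 (s n - f)) \<longlonglongrightarrow> 0"
    using S1.closure_of_htop[OF M1, of f] by simp
  then obtain s where s: "\<And>n. s n \<in> M" "(\<lambda>n. hnorm S1 (s n - f)) \<longlonglongrightarrow> 0" by auto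
  have s1: "s n \<in> car S1" and s2: "s n \<in> car S2" for n using s M1 M2 by auto
  have norm_eq: "hnorm S1 h = hnorm S2 h" if "h \<in> M" for h
    using agree[OF subsetD[OF M1 that] subsetD[OF M2 that] that] by (simp add: hnorm_def)
  have "S1.MCauchy s" using S1.hnorm_tendsto_Cauchy[of s, OF s1 f s(2)] .
  moreover have "hnorm S1 (s m - s n) = hnorm S2 (s m - s n)" for m n
    using complex_vector.subspace_diff[OF M s(1) s(1)] by (rule norm_eq)
  ultimately have "S2.MCauchy s"
    unfolding S1.MCauchy_iff[of s, OF s1] S2.MCauchy_iff[of s, OF s2] by simp
  then obtain f' where f': "f' \<in> car S2" "(\<lambda>n. hnorm S2 (s n - f')) \<longlonglongrightarrow> 0"
    using S2.complete[of s, OF s2] by blast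
  \<comment> \<open>Evaluation at \<open>\<mu>\<close> is pairing with kernel functions, so the
    limits in the two norms have the same values.\<close>
  have "f \<mu> = f' \<mu>" for \<mu>
  proof (cases "\<mu> \<in> X")
    case True
    have "ip K (f \<mu>) x = ip K (f' \<mu>) x" if x: "x \<in> car K" for x
    proof -
      have "(\<lambda>n. ip S1 (s n) (kf \<mu> x)) \<longlonglongrightarrow> ip S1 f (kf \<mu> x)"
        by (rule S1.ip_tendsto_left) (auto simp: s1 f kf1 True x s)
      moreover have "(\<lambda>n. ip S2 (s n) (kf \<mu> x)) \<longlonglongrightarrow> ip S2 f' (kf \<mu> x)"
        by (rule S2.ip_tendsto_left) (auto simp: s2 f' kf2 True x)
      ultimately show ?thesis
        using LIMSEQ_unique by (auto simp: rep1 rep2 s1 s2 f f' True x)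
    qed
    then have "ip K (f \<mu> - f' \<mu>) (f \<mu> - f' \<mu>) = 0"
      using val1[OF f True] val2[OF f'(1) True] by simp
    then show ?thesis using K.ip_eq_zero[of "f \<mu> - f' \<mu>"] val1[OF f True] val2[OF f'(1) True] by simp
  qed (simp add: off1 off2 f f')
  then have ff': "f = f'" by auto
  then show "f \<in> car S2" using f' by simp
  show "ip S1 g f = ip S2 g f" if g: "g \<in> car S1" "g \<in> car S2"
  proof -
    have "(\<lambda>n. ip S1 g (s n)) \<longlonglongrightarrow> ip S1 g f"
      by (rule S1.ip_tendsto_right) (auto simp: s1 f g s)
    moreover have "(\<lambda>n. ip S2 g (s n)) \<longlonglongrightarrow> ip S2 g f"
      unfolding ff' by (rule S2.ip_tendsto_right) (auto simp: s2 f' g)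
    ultimately show ?thesis using LIMSEQ_unique agree[OF g s(1)] by auto
  qed
qed

lemma rkhs_eqI:
  assumes K: "inner_space K" and S: "is_rkhs X K k S"
    and off: "\<And>f g. f \<notin> car S \<or> g \<notin> car S \<Longrightarrow> ip S f g = 0"
  shows "rkhs X K k = S"
  unfolding rkhs_def
proof (rule the_equality)
  show "is_rkhs X K k S \<and> (\<forall>f g. f \<notin> car S \<or> g \<notin> car S \<longrightarrow> ip S f g = 0)" using S off by blast
  fix S' assume S': "is_rkhs X K k S' \<and> (\<forall>f g. f \<notin> car S' \<or> g \<notin> car S' \<longrightarrow> ip S' f g = 0)"
  then have car: "car S' = car S" using rkhs_subset(1)[OF K] S by blast
  have "ip S' g f = ip S g f" for g f
  proof (cases "g \<in> car S \<and> f \<in> car S")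
    case True
    then show ?thesis using rkhs_subset(2)[OF K _ S, of S' f g] S' car by blast
  next
    case False
    then have "ip S g f = 0" "ip S' g f = 0" using off S' car by blast+
    then show ?thesis by simp
  qed
  then have "ip S' = ip S" by (intro ext)
  then show "S' = S" using car by simp
qed

context livsic_function
begin

definition W where "W f = (\<lambda>z. if z \<in> nonreal then Gm z f else 0)"

text \<open>The inner product is pulled back along \<open>W\<close>, and it is set to 0 off the
  carrier because \<open>rkhs\<close> prescribes this normalisation.\<close>

definition HV :: "(complex \<Rightarrow> 'k) hspace" where
  "HV = \<lparr>car = W ` car H, ip = (\<lambda>a b. if a \<in> W ` car H \<and> b \<in> W ` car H
     then ip H (inv_into (car H) W a) (inv_into (car H) W b) else 0)\<rparr>"

lemma Gm_lin:
  assumes "z \<in> nonreal" "f \<in> car H"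
  shows "g \<in> car H \<Longrightarrow> Gm z (f + g) = Gm z f + Gm z g" "g \<in> car H \<Longrightarrow> Gm z (f - g) = Gm z f - Gm z g"
    "Gm z (a *\<^sub>C f) = a *\<^sub>C Gm z f"
proof -
  note b = adjoint_opsD(1)[OF adjGm[OF assms(1)]]
  show "g \<in> car H \<Longrightarrow> Gm z (f + g) = Gm z f + Gm z g" by (rule bounded_op_add[OF b assms(2)])
  show "g \<in> car H \<Longrightarrow> Gm z (f - g) = Gm z f - Gm z g" by (rule bounded_op_diff[OF H.inner b assms(2)])
  show "Gm z (a *\<^sub>C f) = a *\<^sub>C Gm z f" by (rule bounded_op_scaleC[OF b assms(2)])
qed

lemma W_linear: "linear_on (car H) W"
  by (auto simp: linear_on_def W_def Gm_lin scaleC_fun_def fun_eq_iff)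

lemma W_nonreal [simp]: "z \<in> nonreal \<Longrightarrow> W f z = Gm z f" "z \<notin> nonreal \<Longrightarrow> W f z = 0"
  by (simp_all add: W_def)

lemma inj_W: "inj_on W (car H)"
proof (rule inj_onI)
  fix f g assume fg: "f \<in> car H" "g \<in> car H" "W f = W g"
  have "Gs z (f - g) = 0" if z: "z \<in> nonreal" for z
  proof -
    have "Gm z f = Gm z g" using fun_cong[OF fg(3), of z] z by simp
    then have "Gm z (f - g) = 0" using Gm_lin[OF z] fg by simp
    then show ?thesis using Gm_eq_0[OF z, of "f - g"] fg by simp
  qed
  then show "f = g" using eq_0_if_Gs[of "f - g"] fg by simp
qed

lemma HV_car: "car HV = W ` car H"
  by (simp add: HV_def)

lemma HV_ip: "f \<in> car H \<Longrightarrow> g \<in> car H \<Longrightarrow> ip HV (W f) (W g) = ip H f g"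
  by (simp add: HV_def inj_W)

lemma HV_inner: "inner_space HV"
proof -
  note W_add = linear_on_add[OF W_linear, symmetric] and W_scale = linear_on_scaleC[OF W_linear, symmetric]
  show ?thesis
    unfolding inner_space_def HV_car
  proof (intro conjI allI; (intro ballI; elim imageE; hypsubst)?)
    show "complex_vector.subspace (W ` car H)" by (rule linear_on_image_subspace[OF W_linear H.sub])
    fix f g assume f: "f \<in> car H" and g: "g \<in> car H"
    show "ip HV (W g) (W f) = cnj (ip HV (W f) (W g))"
      unfolding HV_ip[OF f g] HV_ip[OF g f] by (rule H.ip_commute[OF f g])
  next
    fix f assume f: "f \<in> car H"
    show "0 \<le> Re (ip HV (W f) (W f))" using f by (simp add: HV_ip H.ip_ge_zero)
    show "ip HV (W f) (W f) = 0 \<longrightarrow> W f = 0"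
      using H.ip_eq_zero[OF f] linear_on_0[OF W_linear H.sub] f by (auto simp: HV_ip)
  qed (simp_all add: W_add W_scale HV_ip)
qed

lemma W_unitary: "cunitary H HV W"
  by (intro cunitary.intro cunitary_axioms.intro cinner.intro H.inner HV_inner)
    (simp add: unitary_op_def W_linear HV_car HV_ip)

text \<open>By \<open>kernel_eq\<close> the kernel function at \<open>\<mu>\<close> and
  \<open>x\<close> is \<open>W (Gm' \<mu> x)\<close>. The reproducing property then says that
  \<open>Gm \<mu>\<close> and \<open>Gm' \<mu>\<close> are adjoint to each other.\<close>

lemma HV_rkhs: "is_rkhs nonreal K (herglotz_kernel K V) HV"
  unfolding is_rkhs_def
proof (intro conjI ballI allI impI)
  show "hilbert_space HV" by (rule cunitary.hilbert_U[OF W_unitary H.hilbert])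
  show "f z \<in> car K" if "f \<in> car HV" "z \<in> nonreal" for f z using that by (auto simp: HV_car)
  show "f z = 0" if "f \<in> car HV" "z \<notin> nonreal" for f z using that by (auto simp: HV_car)
  fix \<mu> x assume \<mu>: "\<mu> \<in> nonreal" and x: "x \<in> car K"
  have eq: "(\<lambda>z. if z \<in> nonreal then herglotz_kernel K V \<mu> z x else 0) = W (Gm' \<mu> x)"
    by (auto simp: fun_eq_iff W_def kernel_eq \<mu> x)
  show "(\<lambda>z. if z \<in> nonreal then herglotz_kernel K V \<mu> z x else 0) \<in> car HV"
    unfolding eq HV_car using \<mu> x by simp
  show "ip HV f (\<lambda>z. if z \<in> nonreal then herglotz_kernel K V \<mu> z x else 0) = ip K (f \<mu>) x" if "f \<in> car HV" for f
    using that \<mu> x adjoint_opsD(5)[OF adjGm[OF \<mu>]] unfolding eq HV_car by (auto simp: HV_ip)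
qed

lemma herglotz_space_eq: "herglotz_space K V = HV"
  unfolding herglotz_space_def
  by (rule rkhs_eqI[OF K.inner HV_rkhs]) (auto simp: HV_def)

lemma Gm_app: "z \<in> nonreal \<Longrightarrow> g \<in> opdom T \<Longrightarrow> Gm z (opapp T g) = z *\<^sub>C Gm z g"
  using bounded_op_scaleC[OF adjoint_opsD(1)[OF adjEi]]
  by (simp add: Gm_def Gs_app mult.commute)

lemma W_app: "g \<in> opdom T \<Longrightarrow> W (opapp T g) = (\<lambda>z. z *\<^sub>C W g z)"
  by (auto simp: fun_eq_iff W_def Gm_app)

text \<open>At \<open>z = \<i>\<close> the equation puts \<open>g - \<i> *\<^sub>C f\<close> into
  the kernel of \<open>Gs \<i>\<close>, so it equals \<open>D \<i> u\<close> for some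
  \<open>u\<close> in the domain. The remainder \<open>h = f - u\<close> then satisfies
  \<open>z *\<^sub>C Gm z h = \<i> *\<^sub>C Gm z h\<close>, hence is annihilated for all
  \<open>z\<close> other than \<open>\<i>\<close>. Continuity adds the point \<open>\<i>\<close>,
  and simplicity gives \<open>h = 0\<close>.\<close>

lemma mem_dom_if_mult:
  assumes f: "f \<in> car H" and g: "g \<in> car H" and eq: "(\<lambda>z. z *\<^sub>C W f z) = W g"
  shows "f \<in> opdom T"
proof -
  have gz: "Gm z g = z *\<^sub>C Gm z f" if "z \<in> nonreal" for z
    using fun_cong[OF eq, of z] that by simp
  have "Gm \<i> (g - \<i> *\<^sub>C f) = 0" using f g by (simp add: Gm_lin gz)
  then have "g - \<i> *\<^sub>C f \<in> op_range T \<i>" using Gm_eq_0[of \<i> "g - \<i> *\<^sub>C f"] Gs_eq_0_iff[of \<i> "g - \<i> *\<^sub>C f"] f g by simp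
  then obtain u where u: "u \<in> opdom T" "g - \<i> *\<^sub>C f = D \<i> u" using range_iff by blast
  define h where "h = f - u"
  have h: "h \<in> car H" using f u by (simp add: h_def)
  have gh: "g - opapp T u = \<i> *\<^sub>C h"
    using u(2) by (simp add: D_def h_def complex_vector.scale_right_diff_distrib algebra_simps)
  have 1: "Gm z h = 0" if z: "z \<in> nonreal" "z \<noteq> \<i>" for z
  proof -
    have "\<i> *\<^sub>C Gm z h = Gm z (g - opapp T u)" unfolding gh using Gm_lin(3)[OF z(1) h] by simp
    also have "\<dots> = z *\<^sub>C Gm z h"
      using f g u(1) z by (simp add: Gm_lin Gm_app gz h_def complex_vector.scale_right_diff_distrib)
    finally have "(\<i> - z) *\<^sub>C Gm z h = 0" by (simp add: complex_vector.scale_left_diff_distrib)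
    then show ?thesis using z by simp
  qed
  \<comment> \<open>At \<open>\<i>\<close> the factor \<open>\<i> - z\<close> gives no information,
    so the value is obtained as a limit.\<close>
  have "Gm \<i> h = 0"
  proof -
    have "((\<lambda>w. hnorm K (Gm w h - Gm \<i> h)) \<longlongrightarrow> 0) (at \<i>)" by (rule Gm_tendsto[OF i_nonreal(1) h])
    moreover have "\<forall>\<^sub>F w in at \<i>. hnorm K (Gm w h - Gm \<i> h) = hnorm K (Gm \<i> h)"
    proof -
      have "\<forall>\<^sub>F w in at \<i>. w \<noteq> \<i>" by (simp add: eventually_at_filter)
      with eventually_nonreal[OF i_nonreal(1)] show ?thesis
        by eventually_elim (simp add: 1 h)
    qed
    ultimately have "((\<lambda>w::complex. hnorm K (Gm \<i> h)) \<longlongrightarrow> 0) (at \<i>)" by (rule Lim_transform_eventually)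
    then have "hnorm K (Gm \<i> h) = 0" using tendsto_const_iff[of "at \<i>"] by auto
    then show ?thesis using h by simp
  qed
  then have "Gm z h = 0" if "z \<in> nonreal" for z using 1 that by blast
  then have "h = 0" using Gm_eq_0 h eq_0_if_Gs[OF h] by blast
  then show ?thesis using u(1) by (simp add: h_def)
qed

lemma W_dom: "W ` opdom T = opdom (mult_operator HV)"
proof
  show "W ` opdom T \<subseteq> opdom (mult_operator HV)"
  proof clarify
    fix g assume g: "g \<in> opdom T"
    show "W g \<in> opdom (mult_operator HV)"
      using g W_app[OF g, symmetric] by (simp add: mult_operator_def HV_car)
  qed
  show "opdom (mult_operator HV) \<subseteq> W ` opdom T"
    using mem_dom_if_mult by (auto simp: mult_operator_def HV_car)
qed

lemma W_intertwined: "intertwined H HV W T (mult_operator HV)"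
  by (intro intertwined.intro intertwined_axioms.intro W_unitary lin W_dom)
    (simp add: mult_operator_def W_app)

end

section \<open>Dependence of the Livsic function on the model\<close>

text \<open>
  Two models of unitarily equivalent operators differ by an invertible factor \<open>A z\<close> on the right.
  It cancels from \<open>\<Phi>\<^sup>-\<^sup>1 \<Psi>\<close> up to the unitary factors of the polar decompositions of
  \<open>K\<^sub>s(s)\<^sup>1\<^sup>/\<^sup>2 A s\<close> for \<open>s = \<i>\<close> and \<open>s = - \<i>\<close>.
\<close>

locale two_models =
  M1: livsic_model K H1 T1 \<Gamma>1 + M2: livsic_model K H2 T2 \<Gamma>2 + intertwined H1 H2 U T1 T2
  for K :: "'k::complex_vector hspace"
    and H1 :: "'a::complex_vector hspace" and T1 \<Gamma>1
    and H2 :: "'b::complex_vector hspace" and T2 \<Gamma>2 and U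
begin

definition A where "A z x = op_inv K (\<lambda>x. U (\<Gamma>1 z x)) (\<Gamma>2 z x)"

lemma range_inner: "inner_space (restr H2 (ortho H2 (op_range T2 z)))"
  by (intro M2.H.inner_restr M2.H.ortho_subspace M2.range_car) (auto simp: ortho_def)

lemma UG_invertible: "z \<in> nonreal \<Longrightarrow> invertible_op K (restr H2 (ortho H2 (op_range T2 z))) (\<lambda>x. U (\<Gamma>1 z x))"
  using is_model_U[OF M1.model M1.K.inner] by (simp add: is_model_def)

lemma A_invertible: "z \<in> nonreal \<Longrightarrow> invertible_op K K (A z)"
  unfolding A_def[abs_def]
  by (rule invertible_op_compose[OF M1.K.inner range_inner M1.K.inner M2.G_invertible
        invertible_op_op_inv[OF M1.K.inner range_inner UG_invertible]])

lemma A_car [simp]: "z \<in> nonreal \<Longrightarrow> x \<in> car K \<Longrightarrow> A z x \<in> car K"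
  using invertible_op_inv(4)[OF A_invertible] .

lemma G2_eq: "z \<in> nonreal \<Longrightarrow> x \<in> car K \<Longrightarrow> \<Gamma>2 z x = U (\<Gamma>1 z (A z x))"
  using invertible_op_inv(3)[OF UG_invertible, of z "\<Gamma>2 z x"] invertible_op_inv(4)[OF M2.G_invertible, of z x]
  by (simp add: A_def)

definition A' where "A' z = adj K K (A z)"

lemma adjA: "z \<in> nonreal \<Longrightarrow> adjoint_ops K K (A z) (A' z)"
  unfolding A'_def by (rule adjoint_ops_adj[OF M1.K.hilbert M1.K.inner invertible_op_inv(1)[OF A_invertible]])

lemma A'_invertible: "z \<in> nonreal \<Longrightarrow> invertible_op K K (A' z)"
  by (rule invertible_op_adjoint[OF M1.K.inner M1.K.hilbert adjA A_invertible])

lemma A'_car [simp]: "z \<in> nonreal \<Longrightarrow> x \<in> car K \<Longrightarrow> A' z x \<in> car K"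
  using adjoint_opsD(4)[OF adjA] .

lemma kernel2_eq:
  assumes "\<mu> \<in> nonreal" "z \<in> nonreal" "x \<in> car K"
  shows "M2.Gs z (\<Gamma>2 \<mu> x) = A' z (M1.Gs z (\<Gamma>1 \<mu> (A \<mu> x)))"
proof (rule M1.K.eq_by_ip)
  fix v assume v: "v \<in> car K"
  have "ip K v (M2.Gs z (\<Gamma>2 \<mu> x)) = ip H2 (\<Gamma>2 z v) (\<Gamma>2 \<mu> x)"
    using M2.ip_G[of z v "\<Gamma>2 \<mu> x"] assms v by simp
  also have "\<dots> = ip H1 (\<Gamma>1 z (A z v)) (\<Gamma>1 \<mu> (A \<mu> x))"
    using assms v by (simp add: G2_eq)
  also have "\<dots> = ip K (A z v) (M1.Gs z (\<Gamma>1 \<mu> (A \<mu> x)))"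
    using M1.ip_G[of z "A z v" "\<Gamma>1 \<mu> (A \<mu> x)"] assms v by simp
  also have "\<dots> = ip K v (A' z (M1.Gs z (\<Gamma>1 \<mu> (A \<mu> x))))"
    using assms v by (simp add: adjoint_opsD(5)[OF adjA])
  finally show "ip K v (M2.Gs z (\<Gamma>2 \<mu> x)) = ip K v (A' z (M1.Gs z (\<Gamma>1 \<mu> (A \<mu> x))))" .
qed (use assms in auto)

definition Q where "Q s x = M1.S s (A s (M2.R s x))"

lemma Q_car [simp]: "s \<in> nonreal \<Longrightarrow> x \<in> car K \<Longrightarrow> Q s x \<in> car K"
  by (simp add: Q_def)

lemma Q_invertible: "s \<in> nonreal \<Longrightarrow> invertible_op K K (Q s)"
  unfolding Q_def[abs_def]
  by (rule invertible_op_compose[OF M1.K.inner M1.K.inner M1.K.inner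
        invertible_op_compose[OF M1.K.inner M1.K.inner M1.K.inner M2.R_invertible A_invertible] M1.S_props(3)])

text \<open>By \<open>kernel2_eq\<close> at \<open>\<mu> = z = s\<close>, the operator
  \<open>A' s\<close> composed with the square of \<open>M1.S s\<close> and \<open>A s\<close> is
  the square of \<open>M2.S s\<close>; the factors \<open>M2.R s\<close> reduce it to the identity.
  Surjectivity comes from invertibility.\<close>

lemma Q_unitary:
  assumes s: "s \<in> nonreal"
  shows "unitary_op K K (Q s)"
  unfolding unitary_op_def
proof (intro conjI ballI)
  show "linear_on (car K) (Q s)" using bounded_op_linear[OF invertible_op_inv(1)[OF Q_invertible[OF s]]] .
  show "Q s ` car K = car K"
  proof
    show "car K \<subseteq> Q s ` car K"
      using invertible_op_inv(3,5)[OF Q_invertible[OF s]] by (metis image_eqI subsetI)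
  qed (use s in auto)
  fix x y assume x: "x \<in> car K" and y: "y \<in> car K"
  define u v where "u = M2.R s x" and "v = M2.R s y"
  have uv [simp]: "u \<in> car K" "v \<in> car K" "M2.S s u = x" "M2.S s v = y" using s x y by (auto simp: u_def v_def)
  have "ip K (Q s x) (Q s y) = ip K (A s u) (M1.S s (M1.S s (A s v)))"
    using adjoint_opsD(5)[OF M1.S_props(1)[OF s], of "A s u" "M1.S s (A s v)"] s
    by (simp add: Q_def flip: u_def v_def)
  also have "\<dots> = ip K (A s u) (M1.Gs s (\<Gamma>1 s (A s v)))" using M1.S_props(2)[OF s, of "A s v"] s by simp
  also have "\<dots> = ip K u (M2.Gs s (\<Gamma>2 s v))"
    using adjoint_opsD(5)[OF adjA[OF s], of u "M1.Gs s (\<Gamma>1 s (A s v))"] s by (simp add: kernel2_eq)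
  also have "\<dots> = ip K u (M2.S s y)" using M2.S_props(2)[OF s, of v] by simp
  also have "\<dots> = ip K x y"
    using adjoint_opsD(5)[OF M2.S_props(1)[OF s], of u y] s y by simp
  finally show "ip K (Q s x) (Q s y) = ip K x y" .
qed

text \<open>In \<open>kernel2_eq\<close> the product of \<open>M1.R s\<close> and
  \<open>M1.S s\<close>, which is the identity, is inserted in front of \<open>A s\<close>; the
  second half forms \<open>Q s\<close>.\<close>

lemma Th2_eq:
  assumes "s \<in> nonreal" "z \<in> nonreal" "x \<in> car K"
  shows "M2.Th s z x = A' z (M1.Th s z (Q s x))"
  using assms by (simp add: M2.Th_def M1.Th_def kernel2_eq Q_def)

lemma Th_car [simp]: "s \<in> nonreal \<Longrightarrow> z \<in> nonreal \<Longrightarrow> x \<in> car K \<Longrightarrow> M1.Th s z x \<in> car K"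
  by (simp add: M1.Th_def)

lemma Th_invertible_iff:
  assumes s: "s \<in> nonreal" and z: "z \<in> nonreal"
  shows "invertible_op K K (M2.Th s z) \<longleftrightarrow> invertible_op K K (M1.Th s z)"
proof
  note c = invertible_op_compose[OF M1.K.inner M1.K.inner M1.K.inner]
  note Qi = invertible_op_op_inv[OF M1.K.inner M1.K.inner Q_invertible[OF s]]
    and Ai = invertible_op_op_inv[OF M1.K.inner M1.K.inner A'_invertible[OF z]]
  show "invertible_op K K (M2.Th s z)" if "invertible_op K K (M1.Th s z)"
    by (rule invertible_op_cong[OF M1.K.inner c[OF c[OF Q_invertible[OF s] that] A'_invertible[OF z]]])
      (simp add: Th2_eq s z)
  show "invertible_op K K (M1.Th s z)" if "invertible_op K K (M2.Th s z)"
    by (rule invertible_op_cong[OF M1.K.inner c[OF c[OF Qi that] Ai]])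
      (use s z invertible_op_inv[OF Q_invertible[OF s]] invertible_op_inv[OF A'_invertible[OF z]] in \<open>simp add: Th2_eq\<close>)
qed

text \<open>\<open>A' z\<close> cancels between \<open>\<Phi>\<close> and \<open>\<Psi>\<close>,
  leaving only \<open>Q \<i>\<close> and \<open>Q (- \<i>)\<close>. By
  \<open>Th_invertible_iff\<close> both models take the default value 0 at the same points.\<close>

lemma livsic_eq:
  assumes z: "z \<in> nonreal" and x: "x \<in> car K"
  shows "livsic K H2 \<Gamma>2 z x = op_inv K (Q \<i>) (livsic K H1 \<Gamma>1 z (Q (- \<i>) x))"
proof -
  note i = M1.i_nonreal
  note Qi = invertible_op_inv[OF Q_invertible[OF i(1)]]
  note Qb = bounded_op_op_inv[OF M1.K.inner Q_invertible[OF i(1)]]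
  show ?thesis
  proof (cases "z \<noteq> - \<i> \<and> invertible_op K K (M1.Th \<i> z)")
    case True
    then have inv1: "invertible_op K K (M1.Th \<i> z)" and inv2: "invertible_op K K (M2.Th \<i> z)"
      using Th_invertible_iff[OF i(1) z] by auto
    note I1 = invertible_op_inv[OF inv1] and I2 = invertible_op_inv[OF inv2]
    define w where "w = op_inv K (M1.Th \<i> z) (M1.Th (- \<i>) z (Q (- \<i>) x))"
    have w: "w \<in> car K" "M1.Th \<i> z w = M1.Th (- \<i>) z (Q (- \<i>) x)" using I1 z x by (auto simp: w_def)
    have "M2.Th \<i> z (op_inv K (Q \<i>) w) = M2.Th (- \<i>) z x" using Qi w z x by (simp add: Th2_eq)
    then have "op_inv K (M2.Th \<i> z) (M2.Th (- \<i>) z x) = op_inv K (Q \<i>) w"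
      using I2(2)[of "op_inv K (Q \<i>) w"] Qi(5)[OF w(1)] by simp
    then show ?thesis
      using True inv2 bounded_op_scaleC[OF Qb w(1)]
      by (simp add: livsic_def M1.model_Phi_eq M1.model_Psi_eq M2.model_Phi_eq M2.model_Psi_eq w_def)
  next
    case False
    then have "\<not> (z \<noteq> - \<i> \<and> invertible_op K K (M2.Th \<i> z))" using Th_invertible_iff[OF i(1) z] by simp
    then have "livsic K H2 \<Gamma>2 z = (\<lambda>x. 0)" "livsic K H1 \<Gamma>1 z = (\<lambda>x. 0)"
      using False unfolding livsic_def M1.model_Phi_eq M2.model_Phi_eq by (simp_all only: if_False)
    then show ?thesis using bounded_op_zero[OF M1.K.inner Qb] by simp
  qed
qed

lemma livsic_equiv_livsic:
  assumes "\<And>z x. z \<in> nonreal \<Longrightarrow> x \<in> car K \<Longrightarrow> V z x = livsic K H1 \<Gamma>1 z x"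
    and "\<And>z x. z \<in> nonreal \<Longrightarrow> x \<in> car K \<Longrightarrow> W z x = livsic K H2 \<Gamma>2 z x"
  shows "livsic_equiv K V W"
  unfolding livsic_equiv_def
proof (intro exI conjI ballI)
  interpret Q: cunitary K K "Q \<i>"
    by (intro cunitary.intro cunitary_axioms.intro cinner.intro M1.K.inner Q_unitary M1.i_nonreal)
  show "unitary_op K K (op_inv K (Q \<i>))" using Q.unitary_Ui by (simp add: Q.Ui_def)
  show "unitary_op K K (Q (- \<i>))" by (rule Q_unitary[OF M1.i_nonreal(2)])
  show "W z x = op_inv K (Q \<i>) (V z (Q (- \<i>) x))" if "z \<in> nonreal" "x \<in> car K" for z x
    using that by (simp add: assms livsic_eq)
qed

end

lemma livsic_modelI:
  assumes "T \<in> \<S>\<^bsub>n\<^esub> H" "hilbert_space K" "is_model K H T \<Gamma>"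
  shows "livsic_model K H T \<Gamma>"
  using assms
  by (intro livsic_model.intro livsic_model_axioms.intro closed_symmetric.intro
      closed_symmetric_axioms.intro chilbert.intro)
    (simp_all add: sym_class_def separable_hilbert_space_def)

theorem theorem6p3:
  fixes n :: enat
    and H :: "'h::complex_vector hspace" and T :: "'h lin_op"
    and K :: "'k::complex_vector hspace" and V :: "complex \<Rightarrow> 'k \<Rightarrow> 'k"
  assumes "T \<in> \<S>\<^bsub>n\<^esub> H"
    and "separable_hilbert_space K" and "has_hdim K n"
    and "is_livsic_function K H T V"
  shows "unitarily_equivalent H T (herglotz_space K V) (mult_operator (herglotz_space K V)) \<and>
    mult_operator (herglotz_space K V) \<in> \<S>\<^bsub>n\<^esub> (herglotz_space K V) \<and>
    (\<exists>W. is_livsic_function K (herglotz_space K V) (mult_operator (herglotz_space K V)) W) \<and>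
    (\<forall>W. is_livsic_function K (herglotz_space K V) (mult_operator (herglotz_space K V)) W \<longrightarrow>
       livsic_equiv K V W)"
proof -
  have K: "hilbert_space K" using assms(2) by (simp add: separable_hilbert_space_def)
  obtain \<Gamma> where \<Gamma>: "is_model K H T \<Gamma>" and V: "\<And>z x. z \<in> nonreal \<Longrightarrow> x \<in> car K \<Longrightarrow> V z x = livsic K H \<Gamma> z x"
    using assms(4) by (auto simp: is_livsic_function_def)
  interpret livsic_function K H T \<Gamma> V
    by (intro livsic_function.intro livsic_function_axioms.intro livsic_modelI[OF assms(1) K \<Gamma>] V)
  interpret I: intertwined H HV W T "mult_operator HV" by (rule W_intertwined)
  have 1: "unitarily_equivalent H T HV (mult_operator HV)"
    unfolding unitarily_equivalent_def using I.unitary I.dom I.app by blast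
  have 2: "mult_operator HV \<in> \<S>\<^bsub>n\<^esub> HV" by (rule I.sym_class_U[OF assms(1)])
  \<comment> \<open>The transported model witnesses that a Livsic function of the multiplication
    operator exists.\<close>
  have 3: "is_livsic_function K HV (mult_operator HV) (livsic K HV (\<lambda>\<mu> x. W (\<Gamma> \<mu> x)))"
    unfolding is_livsic_function_def using I.is_model_U[OF \<Gamma> K.inner] by blast
  \<comment> \<open>An arbitrary model \<open>\<Gamma>2\<close> of the multiplication operator is
    compared directly with the model \<open>\<Gamma>\<close> of \<open>T\<close> through the unitary
    \<open>W\<close>.\<close>
  have 4: "livsic_equiv K V W'" if "is_livsic_function K HV (mult_operator HV) W'" for W'
  proof -
    obtain \<Gamma>2 where \<Gamma>2: "is_model K HV (mult_operator HV) \<Gamma>2"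
      and W': "\<And>z x. z \<in> nonreal \<Longrightarrow> x \<in> car K \<Longrightarrow> W' z x = livsic K HV \<Gamma>2 z x"
      using \<open>is_livsic_function K HV (mult_operator HV) W'\<close> by (auto simp: is_livsic_function_def)
    interpret two_models K H T \<Gamma> HV "mult_operator HV" \<Gamma>2 W
      by (intro two_models.intro livsic_model_axioms livsic_modelI[OF 2 K \<Gamma>2] W_intertwined)
    show ?thesis by (rule livsic_equiv_livsic[OF V W'])
  qed
  show ?thesis unfolding herglotz_space_eq using 1 2 3 4 by blast
qed

end
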